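(* Set \[ \alpha=\frac13+10^{-12}\sqrt2,\qquad \beta=\frac13+10^{-12}\sqrt3 . \] There exist a nonzero complex-valued Schwartz function $f\in\mathcal S(\mathbb R)$ and a scalar $\lambda\in\mathbb C\setminus\{0\}$ such that \[ \left(I+\frac12W(1,0)+\frac12W(0,1/2)\right)W(\alpha,\beta/2)f=\lambda f . \]
   Context: For $(a,b)\in\mathbb R^2$, the Weyl time--frequency shift $W(a,b)$ is the operator on $L^2(\mathbb R)$ (complex-valued functions) given by \[ (W(a,b)f)(t)=e^{2\pi i b(t-a/2)}f(t-a). \] $I$ is the identity operator. *)

theory Defs
  imports "HOL-Analysis.Analysis"
begin

definition nth_vderiv :: "nat \<Rightarrow> (real \<Rightarrow> complex) \<Rightarrow> real \<Rightarrow> complex" where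
  "nth_vderiv n f = ((\<lambda>g t. vector_derivative g (at t)) ^^ n) f"

(* The differentiability conjunct is needed because vector_derivative is an
   unspecified value at points where the function is not differentiable. *)
definition schwartz :: "(real \<Rightarrow> complex) \<Rightarrow> bool" where
  "schwartz f \<longleftrightarrow>
     (\<forall>n t. nth_vderiv n f differentiable (at t)) \<and>
     (\<forall>k n. bounded (range (\<lambda>t. t ^ k *\<^sub>R nth_vderiv n f t)))"

(* W(a,b), acting on functions rather than on almost-everywhere classes in L^2.
   It maps Schwartz functions to Schwartz functions; two continuous functions
   agree in L^2 iff they agree at every point. *)
definition weyl :: "real \<Rightarrow> real \<Rightarrow> (real \<Rightarrow> complex) \<Rightarrow> real \<Rightarrow> complex" where
  "weyl a b f t = exp (2 * complex_of_real pi * \<i> * complex_of_real (b * (t - a / 2))) * f (t - a)"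

definition trinomial_op :: "(real \<Rightarrow> complex) \<Rightarrow> real \<Rightarrow> complex" where
  "trinomial_op f t = f t + 1 / 2 * weyl 1 0 f t + 1 / 2 * weyl 0 (1 / 2) f t"

end

theory Submission
  imports Defs "HOL-Complex_Analysis.Complex_Analysis" "HOL-Computational_Algebra.Primes"
begin

text \<open>
  Integrating a smooth function \<open>G(t, y)\<close> with \<open>G(t + 2, y) = exp(2 \<pi> \<i> y) G(t, y)\<close> and period \<open>1\<close> in \<open>y\<close> over \<open>y\<close>
  gives a Schwartz function of \<open>t\<close>, and the operator becomes a weighted shift of \<open>G\<close> by \<open>(\<alpha>, \<beta>)\<close>. Three times this
  shift is the period \<open>(1, 1)\<close> up to a tiny vector \<open>e\<close>, so the cube of the operator acts on the vector with entries \<open>G(t, y)\<close>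
  and \<open>\<omega> G(t - 1, y)\<close>, \<open>\<omega> = exp(\<i> \<pi> / 3)\<close>, as a two-by-two matrix cocycle over the translation by \<open>e\<close>. For \<open>e = 0\<close> the two
  eigenvalues have different modulus everywhere on the torus; hence an invariant line field persists for small \<open>e\<close>, and
  it is analytic since it is the limit of a contraction on a complex strip. Projecting a bump function to this line field
  gives a nonvanishing section, on which the cube acts as multiplication by a periodic function \<open>M\<close> with positive real part.
  The translation vector \<open>e\<close>, a rational multiple of \<open>(\<surd>2, \<surd>3)\<close>, is Diophantine, so \<open>Ln M\<close> is cohomologous to a constant, and multiplying the
  section by the exponential of the solution gives an eigenfunction of the cube. Projecting it to the eigenspaces
  of the three cube roots of the eigenvalue gives an eigenfunction of the operator itself.
\<close>

section \<open>Smooth functions of two real variables\<close>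

text \<open>The pairs \<open>(G(t, y), \<omega> G(t - 1, y))\<close> are sections of a plane bundle
  over the torus, glued by a matrix whose determinant has winding number one, up to sign, in
  \<open>y\<close>. The bundle has odd degree, so the two eigenline fields cannot both have a
  nonvanishing section. The field of the smaller eigenvalue has one, so the construction uses this
  field, although the cocycle repels it. Hence the graph transform runs backwards, with adjugates in
  place of inverses: they exchange the two eigenvalues, so that the line of the smaller one becomes
  attracting. Contraction in the supremum norm on the real torus would give only a continuous field,
  too little against small divisors; on a complex strip the same contraction yields holomorphy,
  because the translation is real and uniform limits of holomorphic functions are holomorphic. The
  positive real part of \<open>M\<close> excludes a winding number and makes \<open>Ln M\<close>
  periodic. It comes from explicit estimates: \<open>M\<close> is close to \<i> times the smaller
  eigenvalue, and on the torus this product stays in the right half plane.\<close>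

primrec Ck2 :: "nat \<Rightarrow> (real \<Rightarrow> real \<Rightarrow> complex) \<Rightarrow> bool" where
  "Ck2 0 f \<longleftrightarrow> continuous_on UNIV (\<lambda>p. f (fst p) (snd p))"
| "Ck2 (Suc n) f \<longleftrightarrow> continuous_on UNIV (\<lambda>p. f (fst p) (snd p)) \<and>
     (\<exists>f1 f2. (\<forall>t y. ((\<lambda>t. f t y) has_vector_derivative f1 t y) (at t)) \<and>
              (\<forall>t y. (f t has_vector_derivative f2 t y) (at y)) \<and> Ck2 n f1 \<and> Ck2 n f2)"

text \<open>\<open>Ck2\<close> speaks of partial derivatives along the two axes only, so every
  closure property is an induction on the order that uses one-variable calculus.\<close>

definition smooth2 :: "(real \<Rightarrow> real \<Rightarrow> complex) \<Rightarrow> bool" where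
  "smooth2 f \<longleftrightarrow> (\<forall>n. Ck2 n f)"

definition dt :: "(real \<Rightarrow> real \<Rightarrow> complex) \<Rightarrow> real \<Rightarrow> real \<Rightarrow> complex" where
  "dt f t y = vector_derivative (\<lambda>t. f t y) (at t)"

definition dy :: "(real \<Rightarrow> real \<Rightarrow> complex) \<Rightarrow> real \<Rightarrow> real \<Rightarrow> complex" where
  "dy f t y = vector_derivative (f t) (at y)"

lemma Ck2_continuous: "Ck2 n f \<Longrightarrow> continuous_on UNIV (\<lambda>p. f (fst p) (snd p))"
  by (cases n) auto

lemma Ck2_Suc_D: "Ck2 (Suc n) f \<Longrightarrow> Ck2 n f"
proof (induction n arbitrary: f)
  case 0 then show ?case by simp
next
  case (Suc n)
  from Suc.prems obtain f1 f2 where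
    "\<forall>t y. ((\<lambda>t. f t y) has_vector_derivative f1 t y) (at t)"
    "\<forall>t y. (f t has_vector_derivative f2 t y) (at y)" "Ck2 (Suc n) f1" "Ck2 (Suc n) f2"
    unfolding Ck2.simps(2)[of "Suc n"] by blast
  with Suc.IH[of f1] Suc.IH[of f2] Ck2_continuous[OF Suc.prems] show ?case
    by auto
qed

lemma Ck2_SucI:
  assumes "\<And>t y. ((\<lambda>t. f t y) has_vector_derivative ft t y) (at t)"
    and "\<And>t y. (f t has_vector_derivative fy t y) (at y)"
    and "Ck2 n ft" "Ck2 n fy" "continuous_on UNIV (\<lambda>p. f (fst p) (snd p))"
  shows "Ck2 (Suc n) f"
  using assms by auto

lemma Ck2_SucE:
  assumes "Ck2 (Suc n) f"
  obtains f1 f2 where "\<And>t y. ((\<lambda>t. f t y) has_vector_derivative f1 t y) (at t)"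
    "\<And>t y. (f t has_vector_derivative f2 t y) (at y)" "Ck2 n f1" "Ck2 n f2" "Ck2 n f"
    "continuous_on UNIV (\<lambda>p. f (fst p) (snd p))"
  using assms Ck2_Suc_D[OF assms] by auto

lemma smooth2_continuous: "smooth2 f \<Longrightarrow> continuous_on UNIV (\<lambda>p. f (fst p) (snd p))"
  unfolding smooth2_def using Ck2_continuous by blast

lemma continuous_on_slice2:
  assumes "continuous_on UNIV (\<lambda>p. f (fst p) (snd p))"
  shows "continuous_on S (f t)"
  using continuous_on_compose2[OF assms, of S "\<lambda>y. (t, y)"] by (simp add: continuous_on_Pair continuous_on_const)

lemma smooth2_dt_deriv: "smooth2 f \<Longrightarrow> ((\<lambda>t. f t y) has_vector_derivative dt f t y) (at t)"
  unfolding smooth2_def dt_def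
  by (metis Ck2.simps(2) vector_derivative_at)

lemma smooth2_dy_deriv: "smooth2 f \<Longrightarrow> (f t has_vector_derivative dy f t y) (at y)"
  unfolding smooth2_def dy_def
  by (metis Ck2.simps(2) vector_derivative_at)

lemma smooth2_dt: assumes "smooth2 f" shows "smooth2 (dt f)"
  unfolding smooth2_def
proof
  fix n
  have "Ck2 (Suc n) f" using assms by (simp add: smooth2_def)
  then obtain f1 f2 where 1: "\<And>t y. ((\<lambda>t. f t y) has_vector_derivative f1 t y) (at t)" "Ck2 n f1"
    by (elim Ck2_SucE) blast
  have "f1 = dt f"
    by (rule ext)+ (simp add: dt_def vector_derivative_at[OF 1(1)])
  with 1(2) show "Ck2 n (dt f)" by simp
qed

lemma smooth2_dy: assumes "smooth2 f" shows "smooth2 (dy f)"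
  unfolding smooth2_def
proof
  fix n
  have "Ck2 (Suc n) f" using assms by (simp add: smooth2_def)
  then obtain f1 f2 where 1: "\<And>t y. (f t has_vector_derivative f2 t y) (at y)" "Ck2 n f2"
    by (elim Ck2_SucE) blast
  have "f2 = dy f"
    by (rule ext)+ (simp add: dy_def vector_derivative_at[OF 1(1)])
  with 1(2) show "Ck2 n (dy f)" by simp
qed

section \<open>Closure under algebra, composition and translation\<close>

lemma Ck2_const: "Ck2 n (\<lambda>t y. c)"
proof (induction n arbitrary: c)
  case (Suc n)
  show ?case by (rule Ck2_SucI[where ft="\<lambda>t y. 0" and fy="\<lambda>t y. 0"]) (auto intro: Suc)
qed simp

lemma Ck2_add: "Ck2 n f \<Longrightarrow> Ck2 n g \<Longrightarrow> Ck2 n (\<lambda>t y. f t y + g t y)"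
proof (induction n arbitrary: f g)
  case 0 then show ?case by (simp add: continuous_on_add)
next
  case (Suc n)
  from Suc.prems(1) obtain f1 f2 where f: "\<And>t y. ((\<lambda>t. f t y) has_vector_derivative f1 t y) (at t)"
    "\<And>t y. (f t has_vector_derivative f2 t y) (at y)" "Ck2 n f1" "Ck2 n f2"
    "continuous_on UNIV (\<lambda>p. f (fst p) (snd p))" by (elim Ck2_SucE) blast
  from Suc.prems(2) obtain g1 g2 where g: "\<And>t y. ((\<lambda>t. g t y) has_vector_derivative g1 t y) (at t)"
    "\<And>t y. (g t has_vector_derivative g2 t y) (at y)" "Ck2 n g1" "Ck2 n g2"
    "continuous_on UNIV (\<lambda>p. g (fst p) (snd p))" by (elim Ck2_SucE) blast
  show ?case
    by (rule Ck2_SucI[where ft="\<lambda>t y. f1 t y + g1 t y" and fy="\<lambda>t y. f2 t y + g2 t y"])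
      (intro has_vector_derivative_add continuous_on_add f g Suc.IH)+
qed

lemma Ck2_mult: "Ck2 n f \<Longrightarrow> Ck2 n g \<Longrightarrow> Ck2 n (\<lambda>t y. f t y * g t y)"
proof (induction n arbitrary: f g)
  case 0 then show ?case by (simp add: continuous_on_mult)
next
  case (Suc n)
  from Suc.prems(1) obtain f1 f2 where f: "\<And>t y. ((\<lambda>t. f t y) has_vector_derivative f1 t y) (at t)"
    "\<And>t y. (f t has_vector_derivative f2 t y) (at y)" "Ck2 n f1" "Ck2 n f2" "Ck2 n f"
    "continuous_on UNIV (\<lambda>p. f (fst p) (snd p))" by (elim Ck2_SucE) blast
  from Suc.prems(2) obtain g1 g2 where g: "\<And>t y. ((\<lambda>t. g t y) has_vector_derivative g1 t y) (at t)"
    "\<And>t y. (g t has_vector_derivative g2 t y) (at y)" "Ck2 n g1" "Ck2 n g2" "Ck2 n g"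
    "continuous_on UNIV (\<lambda>p. g (fst p) (snd p))" by (elim Ck2_SucE) blast
  show ?case
  proof (rule Ck2_SucI[where ft="\<lambda>t y. f t y * g1 t y + f1 t y * g t y"
        and fy="\<lambda>t y. f t y * g2 t y + f2 t y * g t y"])
    show "((\<lambda>t. f t y * g t y) has_vector_derivative f t y * g1 t y + f1 t y * g t y) (at t)" for t y
      by (intro has_vector_derivative_mult f g)
    show "((\<lambda>y. f t y * g t y) has_vector_derivative f t y * g2 t y + f2 t y * g t y) (at y)" for t y
      by (intro has_vector_derivative_mult f g)
    show "continuous_on UNIV (\<lambda>p. f (fst p) (snd p) * g (fst p) (snd p))"
      by (intro continuous_intros f g)
  qed (intro Ck2_add Suc.IH f g)+
qed

lemma Ck2_cnj: "Ck2 n f \<Longrightarrow> Ck2 n (\<lambda>t y. cnj (f t y))"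
proof (induction n arbitrary: f)
  case 0 then show ?case by (simp add: continuous_on_cnj)
next
  case (Suc n)
  from Suc.prems obtain f1 f2 where f: "\<And>t y. ((\<lambda>t. f t y) has_vector_derivative f1 t y) (at t)"
    "\<And>t y. (f t has_vector_derivative f2 t y) (at y)" "Ck2 n f1" "Ck2 n f2"
    "continuous_on UNIV (\<lambda>p. f (fst p) (snd p))" by (elim Ck2_SucE) blast
  show ?case
    by (rule Ck2_SucI[where ft="\<lambda>t y. cnj (f1 t y)" and fy="\<lambda>t y. cnj (f2 t y)"])
      (intro has_vector_derivative_cnj continuous_on_cnj f Suc.IH)+
qed

text \<open>Chain rule by induction on the order. The second hypothesis lets the regularity of
  \<open>\<phi>' (f t y)\<close> be derived from that of \<open>\<phi> (f t y)\<close> of the same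
  order, which suits \<open>exp\<close> and \<open>inverse\<close>, whose derivatives are
  polynomials in the function itself.\<close>

lemma Ck2_compose_field:
  assumes \<phi>: "\<And>t y. (\<phi> has_field_derivative \<phi>' (f t y)) (at (f t y))"
    and IH: "\<And>m. m \<le> n \<Longrightarrow> Ck2 m f \<Longrightarrow> Ck2 m (\<lambda>t y. \<phi> (f t y)) \<Longrightarrow> Ck2 m (\<lambda>t y. \<phi>' (f t y))"
    and f: "Ck2 n f"
  shows "Ck2 n (\<lambda>t y. \<phi> (f t y))"
  using IH f
proof (induction n)
  case 0
  have c: "isCont \<phi> (f t y)" for t y using \<phi> DERIV_isCont by blast
  have "continuous_on UNIV (\<lambda>p. f (fst p) (snd p))" using 0 by simp
  then show ?case
    unfolding Ck2.simps continuous_on_eq_continuous_at[OF open_UNIV]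
    using c isCont_o2 by blast
next
  case (Suc n)
  from Suc.prems(2) obtain f1 f2 where f: "\<And>t y. ((\<lambda>t. f t y) has_vector_derivative f1 t y) (at t)"
    "\<And>t y. (f t has_vector_derivative f2 t y) (at y)" "Ck2 n f1" "Ck2 n f2" "Ck2 n f"
    "continuous_on UNIV (\<lambda>p. f (fst p) (snd p))" by (elim Ck2_SucE) blast
  have n: "Ck2 n (\<lambda>t y. \<phi> (f t y))" using Suc f by simp
  have n': "Ck2 n (\<lambda>t y. \<phi>' (f t y))" using Suc.prems(1)[of n] f n by simp
  show ?case
  proof (rule Ck2_SucI[where ft="\<lambda>t y. f1 t y * \<phi>' (f t y)" and fy="\<lambda>t y. f2 t y * \<phi>' (f t y)"])
    show "((\<lambda>t. \<phi> (f t y)) has_vector_derivative f1 t y * \<phi>' (f t y)) (at t)" for t y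
      using field_vector_diff_chain_at[OF f(1) \<phi>] by (simp add: o_def)
    show "((\<lambda>y. \<phi> (f t y)) has_vector_derivative f2 t y * \<phi>' (f t y)) (at y)" for t y
      using field_vector_diff_chain_at[OF f(2) \<phi>] by (simp add: o_def)
  qed (use n n' f Ck2_continuous[OF n] in \<open>auto intro: Ck2_mult\<close>)
qed

lemma Ck2_inverse:
  assumes "Ck2 n f" "\<And>t y. f t y \<noteq> 0"
  shows "Ck2 n (\<lambda>t y. inverse (f t y))"
proof (rule Ck2_compose_field[where \<phi>=inverse and \<phi>'="\<lambda>z. - (inverse z * inverse z)"])
  show "(inverse has_field_derivative - (inverse (f t y) * inverse (f t y))) (at (f t y))" for t y
    using assms(2) by (auto intro!: derivative_eq_intros)
  show "Ck2 m (\<lambda>t y. - (inverse (f t y) * inverse (f t y)))" if "Ck2 m (\<lambda>t y. inverse (f t y))" for m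
    using Ck2_mult[OF Ck2_const[of _ "-1"] Ck2_mult[OF that that]] by simp
qed (rule assms)

lemma Ck2_exp: "Ck2 n f \<Longrightarrow> Ck2 n (\<lambda>t y. exp (f t y))"
  by (rule Ck2_compose_field[where \<phi>=exp and \<phi>'=exp]) (auto intro: DERIV_exp)

lemma Ck2_Ln:
  assumes "Ck2 n f" "\<And>t y. Re (f t y) > 0"
  shows "Ck2 n (\<lambda>t y. Ln (f t y))"
proof (rule Ck2_compose_field[where \<phi>=Ln and \<phi>'=inverse])
  have nz: "f t y \<notin> \<real>\<^sub>\<le>\<^sub>0" for t y
    using assms(2)[of t y] by (auto simp: complex_nonpos_Reals_iff)
  then show "(Ln has_field_derivative inverse (f t y)) (at (f t y))" for t y
    by (rule has_field_derivative_Ln)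
  show "Ck2 m (\<lambda>t y. inverse (f t y))" if "Ck2 m f" for m
    using that
  proof (rule Ck2_inverse)
    show "f t y \<noteq> 0" for t y using assms(2)[of t y] by (metis less_irrefl zero_complex.simps(1))
  qed
qed (rule assms)

lemma Ck2_translate: "Ck2 n f \<Longrightarrow> Ck2 n (\<lambda>t y. f (t + a) (y + b))"
proof (induction n arbitrary: f)
  case 0
  then show ?case
    using continuous_on_compose2[of UNIV "\<lambda>p. f (fst p) (snd p)" UNIV "\<lambda>p. (fst p + a, snd p + b)"]
    by (simp add: continuous_on_Pair continuous_on_add continuous_on_fst continuous_on_snd continuous_on_const continuous_on_id)
next
  case (Suc n)
  from Suc.prems obtain f1 f2 where f: "\<And>t y. ((\<lambda>t. f t y) has_vector_derivative f1 t y) (at t)"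
    "\<And>t y. (f t has_vector_derivative f2 t y) (at y)" "Ck2 n f1" "Ck2 n f2"
    "continuous_on UNIV (\<lambda>p. f (fst p) (snd p))" by (elim Ck2_SucE) blast
  have s: "((\<lambda>x. x + c) has_real_derivative 1) (at x)" for c x :: real
    by (auto intro!: derivative_eq_intros)
  show ?case
  proof (rule Ck2_SucI[where ft="\<lambda>t y. f1 (t + a) (y + b)" and fy="\<lambda>t y. f2 (t + a) (y + b)"])
    show "((\<lambda>t. f (t + a) (y + b)) has_vector_derivative f1 (t + a) (y + b)) (at t)" for t y
      using vector_diff_chain_at[OF s[THEN has_real_derivative_iff_has_vector_derivative[THEN iffD1]] f(1)]
      by (simp add: o_def)
    show "((\<lambda>y. f (t + a) (y + b)) has_vector_derivative f2 (t + a) (y + b)) (at y)" for t y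
      using vector_diff_chain_at[OF s[THEN has_real_derivative_iff_has_vector_derivative[THEN iffD1]] f(2)]
      by (simp add: o_def)
    show "continuous_on UNIV (\<lambda>p. f (fst p + a) (snd p + b))"
      using continuous_on_compose2[of UNIV "\<lambda>p. f (fst p) (snd p)" UNIV "\<lambda>p. (fst p + a, snd p + b)"] f(5)
      by (simp add: continuous_on_Pair continuous_on_add continuous_on_fst continuous_on_snd continuous_on_const continuous_on_id)
  qed (use Suc.IH f in auto)
qed

lemma Ck2_linear: "Ck2 n (\<lambda>t y. a * of_real t + b * of_real y + (c::complex))"

proof (cases n)
  case (Suc m)
  have 1: "((\<lambda>t. a * of_real t + b * of_real y + c) has_vector_derivative a) (at t)" for t y :: real
    unfolding has_vector_derivative_def
    by (auto intro!: derivative_eq_intros simp: scaleR_conv_of_real)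
  have 2: "((\<lambda>y. a * of_real t + b * of_real y + c) has_vector_derivative b) (at y)" for t y :: real
    unfolding has_vector_derivative_def
    by (auto intro!: derivative_eq_intros simp: scaleR_conv_of_real)
  show ?thesis unfolding Suc
    by (rule Ck2_SucI[OF 1 2 Ck2_const Ck2_const]) (intro continuous_intros)
qed (simp add: continuous_intros)

named_theorems smooth2_intros

lemma smooth2_const [smooth2_intros]: "smooth2 (\<lambda>t y. c)"
  and smooth2_add [smooth2_intros]: "smooth2 f \<Longrightarrow> smooth2 g \<Longrightarrow> smooth2 (\<lambda>t y. f t y + g t y)"
  and smooth2_mult [smooth2_intros]: "smooth2 f \<Longrightarrow> smooth2 g \<Longrightarrow> smooth2 (\<lambda>t y. f t y * g t y)"
  and smooth2_cnj [smooth2_intros]: "smooth2 f \<Longrightarrow> smooth2 (\<lambda>t y. cnj (f t y))"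
  and smooth2_exp [smooth2_intros]: "smooth2 f \<Longrightarrow> smooth2 (\<lambda>t y. exp (f t y))"
  and smooth2_inverse: "smooth2 f \<Longrightarrow> (\<And>t y. f t y \<noteq> 0) \<Longrightarrow> smooth2 (\<lambda>t y. inverse (f t y))"
  and smooth2_Ln: "smooth2 f \<Longrightarrow> (\<And>t y. Re (f t y) > 0) \<Longrightarrow> smooth2 (\<lambda>t y. Ln (f t y))"
  and smooth2_translate: "smooth2 f \<Longrightarrow> smooth2 (\<lambda>t y. f (t + a) (y + b))"
  and smooth2_linear: "\<And>a b c :: complex. smooth2 (\<lambda>t y. a * of_real t + b * of_real y + c)"
  by (auto simp: smooth2_def intro: Ck2_const Ck2_add Ck2_mult Ck2_cnj Ck2_exp Ck2_inverse
      Ck2_Ln Ck2_translate Ck2_linear)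

lemma smooth2_minus [smooth2_intros]: "smooth2 f \<Longrightarrow> smooth2 (\<lambda>t y. - f t y)"
  using smooth2_mult[OF smooth2_const[of "-1"]] by simp

lemma smooth2_diff [smooth2_intros]:
  "smooth2 f \<Longrightarrow> smooth2 g \<Longrightarrow> smooth2 (\<lambda>t y. f t y - g t y)"
  using smooth2_add[OF _ smooth2_minus, of f g] by simp

lemma smooth2_sum [smooth2_intros]:
  "(\<And>i. i \<in> I \<Longrightarrow> smooth2 (f i)) \<Longrightarrow> smooth2 (\<lambda>t y. \<Sum>i\<in>I. f i t y)"
  by (induction I rule: infinite_finite_induct) (auto intro: smooth2_intros)

text \<open>Spares an induction on the order for each class closed under both derivatives:
  restrictions of holomorphic functions, rapidly convergent Fourier series, functions with swapped
  arguments, locally smooth functions.\<close>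

lemma smooth2_coinduct:
  assumes "P f"
    and "\<And>f. P f \<Longrightarrow> continuous_on UNIV (\<lambda>p. f (fst p) (snd p)) \<and>
     (\<exists>f1 f2. (\<forall>t y. ((\<lambda>t. f t y) has_vector_derivative f1 t y) (at t)) \<and>
              (\<forall>t y. (f t has_vector_derivative f2 t y) (at y)) \<and> P f1 \<and> P f2)"
  shows "smooth2 f"
proof -
  have "Ck2 n f" for n
    using assms(1)
  proof (induction n arbitrary: f)
    case 0 then show ?case using assms(2) by simp
  next
    case (Suc n)
    then show ?case unfolding Ck2.simps using assms(2)[OF Suc.prems] by blast
  qed
  then show ?thesis by (simp add: smooth2_def)
qed

section \<open>Holomorphic functions on strips\<close>

definition strip :: "real \<Rightarrow> complex set" where
  "strip k = {z. \<bar>Im z\<bar> < k}"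

text \<open>Holomorphy in each variable separately plus a common bound: Cauchy estimates turn the
  bound into joint regularity, so one-variable theory suffices.\<close>

definition strip_holo :: "real \<Rightarrow> real \<Rightarrow> (complex \<Rightarrow> complex \<Rightarrow> complex) \<Rightarrow> bool" where
  "strip_holo k B f \<longleftrightarrow> (\<forall>z\<in>strip k. \<forall>w\<in>strip k. norm (f z w) \<le> B) \<and>
     (\<forall>w\<in>strip k. (\<lambda>z. f z w) holomorphic_on strip k) \<and> (\<forall>z\<in>strip k. f z holomorphic_on strip k)"

lemma open_strip: "open (strip k)"
  unfolding strip_def by (intro open_Collect_less continuous_intros)

lemma convex_strip: "convex (strip k)"
proof -
  have "strip k = {z. Im z < k} \<inter> {z. Im z > - k}" by (auto simp: strip_def)
  then show ?thesis by (simp add: convex_Int convex_halfspace_Im_lt convex_halfspace_Im_gt)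
qed

lemma strip_mono: "k \<le> l \<Longrightarrow> strip k \<subseteq> strip l"
  by (auto simp: strip_def)

lemma strip_of_real [simp]: "k > 0 \<Longrightarrow> of_real t \<in> strip k"
  by (simp add: strip_def)

lemma strip_add_of_real [simp]: "z + of_real t \<in> strip k \<longleftrightarrow> z \<in> strip k"
  by (simp add: strip_def)

lemma cball_subset_strip: "z \<in> strip k' \<Longrightarrow> r + k' \<le> k \<Longrightarrow> cball z r \<subseteq> strip k"
proof
  fix x assume "z \<in> strip k'" "r + k' \<le> k" "x \<in> cball z r"
  moreover have "\<bar>Im z - Im x\<bar> \<le> norm (z - x)" using abs_Im_le_cmod[of "z - x"] by simp
  ultimately show "x \<in> strip k" by (auto simp: strip_def dist_norm)
qed

section \<open>Cauchy estimates on strips\<close>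

lemma strip_deriv_bound:
  assumes "g holomorphic_on strip k" "\<And>z. z \<in> strip k \<Longrightarrow> norm (g z) \<le> B" "r > 0" "r + k' \<le> k"
    and "z \<in> strip k'"
  shows "norm ((deriv ^^ n) g z) \<le> fact n * B / r ^ n"
proof (rule Cauchy_inequality)
  have c: "cball z r \<subseteq> strip k" using cball_subset_strip assms by blast
  then show "continuous_on (cball z r) g" "g holomorphic_on ball z r"
    using assms(1) holomorphic_on_subset holomorphic_on_imp_continuous_on ball_subset_cball by blast+
  show "norm (g x) \<le> B" if "norm (z - x) = r" for x
    using that c by (intro assms) (auto simp: dist_norm)
qed (rule assms)

lemma strip_lipschitz:
  assumes "g holomorphic_on strip k" "\<And>z. z \<in> strip k \<Longrightarrow> norm (g z) \<le> B" "k' < k"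
    and "z \<in> strip k'" "z' \<in> strip k'"
  shows "norm (g z - g z') \<le> B / (k - k') * norm (z - z')"
proof (rule field_differentiable_bound[OF convex_strip[of k']])
  fix x assume x: "x \<in> strip k'"
  then have "x \<in> strip k" using assms strip_mono[of k' k] by auto
  then show "(g has_field_derivative deriv g x) (at x within strip k')"
    using assms(1) open_strip holomorphic_derivI by blast
  show "norm (deriv g x) \<le> B / (k - k')"
    using strip_deriv_bound[OF assms(1,2), where r="k - k'" and k'=k' and z=x and n=1] x assms(3) by simp
qed (use assms in auto)

lemma strip_holo_lipschitz:
  assumes "strip_holo k B f" "k' < k" "z \<in> strip k'" "z' \<in> strip k'" "w \<in> strip k'" "w' \<in> strip k'"
  shows "norm (f z w - f z' w') \<le> B / (k - k') * (norm (z - z') + norm (w - w'))"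
proof -
  have sub: "strip k' \<subseteq> strip k" using assms by (intro strip_mono) auto
  have "norm (f z w - f z' w) \<le> B / (k - k') * norm (z - z')"
    by (rule strip_lipschitz) (use assms sub in \<open>auto simp: strip_holo_def\<close>)
  moreover have "norm (f z' w - f z' w') \<le> B / (k - k') * norm (w - w')"
    by (rule strip_lipschitz) (use assms sub in \<open>auto simp: strip_holo_def\<close>)
  moreover have "norm (f z w - f z' w') \<le> norm (f z w - f z' w) + norm (f z' w - f z' w')"
    by (metis diff_add_cancel add_diff_eq norm_triangle_ineq)
  ultimately show ?thesis by (simp add: algebra_simps)
qed

text \<open>The quadratic remainder makes difference quotients converge at a rate that does not
  depend on the other variable.\<close>

lemma strip_taylor1:
  assumes "g holomorphic_on strip k" "\<And>z. z \<in> strip k \<Longrightarrow> norm (g z) \<le> B" "r > 0" "r + k' \<le> k"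
    and "z \<in> strip k'" "w \<in> strip k'"
  shows "norm (g w - g z - deriv g z * (w - z)) \<le> 2 * B / r\<^sup>2 * norm (w - z) ^ 2"
proof -
  have "norm ((deriv ^^ 0) g w - (\<Sum>i\<le>1. (deriv ^^ i) g z * (w - z) ^ i / fact i))
    \<le> (2 * B / r\<^sup>2) * norm (w - z) ^ Suc 1 / fact 1"
  proof (rule complex_Taylor[OF convex_strip[of k']])
    fix i x assume x: "x \<in> strip k'"
    then have "x \<in> strip k" using assms strip_mono[of k' k] by auto
    moreover have "(deriv ^^ i) g holomorphic_on strip k"
      using assms(1) open_strip by (rule holomorphic_higher_deriv)
    ultimately show "((deriv ^^ i) g has_field_derivative (deriv ^^ Suc i) g x) (at x within strip k')"
      using open_strip holomorphic_derivI by fastforce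
    show "norm ((deriv ^^ Suc 1) g x) \<le> 2 * B / r\<^sup>2"
      using strip_deriv_bound[OF assms(1,2,3,4) x, of 2] by (simp add: numeral_2_eq_2)
  qed (use assms in auto)
  then show ?thesis by (simp add: algebra_simps power2_eq_square)
qed

text \<open>Holomorphy of the \<open>z\<close>-derivative in the other variable \<open>w\<close> is
  the point: it is a uniform limit of difference quotients in \<open>z\<close>, each of which is
  holomorphic in \<open>w\<close>.\<close>

lemma strip_holo_deriv:
  assumes f: "strip_holo k B f" and k': "k' < k" "0 < k'"
  shows "strip_holo k' (B / (k - k')) (\<lambda>z w. deriv (\<lambda>z. f z w) z)"
proof -
  have sub: "strip k' \<subseteq> strip k" using assms by (intro strip_mono) auto
  let ?D = "\<lambda>z w. deriv (\<lambda>z. f z w) z"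
  have b: "norm (?D z w) \<le> B / (k - k')" if "z \<in> strip k'" "w \<in> strip k'" for z w
    using strip_deriv_bound[of "\<lambda>z. f z w" k B "k - k'" k' z 1] f that sub k'
    by (auto simp: strip_holo_def)
  have h1: "(\<lambda>z. ?D z w) holomorphic_on strip k'" if "w \<in> strip k'" for w
    using f that sub by (intro holomorphic_on_subset[OF holomorphic_deriv[OF _ open_strip[of k]]])
      (auto simp: strip_holo_def)
  have h2: "(\<lambda>w. ?D z w) holomorphic_on strip k'" if z: "z \<in> strip k'" for z
  proof -
    define h where "h n = 1 / real (Suc n)" for n
    have hpos: "h n > 0" for n by (simp add: h_def)
    have h0: "h \<longlonglongrightarrow> 0" unfolding h_def by (rule LIMSEQ_Suc[OF lim_1_over_n])
    define q where "q n w = (f (z + of_real (h n)) w - f z w) / of_real (h n)" for n w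
    have q: "q n holomorphic_on strip k'" for n
    proof -
      have "f (z + of_real (h n)) holomorphic_on strip k'" "f z holomorphic_on strip k'"
        using f z sub holomorphic_on_subset[of _ "strip k" "strip k'"] by (auto simp: strip_holo_def subset_iff)
      then show ?thesis unfolding q_def using hpos[of n] by (intro holomorphic_intros) auto
    qed
    have est: "norm (q n w - ?D z w) \<le> 2 * B / (k - k')\<^sup>2 * h n" if w: "w \<in> strip k'" for n w
    proof -
      have "norm (f (z + of_real (h n)) w - f z w - ?D z w * (z + of_real (h n) - z))
         \<le> 2 * B / (k - k')\<^sup>2 * norm (z + of_real (h n) - z) ^ 2"
        by (rule strip_taylor1) (use f k' z w sub in \<open>auto simp: strip_holo_def\<close>)
      moreover have "f (z + of_real (h n)) w - f z w - ?D z w * (z + of_real (h n) - z) = (q n w - ?D z w) * of_real (h n)"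
        using hpos[of n] by (simp add: q_def field_simps)
      ultimately have "norm (q n w - ?D z w) * h n \<le> (2 * B / (k - k')\<^sup>2 * h n) * h n"
        using hpos[of n] by (simp add: norm_mult power2_eq_square mult.assoc)
      then show ?thesis using hpos[of n] by (rule mult_right_le_imp_le)
    qed
    have B0: "B \<ge> 0"
      using f z sub by (auto simp: strip_holo_def) (meson norm_ge_zero order_trans subset_iff)
    have ul: "uniform_limit (strip k') q (?D z) sequentially"
      unfolding uniform_limit_iff
    proof (intro allI impI)
      fix e :: real assume e: "e > 0"
      have "(\<lambda>n. 2 * B / (k - k')\<^sup>2 * h n) \<longlonglongrightarrow> 0" by (rule tendsto_mult_right_zero[OF h0])
      then have "\<forall>\<^sub>F n in sequentially. 2 * B / (k - k')\<^sup>2 * h n < e"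
        using e by (rule order_tendstoD(2))
      then show "\<forall>\<^sub>F n in sequentially. \<forall>x\<in>strip k'. dist (q n x) (?D z x) < e"
        by eventually_elim (use est in \<open>auto simp: dist_norm intro: le_less_trans\<close>)
    qed
    show ?thesis
    proof (rule holomorphic_uniform_sequence[OF open_strip q])
      fix x assume "x \<in> strip k'"
      then obtain d where "d > 0" "cball x d \<subseteq> strip k'"
        using open_strip open_contains_cball by blast
      then show "\<exists>d. 0 < d \<and> cball x d \<subseteq> strip k' \<and> uniform_limit (cball x d) q (?D z) sequentially"
        using uniform_limit_on_subset[OF ul] by blast
    qed
  qed
  show ?thesis unfolding strip_holo_def using b h1 h2 by blast
qed

lemma strip_holo_swap: "strip_holo k B f \<Longrightarrow> strip_holo k B (\<lambda>z w. f w z)"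
  unfolding strip_holo_def by auto

text \<open>Restrictions to the real plane of bounded separately holomorphic functions are closed
  under both derivatives, each costing half of the strip width.\<close>

lemma strip_holo_smooth2:
  assumes f: "strip_holo k B f" and k: "k > 0"
  shows "smooth2 (\<lambda>t y. f (of_real t) (of_real y))"
proof (rule smooth2_coinduct[where P="\<lambda>g. \<exists>k B f. k > 0 \<and> strip_holo k B f \<and> g = (\<lambda>t y. f (of_real t) (of_real y))"])
  show "\<exists>k B fa. k > 0 \<and> strip_holo k B fa \<and> (\<lambda>t y. f (of_real t) (of_real y)) = (\<lambda>t y. fa (of_real t) (of_real y))"
    using assms by blast
next
  fix g :: "real \<Rightarrow> real \<Rightarrow> complex"
  assume "\<exists>k B f. k > 0 \<and> strip_holo k B f \<and> g = (\<lambda>t y. f (of_real t) (of_real y))"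
  then obtain k B f where k: "k > 0" and f: "strip_holo k B f" and g: "g = (\<lambda>t y. f (of_real t) (of_real y))"
    by blast
  define L where "L = B / (k - k/2)"
  have lip: "norm (f z w - f z' w') \<le> L * (norm (z - z') + norm (w - w'))"
    if "z \<in> strip (k/2)" "z' \<in> strip (k/2)" "w \<in> strip (k/2)" "w' \<in> strip (k/2)" for z z' w w'
    unfolding L_def by (rule strip_holo_lipschitz[OF f]) (use that k in auto)
  have cont: "continuous_on UNIV (\<lambda>p. g (fst p) (snd p))"
    unfolding continuous_on_def
  proof
    fix p :: "real \<times> real"
    have "((\<lambda>q. L * (\<bar>fst q - fst p\<bar> + \<bar>snd q - snd p\<bar>)) \<longlongrightarrow> L * (\<bar>fst p - fst p\<bar> + \<bar>snd p - snd p\<bar>)) (at p within UNIV)"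
      by (intro tendsto_intros)
    then have 1: "((\<lambda>q. L * (\<bar>fst q - fst p\<bar> + \<bar>snd q - snd p\<bar>)) \<longlongrightarrow> 0) (at p within UNIV)" by simp
    have 2: "\<forall>q. norm (g (fst q) (snd q) - g (fst p) (snd p)) \<le> L * (\<bar>fst q - fst p\<bar> + \<bar>snd q - snd p\<bar>)"
      using lip[of "of_real (fst q)" "of_real (fst p)" "of_real (snd q)" "of_real (snd p)" for q] k
      by (simp add: g flip: of_real_diff)
    have "((\<lambda>q. g (fst q) (snd q) - g (fst p) (snd p)) \<longlongrightarrow> 0) (at p within UNIV)"
      by (rule Lim_null_comparison[OF always_eventually[OF 2] 1])
    then show "((\<lambda>q. g (fst q) (snd q)) \<longlongrightarrow> g (fst p) (snd p)) (at p within UNIV)"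
      by (simp add: LIM_zero_iff)
  qed
  have *: "strip_holo (k/2) (B / (k - k/2)) (\<lambda>z w. deriv (\<lambda>z. f z w) z)"
    by (rule strip_holo_deriv) (use f k in auto)
  have **: "strip_holo (k/2) (B / (k - k/2)) (\<lambda>z w. deriv (f z) w)"
    by (rule strip_holo_swap, rule strip_holo_deriv) (use strip_holo_swap[OF f] k in auto)
  have d1: "((\<lambda>t. g t y) has_vector_derivative deriv (\<lambda>z. f z (of_real y)) (of_real t)) (at t)" for t y
    unfolding g
    by (rule has_vector_derivative_real_field, rule holomorphic_derivI[OF _ open_strip[of k]])
      (use f k in \<open>auto simp: strip_holo_def\<close>)
  have d2: "(g t has_vector_derivative deriv (f (of_real t)) (of_real y)) (at y)" for t y
    unfolding g
    by (rule has_vector_derivative_real_field, rule holomorphic_derivI[OF _ open_strip[of k]])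
      (use f k in \<open>auto simp: strip_holo_def\<close>)
  have e1: "\<exists>k' B' f'. k' > 0 \<and> strip_holo k' B' f' \<and>
      (\<lambda>t y. deriv (\<lambda>z. f z (of_real y)) (of_real t)) = (\<lambda>t y. f' (of_real t) (of_real y))"
    by (rule exI[of _ "k/2"], rule exI, rule exI[of _ "\<lambda>z w. deriv (\<lambda>z. f z w) z"]) (use * k in auto)
  have e2: "\<exists>k' B' f'. k' > 0 \<and> strip_holo k' B' f' \<and>
      (\<lambda>t y. deriv (f (of_real t)) (of_real y)) = (\<lambda>t y. f' (of_real t) (of_real y))"
    by (rule exI[of _ "k/2"], rule exI, rule exI[of _ "\<lambda>z w. deriv (f z) w"]) (use ** k in auto)
  show "continuous_on UNIV (\<lambda>p. g (fst p) (snd p)) \<and>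
     (\<exists>f1 f2. (\<forall>t y. ((\<lambda>t. g t y) has_vector_derivative f1 t y) (at t)) \<and>
              (\<forall>t y. (g t has_vector_derivative f2 t y) (at y)) \<and>
       (\<exists>k B f. k > 0 \<and> strip_holo k B f \<and> f1 = (\<lambda>t y. f (of_real t) (of_real y))) \<and>
       (\<exists>k B f. k > 0 \<and> strip_holo k B f \<and> f2 = (\<lambda>t y. f (of_real t) (of_real y))))"
    by (intro conjI cont exI[of _ "\<lambda>t y. deriv (\<lambda>z. f z (of_real y)) (of_real t)"]
      exI[of _ "\<lambda>t y. deriv (f (of_real t)) (of_real y)"] allI d1 d2 e1 e2)
qed

section \<open>Complex two-by-two matrices\<close>

text \<open>A type of its own carries the noncommutative product and, below, the maximal row sum
  norm, which is submultiplicative with \<open>norm 1 = 1\<close>; matrices thus form a Banach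
  algebra.\<close>

datatype mat2 = Mat2 (m11: complex) (m12: complex) (m21: complex) (m22: complex)

lemma mat2_eqI: "m11 A = m11 B \<Longrightarrow> m12 A = m12 B \<Longrightarrow> m21 A = m21 B \<Longrightarrow> m22 A = m22 B \<Longrightarrow> A = B"
  by (cases A, cases B) simp

instantiation mat2 :: ring_1
begin
definition "0 = Mat2 0 0 0 0"
definition "1 = Mat2 1 0 0 1"
definition "A + B = Mat2 (m11 A + m11 B) (m12 A + m12 B) (m21 A + m21 B) (m22 A + m22 B)"
definition "A - B = Mat2 (m11 A - m11 B) (m12 A - m12 B) (m21 A - m21 B) (m22 A - m22 B)"
definition "- A = Mat2 (- m11 A) (- m12 A) (- m21 A) (- m22 A)"
definition "A * B = Mat2 (m11 A * m11 B + m12 A * m21 B) (m11 A * m12 B + m12 A * m22 B)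
  (m21 A * m11 B + m22 A * m21 B) (m21 A * m12 B + m22 A * m22 B)"
instance
  by standard (auto simp: zero_mat2_def one_mat2_def plus_mat2_def minus_mat2_def uminus_mat2_def
      times_mat2_def algebra_simps intro: mat2_eqI)
end

lemma mat2_sel [simp]:
  "m11 0 = 0" "m12 0 = 0" "m21 0 = 0" "m22 0 = 0"
  "m11 1 = 1" "m12 1 = 0" "m21 1 = 0" "m22 1 = 1"
  "m11 (A + B) = m11 A + m11 B" "m12 (A + B) = m12 A + m12 B"
  "m21 (A + B) = m21 A + m21 B" "m22 (A + B) = m22 A + m22 B"
  "m11 (A - B) = m11 A - m11 B" "m12 (A - B) = m12 A - m12 B"
  "m21 (A - B) = m21 A - m21 B" "m22 (A - B) = m22 A - m22 B"
  "m11 (- A) = - m11 A" "m12 (- A) = - m12 A" "m21 (- A) = - m21 A" "m22 (- A) = - m22 A"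
  "m11 (A * B) = m11 A * m11 B + m12 A * m21 B" "m12 (A * B) = m11 A * m12 B + m12 A * m22 B"
  "m21 (A * B) = m21 A * m11 B + m22 A * m21 B" "m22 (A * B) = m21 A * m12 B + m22 A * m22 B"
  by (simp_all add: zero_mat2_def one_mat2_def plus_mat2_def minus_mat2_def uminus_mat2_def times_mat2_def)

instantiation mat2 :: real_algebra_1
begin
definition "scaleR r A = Mat2 (r *\<^sub>R m11 A) (r *\<^sub>R m12 A) (r *\<^sub>R m21 A) (r *\<^sub>R m22 A)"
instance
  by standard (auto simp: scaleR_mat2_def scaleR_conv_of_real algebra_simps intro!: mat2_eqI)
end

instantiation mat2 :: real_normed_algebra_1
begin
definition "norm A = max (norm (m11 A) + norm (m12 A)) (norm (m21 A) + norm (m22 A))"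
definition "sgn (A::mat2) = A /\<^sub>R norm A"
definition "dist (A::mat2) B = norm (A - B)"
definition "uniformity = (INF e\<in>{0<..}. principal {(A::mat2, B). dist A B < e})"
definition "open (S::mat2 set) \<longleftrightarrow> (\<forall>x\<in>S. \<forall>\<^sub>F (x', y) in uniformity. x' = x \<longrightarrow> y \<in> S)"
instance
proof
  fix A B :: mat2 and r :: real
  show "norm (A + B) \<le> norm A + norm B"
    using norm_triangle_ineq[of "m11 A" "m11 B"] norm_triangle_ineq[of "m12 A" "m12 B"]
      norm_triangle_ineq[of "m21 A" "m21 B"] norm_triangle_ineq[of "m22 A" "m22 B"]
    unfolding norm_mat2_def mat2_sel by (intro max.boundedI; linarith)
  have row: "norm (a * m11 B + b * m21 B) + norm (a * m12 B + b * m22 B) \<le> (norm a + norm b) * norm B"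
    for a b
  proof -
    have "norm (a * m11 B + b * m21 B) + norm (a * m12 B + b * m22 B)
      \<le> (norm a * norm (m11 B) + norm b * norm (m21 B)) + (norm a * norm (m12 B) + norm b * norm (m22 B))"
      by (intro add_mono order_trans[OF norm_triangle_ineq]) (simp_all add: norm_mult)
    also have "\<dots> = norm a * (norm (m11 B) + norm (m12 B)) + norm b * (norm (m21 B) + norm (m22 B))"
      by (simp add: algebra_simps)
    also have "\<dots> \<le> norm a * norm B + norm b * norm B"
      by (intro add_mono mult_left_mono) (auto simp: norm_mat2_def)
    finally show ?thesis by (simp add: algebra_simps)
  qed
  have nn: "norm B \<ge> 0" by (simp add: norm_mat2_def le_max_iff_disj)
  show "norm (A * B) \<le> norm A * norm B"
    unfolding norm_mat2_def[of "A * B"] mat2_sel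
    by (intro max.boundedI order_trans[OF row] mult_right_mono nn) (auto simp: norm_mat2_def)
  show "norm (r *\<^sub>R A) = \<bar>r\<bar> * norm A"
    by (simp add: norm_mat2_def scaleR_mat2_def max_mult_distrib_left flip: distrib_left)
  show "norm A = 0 \<longleftrightarrow> A = 0"
  proof
    assume "norm A = 0"
    then have "norm (m11 A) + norm (m12 A) \<le> 0" "norm (m21 A) + norm (m22 A) \<le> 0"
      by (auto simp: norm_mat2_def max_def split: if_splits)
    then have "m11 A = 0 \<and> m12 A = 0 \<and> m21 A = 0 \<and> m22 A = 0"
      by (smt (verit) norm_ge_zero norm_eq_zero)
    then show "A = 0" by (intro mat2_eqI) auto
  qed (simp add: norm_mat2_def)
qed (auto simp: scaleR_mat2_def norm_mat2_def sgn_mat2_def dist_mat2_def uniformity_mat2_def open_mat2_def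
    scaleR_conv_of_real algebra_simps one_mat2_def zero_mat2_def intro!: mat2_eqI)
end

lemma m_scaleR [simp]:
  "m11 (r *\<^sub>R A) = r *\<^sub>R m11 A" "m12 (r *\<^sub>R A) = r *\<^sub>R m12 A"
  "m21 (r *\<^sub>R A) = r *\<^sub>R m21 A" "m22 (r *\<^sub>R A) = r *\<^sub>R m22 A"
  by (simp_all add: scaleR_mat2_def)

lemma norm_entries_le: "norm (m11 A) \<le> norm A" "norm (m12 A) \<le> norm A" "norm (m21 A) \<le> norm A" "norm (m22 A) \<le> norm A"
  unfolding norm_mat2_def by (auto simp: le_max_iff_disj)

lemma bounded_linear_entries: "bounded_linear m11" "bounded_linear m12" "bounded_linear m21" "bounded_linear m22"
  by (rule bounded_linear_intro[where K=1]; simp add: norm_entries_le)+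

lemma norm_mat2_le_sum: "norm A \<le> norm (m11 A) + norm (m12 A) + norm (m21 A) + norm (m22 A)"
  by (simp add: norm_mat2_def)

lemma tendsto_mat2:
  assumes "((\<lambda>x. m11 (f x)) \<longlongrightarrow> m11 L) F" "((\<lambda>x. m12 (f x)) \<longlongrightarrow> m12 L) F"
    "((\<lambda>x. m21 (f x)) \<longlongrightarrow> m21 L) F" "((\<lambda>x. m22 (f x)) \<longlongrightarrow> m22 L) F"
  shows "(f \<longlongrightarrow> L) F"
proof -
  let ?g = "\<lambda>x. norm (m11 (f x) - m11 L) + norm (m12 (f x) - m12 L) + norm (m21 (f x) - m21 L) + norm (m22 (f x) - m22 L)"
  have "(?g \<longlongrightarrow> norm (m11 L - m11 L) + norm (m12 L - m12 L) + norm (m21 L - m21 L) + norm (m22 L - m22 L)) F"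
    by (intro tendsto_intros assms)
  then have g: "(?g \<longlongrightarrow> 0) F" by simp
  have "\<forall>x. norm (f x - L) \<le> ?g x"
    using norm_mat2_le_sum[of "f x - L" for x] by simp
  then have "((\<lambda>x. f x - L) \<longlongrightarrow> 0) F"
    by (rule Lim_null_comparison[OF always_eventually g])
  then show ?thesis by (simp add: LIM_zero_iff)
qed

instance mat2 :: banach
proof
  fix X :: "nat \<Rightarrow> mat2" assume X: "Cauchy X"
  have "Cauchy (\<lambda>n. g (X n))" if "bounded_linear g" for g :: "mat2 \<Rightarrow> complex"
    using bounded_linear.Cauchy[OF that X] .
  then have "convergent (\<lambda>n. m11 (X n))" "convergent (\<lambda>n. m12 (X n))" "convergent (\<lambda>n. m21 (X n))" "convergent (\<lambda>n. m22 (X n))"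
    using bounded_linear_entries Cauchy_convergent by blast+
  then obtain a b c d where "(\<lambda>n. m11 (X n)) \<longlonglongrightarrow> a" "(\<lambda>n. m12 (X n)) \<longlonglongrightarrow> b"
    "(\<lambda>n. m21 (X n)) \<longlonglongrightarrow> c" "(\<lambda>n. m22 (X n)) \<longlonglongrightarrow> d"
    by (auto simp: convergent_def)
  then have "X \<longlonglongrightarrow> Mat2 a b c d" by (intro tendsto_mat2) auto
  then show "convergent X" by (auto simp: convergent_def)
qed

definition sc :: "complex \<Rightarrow> mat2" where "sc c = Mat2 c 0 0 c"
definition tr :: "mat2 \<Rightarrow> complex" where "tr A = m11 A + m22 A"
definition dt2 :: "mat2 \<Rightarrow> complex" where "dt2 A = m11 A * m22 A - m12 A * m21 A"
definition adj :: "mat2 \<Rightarrow> mat2" where "adj A = Mat2 (m22 A) (- m12 A) (- m21 A) (m11 A)"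

lemma sc_sel [simp]: "m11 (sc c) = c" "m12 (sc c) = 0" "m21 (sc c) = 0" "m22 (sc c) = c"
  by (simp_all add: sc_def)

lemma adj_sel [simp]: "m11 (adj A) = m22 A" "m12 (adj A) = - m12 A" "m21 (adj A) = - m21 A" "m22 (adj A) = m11 A"
  by (simp_all add: adj_def)

lemma sc_simps: "sc 0 = 0" "sc 1 = 1" "sc (a + b) = sc a + sc b" "sc (a - b) = sc a - sc b" "sc (- a) = - sc a"
  "sc (a * b) = sc a * sc b" "sc a * A = A * sc a"
  by (auto intro!: mat2_eqI)

lemma sc_left: "A * (sc c * B) = sc c * (A * B)"
  by (auto intro!: mat2_eqI simp: algebra_simps)

lemma sc_cancel: "c \<noteq> 0 \<Longrightarrow> sc (1 / c) * (sc c * A) = A" "c \<noteq> 0 \<Longrightarrow> sc c * (sc (1 / c) * A) = A"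
  by (auto intro!: mat2_eqI)

lemma norm_sc_mult [simp]: "norm (sc c * A) = norm c * norm A"
  by (simp add: norm_mat2_def norm_mult max_mult_distrib_left flip: distrib_left)

lemma tr_simps [simp]: "tr 0 = 0" "tr 1 = 2" "tr (A + B) = tr A + tr B" "tr (A - B) = tr A - tr B" "tr (- A) = - tr A"
  "tr (sc c * A) = c * tr A"
  by (auto simp: tr_def algebra_simps)

lemma tr_commute: "tr (A * B) = tr (B * A)"
  by (simp add: tr_def)

lemma norm_tr_le: "norm (tr A) \<le> 2 * norm A"
  unfolding tr_def using norm_triangle_ineq[of "m11 A" "m22 A"] norm_entries_le[of A] by linarith

lemma adj_mult: "A * adj A = sc (dt2 A)" "adj A * A = sc (dt2 A)"
  by (auto intro!: mat2_eqI simp: dt2_def)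

lemma adj_diff: "adj (A - B) = adj A - adj B"
  by (auto intro!: mat2_eqI)

lemma norm_adj_le: "norm (adj A) \<le> 2 * norm A"
  using norm_entries_le[of A] by (auto simp: norm_mat2_def)

section \<open>Matrices of rank at most one\<close>

lemma dt2_zeroE:
  assumes "dt2 A = 0"
  obtains p q r s where "A = Mat2 (p * r) (p * s) (q * r) (q * s)"
proof (cases "m11 A = 0 \<and> m12 A = 0")
  case True
  then show ?thesis by (intro that[where p=0 and q=1 and r="m21 A" and s="m22 A"] mat2_eqI) auto
next
  case False
  define k where "k = (if m11 A = 0 then m22 A / m12 A else m21 A / m11 A)"
  have "m21 A = k * m11 A" "m22 A = k * m12 A"
    using False assms unfolding k_def dt2_def by (auto simp: field_simps)
  then show ?thesis by (intro that[where p=1 and q=k and r="m11 A" and s="m12 A"] mat2_eqI) auto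
qed

text \<open>Such a matrix is a column \<open>(p, q)\<close> times a row \<open>(r, s)\<close>, and
  its trace is the pairing of the two. In \<open>P * Z * P\<close> the row, \<open>Z\<close> and the
  column in the middle multiply to a scalar.\<close>

lemma rank_one_idem:
  assumes "dt2 P = 0" "tr P = 1"
  shows "P * P = P" "P * Z * P = sc (tr (P * Z)) * P"
proof -
  obtain p q r s where P: "P = Mat2 (p * r) (p * s) (q * r) (q * s)" using dt2_zeroE assms(1) .
  have t: "p * r + q * s = 1" using assms(2) by (simp add: P tr_def)
  show Z: "P * Z * P = sc (tr (P * Z)) * P" for Z
    by (auto intro!: mat2_eqI simp: P tr_def algebra_simps)
  show "P * P = P"
    using Z[of 1] assms(2) by (simp add: sc_simps)
qed

text \<open>Between two matrices of rank one, \<open>C\<close> can change the product by a scalar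
  only. Cross-multiplication with the traces avoids any division. In \<open>it_equivariant\<close>
  this makes the normalised graph step blind to such a factor.\<close>

lemma rank_one_middle:
  assumes "dt2 P = 0" "dt2 Q = 0"
  shows "sc (tr (M * Q * P)) * (M * Q * C * P) = sc (tr (M * Q * C * P)) * (M * Q * P)"
proof -
  obtain p q r s where P: "P = Mat2 (p * r) (p * s) (q * r) (q * s)" using dt2_zeroE assms(1) .
  obtain p' q' r' s' where Q: "Q = Mat2 (p' * r') (p' * s') (q' * r') (q' * s')" using dt2_zeroE assms(2) .
  have 1: "Q * C * P = sc (r' * m11 C * p + r' * m12 C * q + s' * m21 C * p + s' * m22 C * q) * Mat2 (p' * r) (p' * s) (q' * r) (q' * s)"
    by (auto intro!: mat2_eqI simp: P Q algebra_simps)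
  have 2: "Q * P = sc (r' * p + s' * q) * Mat2 (p' * r) (p' * s) (q' * r) (q' * s)"
    by (auto intro!: mat2_eqI simp: P Q algebra_simps)
  have 3: "M * (sc k * X) = sc k * (M * X)" for k X
    by (metis mult.assoc sc_simps(7))
  have "M * Q * C * P = M * (Q * C * P)" "M * Q * P = M * (Q * P)" by (simp_all add: mult.assoc)
  then show ?thesis unfolding 1 2 3
    by (auto intro!: mat2_eqI simp: tr_def algebra_simps)
qed

text \<open>Junk value \<open>0\<close> if the trace vanishes. The two equations in \<open>near_proj\<close> say that the
  projections have the same kernel, which every step of the graph transform preserves.\<close>

definition graph_step :: "mat2 \<Rightarrow> mat2 \<Rightarrow> mat2 \<Rightarrow> mat2" where
  "graph_step M Q P = sc (1 / tr (M * Q * P)) * (M * Q * P)"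

definition near_proj :: "mat2 \<Rightarrow> mat2 \<Rightarrow> bool" where
  "near_proj P Q \<longleftrightarrow> Q * P = Q \<and> P * Q = P \<and> norm (Q - P) \<le> 1 / 100"

text \<open>\<open>M\<close> acts nearly by \<open>mp\<close> on the range of \<open>P\<close> and
  by \<open>mm\<close> on its kernel, and \<open>P'\<close> is the projection at the next base
  point. The quotient of 7/10 and 9/5 is below 1/2 with room for the errors, which gives the
  contraction rate 1/2. \<open>P\<close> is an oblique projection, so its norm has to be bounded
  too.\<close>

definition almost_split :: "mat2 \<Rightarrow> mat2 \<Rightarrow> mat2 \<Rightarrow> complex \<Rightarrow> complex \<Rightarrow> bool" where
  "almost_split M P P' mp mm \<longleftrightarrow> dt2 P = 0 \<and> tr P = 1 \<and> norm P \<le> 5 \<and> tr P' = 1 \<and>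
     norm (P - P') \<le> 1 / 10^5 \<and> norm (M - (sc mp * P + sc mm * (1 - P))) \<le> 1 / 10^5 \<and>
     9 / 5 \<le> norm mp \<and> norm mp \<le> 4 \<and> norm mm \<le> 7 / 10"

lemma near_projD: "near_proj P Q \<Longrightarrow> dt2 P = 0 \<Longrightarrow> tr P = 1 \<Longrightarrow> tr Q = 1 \<and> dt2 Q = 0 \<and> Q * Q = Q"
proof -
  assume *: "near_proj P Q" "dt2 P = 0" "tr P = 1"
  then have 1: "Q * P = Q" "P * Q = P" by (auto simp: near_proj_def)
  have "tr Q = tr (Q * P)" using 1 by simp
  also have "\<dots> = tr P" using tr_commute[of Q P] 1 by simp
  finally have t: "tr Q = 1" using * by simp
  have "dt2 (Q * P) = dt2 Q * dt2 P" by (simp add: dt2_def algebra_simps)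
  then have "dt2 Q = 0" using 1 * by simp
  with t rank_one_idem show ?thesis by blast
qed

text \<open>If \<open>Q\<close> and \<open>R\<close> share the kernel of \<open>P'\<close>, then
  \<open>P'\<close> annihilates \<open>Q - R\<close> from the left, so the range of
  \<open>Q - R\<close> lies almost in the kernel of \<open>P\<close>. There \<open>M\<close> acts by
  \<open>mm\<close>, while the normalisation divides by a trace near \<open>mp\<close>.\<close>

lemma graph_step_props:
  assumes A: "almost_split M P P' mp mm" and Q: "near_proj P' Q"
  shows "norm (tr (M * Q * P) - mp) \<le> 1 / 500" "near_proj P (graph_step M Q P)"
    and "\<And>R. near_proj P' R \<Longrightarrow> norm (graph_step M Q P - graph_step M R P) \<le> norm (Q - R) / 2"
proof -
  define d :: real where "d = 1 / 10^5"
  define M0 where "M0 = sc mp * P + sc mm * (1 - P)"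
  define D where "D = P - P'"
  define N where "N = M - M0"
  have dP: "dt2 P = 0" "tr P = 1" "norm P \<le> 5" "tr P' = 1" "norm D \<le> d" "norm N \<le> d"
    "9/5 \<le> norm mp" "norm mp \<le> 4" "norm mm \<le> 7/10"
    using A by (auto simp: almost_split_def d_def M0_def N_def D_def)
  have PP: "P * P = P" using rank_one_idem dP by blast
  have PM: "P * M = sc mp * P + P * N"
  proof -
    have "P * M0 = sc mp * P"
      unfolding M0_def distrib_left sc_left[of P] by (simp add: right_diff_distrib PP)
    then show ?thesis by (simp add: N_def algebra_simps)
  qed
  have QM: "M = sc mp * P + sc mm * (1 - P) + N" by (simp add: N_def M0_def)
  have np: "R * P' = R" "P' * R = P'" "norm (R - P') \<le> 1/100" "norm R \<le> 6" if "near_proj P' R" for R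
  proof -
    show "R * P' = R" "P' * R = P'" "norm (R - P') \<le> 1/100" using that by (auto simp: near_proj_def)
    then show "norm R \<le> 6"
      using norm_triangle_ineq[of "R - P'" P'] norm_triangle_ineq4[of P D] dP by (simp add: D_def d_def)
  qed
  have nDR: "norm (D * X) \<le> d * norm X" for X
    by (rule order_trans[OF norm_mult_ineq mult_right_mono]) (use dP in auto)
  have nNR: "norm (N * X) \<le> d * norm X" for X
    by (rule order_trans[OF norm_mult_ineq mult_right_mono]) (use dP in auto)
  have nRD: "norm (X * D) \<le> d * norm X" for X
    by (rule order_trans[OF norm_mult_ineq]) (use dP mult_left_mono[of "norm D" d "norm X"] in \<open>auto simp: mult.commute\<close>)
  have nPX: "norm (P * X) \<le> 5 * norm X" for X
    by (rule order_trans[OF norm_mult_ineq mult_right_mono]) (use dP in auto)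
  have nXP: "norm (X * P) \<le> 5 * norm X" for X
    by (rule order_trans[OF norm_mult_ineq]) (use dP mult_left_mono[of "norm P" 5 "norm X"] in \<open>auto simp: mult.commute\<close>)
  have trc: "tr (M * R * P) = tr (P * M * R)" for R
    by (metis mult.assoc tr_commute)
  have den: "norm (tr (M * R * P) - mp) \<le> 1 / 500" if R: "near_proj P' R" for R
  proof -
    have PR: "P * R = P' + D * R" using np(2)[OF R] by (simp add: D_def algebra_simps)
    have "P * M * R = sc mp * (P * R) + P * (N * R)"
      unfolding PM by (simp add: distrib_right mult.assoc)
    then have "tr (M * R * P) - mp = mp * tr (D * R) + tr (P * (N * R))"
      unfolding trc PR using dP(4) by (simp add: algebra_simps)
    also have "norm \<dots> \<le> 4 * (2 * (d * 6)) + 2 * (5 * (d * 6))"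
    proof (intro order_trans[OF norm_triangle_ineq] add_mono)
      have "norm (D * R) \<le> d * 6" using nDR[of R] np(4)[OF R] mult_left_mono[of "norm R" 6 d] by (simp add: d_def)
      then have "norm (tr (D * R)) \<le> 2 * (d * 6)" using norm_tr_le[of "D * R"] by linarith
      then show "norm (mp * tr (D * R)) \<le> 4 * (2 * (d * 6))"
        unfolding norm_mult by (intro mult_mono dP) auto
      have "norm (N * R) \<le> d * 6" using nNR[of R] np(4)[OF R] mult_left_mono[of "norm R" 6 d] by (simp add: d_def)
      then show "norm (tr (P * (N * R))) \<le> 2 * (5 * (d * 6))"
        using norm_tr_le[of "P * (N * R)"] nPX[of "N * R"] by linarith
    qed
    also have "\<dots> \<le> 1/500" by (simp add: d_def)
    finally show ?thesis .
  qed
  \<comment> \<open>9/5 - 1/500 exceeds 179/100.\<close>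
  have den1: "norm (tr (M * R * P)) \<ge> (179/100)" if R: "near_proj P' R" for R
  proof -
    have "norm mp \<le> norm (tr (M * R * P)) + norm (mp - tr (M * R * P))"
      by (metis add.commute diff_add_cancel norm_triangle_ineq)
    then show ?thesis using den[OF R] dP(7) norm_minus_commute[of mp] by simp
  qed
  have gs: "sc (tr (M * R * P)) * graph_step M R P = M * R * P" if R: "near_proj P' R" for R
  proof -
    have "tr (M * R * P) \<noteq> 0" using den1[OF R] by auto
    then show ?thesis unfolding graph_step_def by (rule sc_cancel)
  qed
  have gsP: "graph_step M R P * P = graph_step M R P" for R
    by (simp add: graph_step_def mult.assoc PP)
  have PMR: "P * (M * R * P) = sc (tr (M * R * P)) * P" for R
  proof -
    have "P * (M * R * P) = P * (M * R) * P" by (simp add: mult.assoc)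
    also have "\<dots> = sc (tr (P * (M * R))) * P" by (rule rank_one_idem(2)[OF dP(1,2)])
    also have "tr (P * (M * R)) = tr (M * R * P)" by (rule tr_commute)
    finally show ?thesis .
  qed
  have Pgs: "P * graph_step M R P = P" if R: "near_proj P' R" for R
    unfolding graph_step_def sc_left[of P] PMR by (rule sc_cancel) (use den1[OF R] in auto)
  have near: "near_proj P (graph_step M R P)" if R: "near_proj P' R" for R
  proof -
    let ?G = "graph_step M R P" and ?t = "tr (M * R * P)"
    \<comment> \<open>Multiplied by the trace, the deviation from \<open>P\<close> is the component
      of \<open>M * R * P\<close> along the kernel of \<open>P\<close>. The term with the large
      factor \<open>mp\<close> cancels in it.\<close>
    have "sc ?t * (?G - P) = M * R * P - P * (M * R * P)"
      unfolding right_diff_distrib gs[OF R] PMR ..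
    also have "\<dots> = sc mm * (R * P - P * (R * P)) + N * (R * P) - P * (N * (R * P))"
    proof -
      have 1: "P * (M * X) = sc mp * (P * X) + P * (N * X)" for X
        using arg_cong[OF PM, of "\<lambda>Z. Z * X"] by (simp add: distrib_right mult.assoc)
      have 2: "M * X = sc mp * (P * X) + sc mm * (X - P * X) + N * X" for X
        using arg_cong[OF QM, of "\<lambda>Z. Z * X"] by (simp add: distrib_right left_diff_distrib mult.assoc)
      show ?thesis unfolding mult.assoc[of M R P] 1 unfolding 2 by simp
    qed
    finally have eq: "sc ?t * (?G - P) = sc mm * (R * P - P * (R * P)) + N * (R * P) - P * (N * (R * P))" .
    have RP: "R * P = R + R * D" using np(1)[OF R] by (simp add: D_def algebra_simps)
    have PR: "P * R = P' + D * R" using np(2)[OF R] by (simp add: D_def algebra_simps)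
    have n1: "norm (R * D) \<le> d * 6" using nRD[of R] np(4)[OF R] mult_left_mono[of "norm R" 6 d] by (simp add: d_def)
    have n2: "norm (D * R) \<le> d * 6" using nDR[of R] np(4)[OF R] mult_left_mono[of "norm R" 6 d] by (simp add: d_def)
    have n3: "norm (R * P) \<le> 30" using nXP[of R] np(4)[OF R] by simp
    have n4: "norm (N * (R * P)) \<le> d * 30" using nNR[of "R * P"] n3 mult_left_mono[of "norm (R * P)" 30 d] by (simp add: d_def)
    have "R * P - P * (R * P) = (R - P') - D * R + R * D - P * (R * D)"
      unfolding RP by (simp add: distrib_left right_diff_distrib mult.assoc[symmetric] PR)
    also have "norm \<dots> \<le> 1/100 + d * 6 + d * 6 + 5 * (d * 6)"
      by (intro order_trans[OF norm_triangle_ineq4] order_trans[OF norm_triangle_ineq] add_mono n1 n2 np(3)[OF R]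
          order_trans[OF nPX]) (use n1 in auto)
    also have "\<dots> \<le> 13/1000" by (simp add: d_def)
    finally have n5: "norm (R * P - P * (R * P)) \<le> 13/1000" .
    have "norm ?t * norm (?G - P) = norm (sc ?t * (?G - P))" by simp
    also have "\<dots> \<le> 7/10 * (13/1000) + d * 30 + 5 * (d * 30)"
      unfolding eq
      by (intro order_trans[OF norm_triangle_ineq4] order_trans[OF norm_triangle_ineq] add_mono n4
          order_trans[OF nPX]) (use n4 n5 dP(9) mult_mono[OF dP(9) n5] in auto)
    also have "\<dots> \<le> 179/10000" by (simp add: d_def)
    finally have "norm ?t * norm (?G - P) \<le> 179/10000" .
    moreover have "(179/100) * norm (?G - P) \<le> norm ?t * norm (?G - P)"
      by (intro mult_right_mono den1[OF R]) auto
    ultimately have "norm (?G - P) \<le> 1/100" by linarith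
    then show ?thesis using gsP Pgs[OF R] by (simp add: near_proj_def)
  qed
  show "norm (tr (M * Q * P) - mp) \<le> 1 / 500" "near_proj P (graph_step M Q P)"
    using den[OF Q] near[OF Q] by auto
  fix R assume R: "near_proj P' R"
  define E where "E = Q - R"
  have nE: "norm E \<ge> 0" by simp
  let ?t = "tr (M * Q * P)" and ?G = "graph_step M R P"
  \<comment> \<open>\<open>P' * Q = P' = P' * R\<close> gives \<open>P' * E = 0\<close>, so
    \<open>P\<close> sees \<open>E\<close> only through the drift \<open>D\<close> of the base
    projection.\<close>
  have PE: "P * E = D * E" using np(2)[OF Q] np(2)[OF R] by (simp add: D_def E_def algebra_simps)
  have EP: "E * P = E + E * D" using np(1)[OF Q] np(1)[OF R] by (simp add: D_def E_def algebra_simps)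
  have nEP: "norm (E * P) \<le> norm E + d * norm E"
    unfolding EP using norm_triangle_ineq[of E "E * D"] nRD[of E] by linarith
  have nPEP: "norm (P * (E * P)) \<le> d * (norm E + d * norm E)"
  proof -
    have "P * (E * P) = D * (E * P)" using PE by (metis mult.assoc)
    then show ?thesis using nDR[of "E * P"] mult_left_mono[OF nEP, of d] by (simp add: d_def)
  qed
  have "M * X = sc mp * (P * X) + sc mm * (X - P * X) + N * X" for X
    using arg_cong[OF QM, of "\<lambda>Z. Z * X"] by (simp add: distrib_right left_diff_distrib mult.assoc)
  then have MEP: "M * (E * P) = sc mp * (P * (E * P)) + sc mm * (E * P - P * (E * P)) + N * (E * P)" by blast
  let ?e = "norm E + d * norm E"
  have nMEP: "norm (M * (E * P)) \<le> 4 * (d * ?e) + 7/10 * (?e + d * ?e) + d * ?e"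
    unfolding MEP
  proof (intro order_trans[OF norm_triangle_ineq] add_mono)
    show "norm (sc mp * (P * (E * P))) \<le> 4 * (d * ?e)"
      unfolding norm_sc_mult by (intro mult_mono dP nPEP) auto
    show "norm (sc mm * (E * P - P * (E * P))) \<le> 7/10 * (?e + d * ?e)"
      unfolding norm_sc_mult
      by (intro mult_mono dP order_trans[OF norm_triangle_ineq4] add_mono nEP nPEP) auto
    show "norm (N * (E * P)) \<le> d * ?e"
      using nNR[of "E * P"] mult_left_mono[OF nEP, of d] by (simp add: d_def)
  qed
  have ntr: "norm (tr (M * (E * P))) \<le> 2 * (4 * (d * norm E) + 5 * (d * norm E))"
  proof -
    have "tr (M * (E * P)) = tr (P * M * E)" by (metis mult.assoc tr_commute)
    moreover have "P * M * E = sc mp * (D * E) + P * (N * E)" unfolding PM PE[symmetric] by (simp add: distrib_right mult.assoc)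
    moreover have "norm (sc mp * (D * E) + P * (N * E)) \<le> 4 * (d * norm E) + 5 * (d * norm E)"
    proof (intro order_trans[OF norm_triangle_ineq] add_mono)
      show "norm (sc mp * (D * E)) \<le> 4 * (d * norm E)"
        unfolding norm_sc_mult by (intro mult_mono dP nDR) auto
      show "norm (P * (N * E)) \<le> 5 * (d * norm E)" using nPX[of "N * E"] nNR[of E] by linarith
    qed
    ultimately show ?thesis using norm_tr_le[of "P * M * E"] by simp
  qed
  have nG: "norm ?G \<le> 6"
    using near[OF R] dP(3) norm_triangle_ineq[of "?G - P" P] by (simp add: near_proj_def)
  have d: "M * Q * P - M * R * P = M * (E * P)" by (simp add: E_def algebra_simps)
  have t: "tr (M * R * P) = ?t - tr (M * (E * P))" unfolding d[symmetric] by simp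
  \<comment> \<open>The two steps are normalised by different traces; the discrepancy
    \<open>tr (M * (E * P))\<close> is of order \<open>d * norm E\<close> by
    \<open>ntr\<close>.\<close>
  have "sc ?t * (graph_step M Q P - ?G) = M * (E * P) - sc (tr (M * (E * P))) * ?G"
    using gs[OF Q] gs[OF R] d unfolding t by (simp add: algebra_simps sc_simps(4))
  then have "norm ?t * norm (graph_step M Q P - ?G) = norm (M * (E * P) - sc (tr (M * (E * P))) * ?G)"
    by (metis norm_sc_mult)
  also have "\<dots> \<le> (4 * (d * ?e) + 7/10 * (?e + d * ?e) + d * ?e) + (2 * (4 * (d * norm E) + 5 * (d * norm E))) * 6"
    by (intro order_trans[OF norm_triangle_ineq4] add_mono nMEP)
      (simp only: norm_sc_mult, intro mult_mono ntr nG, auto simp: d_def)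
  also have "\<dots> \<le> 8/10 * norm E"
    using nE by (simp add: d_def algebra_simps)
  finally have "norm ?t * norm (graph_step M Q P - ?G) \<le> 8/10 * norm E" .
  moreover have "(179/100) * norm (graph_step M Q P - ?G) \<le> norm ?t * norm (graph_step M Q P - ?G)"
    by (intro mult_right_mono den1[OF Q]) auto
  ultimately show "norm (graph_step M Q P - graph_step M R P) \<le> norm (Q - R) / 2"
    unfolding E_def[symmetric] using nE by linarith
qed

section \<open>Invariant projections of a nearly split cocycle\<close>

lemma geometric_Cauchy_limit:
  fixes a :: "nat \<Rightarrow> 'a::banach"
  assumes "\<And>n. norm (a (Suc n) - a n) \<le> C * (1 / 2) ^ n"
  shows "\<exists>l. a \<longlonglongrightarrow> l \<and> (\<forall>n. norm (a n - l) \<le> 2 * C * (1 / 2) ^ n)"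
proof -
  have C: "C \<ge> 0" using assms[of 0] norm_ge_zero[of "a (Suc 0) - a 0"] by (simp del: norm_ge_zero)
  have step: "norm (a (n + k) - a n) \<le> 2 * C * (1 / 2) ^ n * (1 - (1 / 2) ^ k)" for n k
  proof (induction k)
    case (Suc k)
    have "norm (a (n + Suc k) - a n) \<le> norm (a (Suc (n + k)) - a (n + k)) + norm (a (n + k) - a n)"
      using norm_triangle_ineq[of "a (Suc (n + k)) - a (n + k)" "a (n + k) - a n"] by simp
    also have "\<dots> \<le> C * (1 / 2) ^ (n + k) + 2 * C * (1 / 2) ^ n * (1 - (1 / 2) ^ k)"
      by (intro add_mono assms Suc)
    also have "\<dots> = 2 * C * (1 / 2) ^ n * (1 - (1 / 2) ^ Suc k)" by (simp add: power_add algebra_simps)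
    finally show ?case .
  qed simp
  have bd: "norm (a (n + k) - a n) \<le> 2 * C * (1 / 2) ^ n" for n k
    using step[of n k] C mult_left_mono[of "1 - (1/2)^k" 1 "2 * C * (1/2)^n"] by simp
  have z: "(\<lambda>n. 2 * C * (1 / 2) ^ n) \<longlonglongrightarrow> 0"
    by (rule tendsto_mult_right_zero[OF LIMSEQ_power_zero]) simp
  have "Cauchy a"
  proof (rule CauchyI')
    fix e :: real assume "e > 0"
    then obtain N where "\<forall>n\<ge>N. 2 * C * (1 / 2) ^ n < e"
      using order_tendstoD(2)[OF z] by (auto simp: eventually_sequentially)
    then have "\<forall>m\<ge>N. \<forall>n>m. dist (a m) (a n) < e"
      unfolding dist_norm
      using bd by (metis le_add_diff_inverse less_imp_le_nat norm_minus_commute order_le_less_trans)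
    then show "\<exists>M. \<forall>m\<ge>M. \<forall>n>m. dist (a m) (a n) < e" by blast
  qed
  then obtain l where l: "a \<longlonglongrightarrow> l" using Cauchy_convergent convergent_def by blast
  have "norm (a n - l) \<le> 2 * C * (1 / 2) ^ n" for n
  proof (rule LIMSEQ_le_const2)
    show "(\<lambda>k. norm (a n - a (k + n))) \<longlonglongrightarrow> norm (a n - l)"
      by (intro tendsto_intros LIMSEQ_ignore_initial_segment l)
    show "\<exists>N. \<forall>k\<ge>N. norm (a n - a (k + n)) \<le> 2 * C * (1 / 2) ^ n"
      using bd[of n] by (metis add.commute norm_minus_commute)
  qed
  with l show ?thesis by blast
qed

section \<open>Separately holomorphic matrix functions\<close>

definition sep_holo :: "real \<Rightarrow> (complex \<Rightarrow> complex \<Rightarrow> complex) \<Rightarrow> bool" where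
  "sep_holo k f \<longleftrightarrow> (\<forall>w\<in>strip k. (\<lambda>z. f z w) holomorphic_on strip k) \<and> (\<forall>z\<in>strip k. f z holomorphic_on strip k)"

named_theorems sep_holo_intros

lemma sep_holo_arith [sep_holo_intros]:
  "sep_holo k (\<lambda>z w. c)"
  "sep_holo k f \<Longrightarrow> sep_holo k g \<Longrightarrow> sep_holo k (\<lambda>z w. f z w + g z w)"
  "sep_holo k f \<Longrightarrow> sep_holo k g \<Longrightarrow> sep_holo k (\<lambda>z w. f z w - g z w)"
  "sep_holo k f \<Longrightarrow> sep_holo k g \<Longrightarrow> sep_holo k (\<lambda>z w. f z w * g z w)"
  "sep_holo k f \<Longrightarrow> sep_holo k (\<lambda>z w. - f z w)"
  "sep_holo k f \<Longrightarrow> sep_holo k (\<lambda>z w. f z w ^ n)"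
  by (auto simp: sep_holo_def intro!: holomorphic_intros)

lemma sep_holo_divide:
  "sep_holo k f \<Longrightarrow> sep_holo k g \<Longrightarrow> (\<And>z w. z \<in> strip k \<Longrightarrow> w \<in> strip k \<Longrightarrow> g z w \<noteq> 0) \<Longrightarrow>
    sep_holo k (\<lambda>z w. f z w / g z w)"
  by (auto simp: sep_holo_def intro!: holomorphic_intros)

lemma holomorphic_on_strip_shift:
  assumes "f holomorphic_on strip k" shows "(\<lambda>z. f (z + of_real a)) holomorphic_on strip k"
proof -
  have "(f \<circ> (\<lambda>z. z + of_real a)) holomorphic_on strip k"
    by (rule holomorphic_on_compose_gen[OF _ assms]) (auto intro!: holomorphic_intros)
  then show ?thesis by (simp add: o_def)
qed

lemma sep_holo_shift: "sep_holo k f \<Longrightarrow> sep_holo k (\<lambda>z w. f (z + of_real a) (w + of_real b))"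
  unfolding sep_holo_def using holomorphic_on_strip_shift[of "\<lambda>z. f z (w + of_real b)" for w]
    holomorphic_on_strip_shift[of "f (z + of_real a)" for z] by simp

definition mat_holo :: "real \<Rightarrow> (complex \<Rightarrow> complex \<Rightarrow> mat2) \<Rightarrow> bool" where
  "mat_holo k F \<longleftrightarrow> sep_holo k (\<lambda>z w. m11 (F z w)) \<and> sep_holo k (\<lambda>z w. m12 (F z w)) \<and>
     sep_holo k (\<lambda>z w. m21 (F z w)) \<and> sep_holo k (\<lambda>z w. m22 (F z w))"

lemma mat_holo_shift: "mat_holo k F \<Longrightarrow> mat_holo k (\<lambda>z w. F (z + of_real a) (w + of_real b))"
  unfolding mat_holo_def
  using sep_holo_shift[of k "\<lambda>z w. m11 (F z w)" a b] sep_holo_shift[of k "\<lambda>z w. m12 (F z w)" a b]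
    sep_holo_shift[of k "\<lambda>z w. m21 (F z w)" a b] sep_holo_shift[of k "\<lambda>z w. m22 (F z w)" a b] by simp

lemma mat_holo_mult: "mat_holo k F \<Longrightarrow> mat_holo k G \<Longrightarrow> mat_holo k (\<lambda>z w. F z w * G z w)"
  unfolding mat_holo_def by (auto intro!: sep_holo_intros)

lemma sep_holo_tr: "mat_holo k F \<Longrightarrow> sep_holo k (\<lambda>z w. tr (F z w))"
  unfolding mat_holo_def tr_def by (auto intro!: sep_holo_intros)

section \<open>The fixed point of the graph transform\<close>

primrec pullback_iter :: "(complex \<Rightarrow> complex \<Rightarrow> mat2) \<Rightarrow> (complex \<Rightarrow> complex \<Rightarrow> mat2) \<Rightarrow> real \<Rightarrow> real \<Rightarrow>
    nat \<Rightarrow> complex \<Rightarrow> complex \<Rightarrow> mat2" where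
  "pullback_iter M P a b 0 = P"
| "pullback_iter M P a b (Suc n) = (\<lambda>z w.
     graph_step (M z w) (pullback_iter M P a b n (z + of_real a) (w + of_real b)) (P z w))"

definition pullback_lim where
  "pullback_lim M P a b z w = lim (\<lambda>n. pullback_iter M P a b n z w)"

text \<open>The translation \<open>(a, b)\<close> is real, so it maps the product of strips onto
  itself and no width is lost in the iteration.\<close>

locale split_field =
  fixes M P :: "complex \<Rightarrow> complex \<Rightarrow> mat2" and k a b :: real and mp mm :: "complex \<Rightarrow> complex \<Rightarrow> complex"
  assumes k: "k > 0" and M: "mat_holo k M" and P: "mat_holo k P"
    and split: "\<And>z w. z \<in> strip k \<Longrightarrow> w \<in> strip k \<Longrightarrow>
      almost_split (M z w) (P z w) (P (z + of_real a) (w + of_real b)) (mp z w) (mm z w)"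
begin

abbreviation "it \<equiv> pullback_iter M P a b"
abbreviation "proj \<equiv> pullback_lim M P a b"

lemma P_rank_one: "z \<in> strip k \<Longrightarrow> w \<in> strip k \<Longrightarrow> dt2 (P z w) = 0 \<and> tr (P z w) = 1 \<and> norm (P z w) \<le> 5"
  using split by (auto simp: almost_split_def)

lemma it_Suc: "it (Suc n) z w = graph_step (M z w) (it n (z + of_real a) (w + of_real b)) (P z w)"
  by simp

lemma near_it: "z \<in> strip k \<Longrightarrow> w \<in> strip k \<Longrightarrow> near_proj (P z w) (it n z w)"
proof (induction n arbitrary: z w)
  case 0
  then show ?case using rank_one_idem P_rank_one by (simp add: near_proj_def)
next
  case (Suc n)
  show ?case unfolding pullback_iter.simps
    by (rule graph_step_props(2)[OF split Suc.IH]) (use Suc.prems in auto)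
qed

lemma it_diff: "z \<in> strip k \<Longrightarrow> w \<in> strip k \<Longrightarrow> norm (it (Suc n) z w - it n z w) \<le> 1/100 * (1/2) ^ n"
proof (induction n arbitrary: z w)
  case 0
  then show ?case using near_it[OF 0, of 1] by (simp add: near_proj_def)
next
  case (Suc n)
  let ?z = "z + of_real a" and ?w = "w + of_real b"
  have "norm (it (Suc (Suc n)) z w - it (Suc n) z w) \<le> norm (it (Suc n) ?z ?w - it n ?z ?w) / 2"
    unfolding it_Suc[of "Suc n" z w] it_Suc[of n z w]
    by (rule graph_step_props(3)[OF split near_it near_it]) (use Suc.prems in auto)
  also have "\<dots> \<le> (1/100 * (1/2) ^ n) / 2"
    using Suc.IH[of ?z ?w] Suc.prems by simp
  finally show ?case by simp
qed

lemma it_lim: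
  assumes "z \<in> strip k" "w \<in> strip k"
  shows "(\<lambda>n. it n z w) \<longlonglongrightarrow> proj z w" "norm (it n z w - proj z w) \<le> 1/50 * (1/2) ^ n"
proof -
  obtain l where l: "(\<lambda>n. it n z w) \<longlonglongrightarrow> l" "\<forall>n. norm (it n z w - l) \<le> 2 * (1/100) * (1/2) ^ n"
    using geometric_Cauchy_limit[OF it_diff[OF assms]] by blast
  moreover have "proj z w = l" unfolding pullback_lim_def using l(1) by (rule limI)
  ultimately show "(\<lambda>n. it n z w) \<longlonglongrightarrow> proj z w" "norm (it n z w - proj z w) \<le> 1/50 * (1/2) ^ n" by auto
qed

lemma near_proj_lim:
  assumes "z \<in> strip k" "w \<in> strip k"
  shows "near_proj (P z w) (proj z w)"
proof -
  note l = it_lim(1)[OF assms] and n = near_it[OF assms, unfolded near_proj_def]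
  have "(\<lambda>n. it n z w * P z w) \<longlonglongrightarrow> proj z w * P z w" "(\<lambda>n. P z w * it n z w) \<longlonglongrightarrow> P z w * proj z w"
    by (intro tendsto_intros l)+
  then have "(\<lambda>n. it n z w) \<longlonglongrightarrow> proj z w * P z w" "(\<lambda>n. P z w) \<longlonglongrightarrow> P z w * proj z w"
    using n by auto
  then have "proj z w * P z w = proj z w" "P z w * proj z w = P z w"
    using LIMSEQ_unique[OF _ l] LIMSEQ_unique[OF tendsto_const] by (blast, metis)
  moreover have "norm (proj z w - P z w) \<le> 1/100"
    by (rule LIMSEQ_le_const2[OF tendsto_norm[OF tendsto_diff[OF l tendsto_const]]]) (use n in auto)
  ultimately show ?thesis by (simp add: near_proj_def)
qed

text \<open>The graph step is Lipschitz with constant 1/2 on projections near \<open>P\<close>, so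
  the recursion passes to the limit.\<close>

lemma proj_fix:
  assumes "z \<in> strip k" "w \<in> strip k"
  shows "proj z w = graph_step (M z w) (proj (z + of_real a) (w + of_real b)) (P z w)"
proof -
  let ?z = "z + of_real a" and ?w = "w + of_real b"
  let ?G = "\<lambda>Q. graph_step (M z w) Q (P z w)"
  have zw: "?z \<in> strip k" "?w \<in> strip k" using assms by auto
  have 1: "\<forall>n. norm (it (Suc n) z w - ?G (proj ?z ?w)) \<le> norm (it n ?z ?w - proj ?z ?w) / 2"
    unfolding it_Suc
    by (intro allI graph_step_props(3)[OF split near_it near_proj_lim]) (use assms zw in auto)
  have "(\<lambda>n. norm (it n ?z ?w - proj ?z ?w) / 2) \<longlonglongrightarrow> norm (proj ?z ?w - proj ?z ?w) / 2"
    by (intro tendsto_intros it_lim(1) zw) auto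
  then have 2: "(\<lambda>n. norm (it n ?z ?w - proj ?z ?w) / 2) \<longlonglongrightarrow> 0" by simp
  have "(\<lambda>n. it (Suc n) z w - ?G (proj ?z ?w)) \<longlonglongrightarrow> 0"
    by (rule Lim_null_comparison[OF always_eventually[OF 1] 2])
  then have "(\<lambda>n. it (Suc n) z w) \<longlonglongrightarrow> ?G (proj ?z ?w)" by (simp only: LIM_zero_iff)
  moreover have "(\<lambda>n. it (Suc n) z w) \<longlonglongrightarrow> proj z w" using it_lim(1)[OF assms] by (rule LIMSEQ_Suc)
  ultimately show ?thesis using LIMSEQ_unique by blast
qed

lemma it_denom:
  assumes "z \<in> strip k" "w \<in> strip k"
  shows "norm (tr (M z w * it n (z + of_real a) (w + of_real b) * P z w) - mp z w) \<le> 1/500"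
  by (rule graph_step_props(1)[OF split near_it]) (use assms in auto)

lemma proj_denom:
  assumes "z \<in> strip k" "w \<in> strip k"
  shows "norm (tr (M z w * proj (z + of_real a) (w + of_real b) * P z w) - mp z w) \<le> 1/500"
  by (rule graph_step_props(1)[OF split near_proj_lim]) (use assms in auto)

lemma it_denom_nz:
  assumes "z \<in> strip k" "w \<in> strip k"
  shows "tr (M z w * it n (z + of_real a) (w + of_real b) * P z w) \<noteq> 0"
  using it_denom[OF assms, of n] split[OF assms] by (auto simp: almost_split_def)

lemma mat_holo_it: "mat_holo k (it n)"
proof (induction n)
  case (Suc n)
  have N: "mat_holo k (\<lambda>z w. M z w * it n (z + of_real a) (w + of_real b) * P z w)"
    by (intro mat_holo_mult mat_holo_shift Suc M P)
  then have "sep_holo k (\<lambda>z w. 1 / tr (M z w * it n (z + of_real a) (w + of_real b) * P z w))"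
    by (intro sep_holo_divide sep_holo_tr sep_holo_intros it_denom_nz)
  then have "mat_holo k (\<lambda>z w. sc (1 / tr (M z w * it n (z + of_real a) (w + of_real b) * P z w)))"
    unfolding mat_holo_def by (auto intro: sep_holo_intros)
  from mat_holo_mult[OF this N] show ?case
    by (simp add: graph_step_def)
qed (simp add: P)

lemma sep_holo_entry_lim:
  assumes g: "bounded_linear g" "\<And>A. norm (g A) \<le> norm A" and h: "\<And>n. sep_holo k (\<lambda>z w. g (it n z w) :: complex)"
  shows "sep_holo k (\<lambda>z w. g (proj z w))"
proof -
  have est: "dist (g (it n z w)) (g (proj z w)) \<le> 1/50 * (1/2) ^ n" if "z \<in> strip k" "w \<in> strip k" for n z w
    using g(2)[of "it n z w - proj z w"] it_lim(2)[OF that, of n] linear_diff[OF bounded_linear.linear[OF g(1)]]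
    by (simp add: dist_norm)
  have z: "(\<lambda>n. 1/50 * (1/2) ^ n :: real) \<longlonglongrightarrow> 0"
    by (rule tendsto_mult_right_zero[OF LIMSEQ_power_zero]) simp
  have ul: "uniform_limit (strip k) (\<lambda>n x. F n x) f sequentially"
    if "\<And>n x. x \<in> strip k \<Longrightarrow> dist (F n x) (f x) \<le> 1/50 * (1/2) ^ n" for F and f :: "complex \<Rightarrow> complex"
    unfolding uniform_limit_iff
  proof (intro allI impI)
    fix e :: real assume "e > 0"
    with z have "\<forall>\<^sub>F n in sequentially. 1/50 * (1/2) ^ n < e" by (rule order_tendstoD(2))
    then show "\<forall>\<^sub>F n in sequentially. \<forall>x\<in>strip k. dist (F n x) (f x) < e"
      by eventually_elim (meson that le_less_trans)
  qed
  have hol: "f holomorphic_on strip k" if "\<And>n. F n holomorphic_on strip k"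
    "\<And>n x. x \<in> strip k \<Longrightarrow> dist (F n x) (f x) \<le> 1/50 * (1/2) ^ n" for F :: "nat \<Rightarrow> complex \<Rightarrow> complex" and f
  proof (rule holomorphic_uniform_sequence[OF open_strip that(1)])
    fix x assume "x \<in> strip k"
    then obtain d where "d > 0" "cball x d \<subseteq> strip k" using open_strip open_contains_cball by blast
    then show "\<exists>d>0. cball x d \<subseteq> strip k \<and> uniform_limit (cball x d) F f sequentially"
      using uniform_limit_on_subset[OF ul[of F f, OF that(2)]] by blast
  qed
  show ?thesis unfolding sep_holo_def
  proof (intro conjI ballI)
    fix w assume w: "w \<in> strip k"
    show "(\<lambda>z. g (proj z w)) holomorphic_on strip k"
      by (rule hol[where F="\<lambda>n z. g (it n z w)"]) (use h w est in \<open>auto simp: sep_holo_def\<close>)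
  next
    fix z assume z: "z \<in> strip k"
    show "(\<lambda>w. g (proj z w)) holomorphic_on strip k"
      by (rule hol[where F="\<lambda>n w. g (it n z w)"]) (use h z est in \<open>auto simp: sep_holo_def\<close>)
  qed
qed

lemma mat_holo_proj: "mat_holo k proj"
  unfolding mat_holo_def
  using mat_holo_it unfolding mat_holo_def
  by (auto intro!: sep_holo_entry_lim bounded_linear_entries norm_entries_le)

lemma norm_proj_le: "z \<in> strip k \<Longrightarrow> w \<in> strip k \<Longrightarrow> norm (proj z w) \<le> 6"
  using near_proj_lim P_rank_one norm_triangle_ineq[of "proj z w - P z w" "P z w"] by (force simp: near_proj_def)

lemma smooth2_proj:
  "smooth2 (\<lambda>t y. m11 (proj (of_real t) (of_real y)))" "smooth2 (\<lambda>t y. m12 (proj (of_real t) (of_real y)))"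
  "smooth2 (\<lambda>t y. m21 (proj (of_real t) (of_real y)))" "smooth2 (\<lambda>t y. m22 (proj (of_real t) (of_real y)))"
proof -
  have "smooth2 (\<lambda>t y. g (proj (of_real t) (of_real y)))"
    if "sep_holo k (\<lambda>z w. g (proj z w))" "\<And>A. norm (g A) \<le> norm A" for g
  proof (rule strip_holo_smooth2[OF _ k])
    show "strip_holo k 6 (\<lambda>z w. g (proj z w))"
      using that norm_proj_le unfolding strip_holo_def sep_holo_def by (meson order_trans)
  qed
  then show "smooth2 (\<lambda>t y. m11 (proj (of_real t) (of_real y)))" "smooth2 (\<lambda>t y. m12 (proj (of_real t) (of_real y)))"
    "smooth2 (\<lambda>t y. m21 (proj (of_real t) (of_real y)))" "smooth2 (\<lambda>t y. m22 (proj (of_real t) (of_real y)))"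
    using mat_holo_proj norm_entries_le unfolding mat_holo_def by blast+
qed

lemma it_periodic:
  assumes "\<And>z w. M z (w + 1) = M z w" "\<And>z w. P z (w + 1) = P z w"
  shows "it n z (w + 1) = it n z w"
proof (induction n arbitrary: z w)
  case (Suc n)
  have "it n (z + of_real a) (w + 1 + of_real b) = it n (z + of_real a) (w + of_real b)"
    using Suc[of "z + of_real a" "w + of_real b"] by (simp add: add_ac)
  then show ?case unfolding it_Suc by (simp add: assms)
qed (simp add: assms)

text \<open>\<open>M\<close> intertwines \<open>U w\<close> with \<open>U (w + b)\<close>, two
  different matrices, so conjugating a step leaves the factor \<open>C\<close>, the inverse of
  \<open>U (w + b)\<close> times \<open>U w\<close>, between the two projections. Both have rank
  one, and by \<open>rank_one_middle\<close> the factor disappears after division by the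
  trace.\<close>

lemma it_equivariant:
  assumes U: "\<And>w. dt2 (U w) \<noteq> 0" and PU: "\<And>z w. P (z - 1) w * U w = U w * P z w"
    and MU: "\<And>z w. M (z - 1) w * U (w + of_real b) = sc (c w) * (U w * M z w)" and c: "\<And>w. c w \<noteq> 0"
    and zw: "z \<in> strip k" "w \<in> strip k"
  shows "it n (z - 1) w * U w = U w * it n z w"
  using zw
proof (induction n arbitrary: z w)
  case (Suc n)
  let ?z = "z + of_real a" and ?w = "w + of_real b"
  have z1: "z - 1 \<in> strip k" using Suc.prems by (simp add: strip_def)
  have zw': "?z \<in> strip k" "?w \<in> strip k" using Suc.prems by auto
  define V where "V w = sc (1 / dt2 (U w)) * adj (U w)" for w
  have UV: "U w * V w = 1" "V w * U w = 1" for w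
    using U[of w] unfolding V_def sc_left[of "U w"] mult.assoc adj_mult
    by (simp_all add: sc_simps(6)[symmetric] sc_simps(2))
  define Q where "Q = it n ?z ?w"
  define C where "C = V ?w * U w"
  let ?M = "M z w" and ?P = "P z w" and ?U = "U w"
  have Q1: "it n (z - 1 + of_real a) ?w * U ?w = U ?w * Q"
    using Suc.IH[OF zw'] by (simp add: Q_def diff_add_eq)
  let ?Q1 = "it n (z - 1 + of_real a) ?w"
  have Q1': "?Q1 = U ?w * Q * V ?w"
    by (metis Q1 UV(1) mult.assoc mult.right_neutral)
  have N: "M (z - 1) w * ?Q1 * P (z - 1) w * ?U = sc (c w) * (?U * (?M * Q * C * ?P))"
  proof -
    have "M (z - 1) w * ?Q1 * P (z - 1) w * ?U = (M (z - 1) w * U ?w) * Q * V ?w * (?U * ?P)"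
      unfolding Q1' by (simp add: mult.assoc PU)
    then show ?thesis unfolding MU C_def by (simp add: mult.assoc)
  qed
  have t1: "tr (M (z - 1) w * ?Q1 * P (z - 1) w) = c w * tr (?M * Q * C * ?P)"
  proof -
    have "M (z - 1) w * ?Q1 * P (z - 1) w = M (z - 1) w * ?Q1 * P (z - 1) w * ?U * V w"
      by (simp add: mult.assoc UV)
    also have "\<dots> = sc (c w) * (?U * (?M * Q * C * ?P) * V w)"
      unfolding N by (simp add: mult.assoc)
    finally have "tr (M (z - 1) w * ?Q1 * P (z - 1) w) = c w * tr (?U * (?M * Q * C * ?P) * V w)" by simp
    also have "tr (?U * (?M * Q * C * ?P) * V w) = tr (V w * (?U * (?M * Q * C * ?P)))" by (rule tr_commute)
    also have "V w * (?U * (?M * Q * C * ?P)) = ?M * Q * C * ?P"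
      by (metis UV(2) mult.assoc mult_1)
    finally show ?thesis .
  qed
  have "tr (M (z - 1) w * ?Q1 * P (z - 1) w) \<noteq> 0" by (rule it_denom_nz[OF z1 Suc.prems(2)])
  then have t2: "tr (?M * Q * C * ?P) \<noteq> 0" using t1 by auto
  have t3: "tr (?M * Q * ?P) \<noteq> 0" unfolding Q_def by (rule it_denom_nz[OF Suc.prems])
  have "dt2 Q = 0"
    using near_projD[OF near_it[OF zw']] P_rank_one[OF zw'] by (simp add: Q_def)
  then have mid: "sc (tr (?M * Q * ?P)) * (?M * Q * C * ?P) = sc (tr (?M * Q * C * ?P)) * (?M * Q * ?P)"
    using rank_one_middle P_rank_one[OF Suc.prems] by blast
  have gs: "sc (1 / tr (?M * Q * C * ?P)) * (?M * Q * C * ?P) = graph_step ?M Q ?P"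
  proof -
    have "?M * Q * C * ?P = sc (1 / tr (?M * Q * ?P)) * (sc (tr (?M * Q * C * ?P)) * (?M * Q * ?P))"
      using mid sc_cancel(1)[OF t3] by metis
    also have "\<dots> = sc (tr (?M * Q * C * ?P)) * graph_step ?M Q ?P"
      unfolding graph_step_def by (rule sc_left)
    finally show ?thesis using sc_cancel(1)[OF t2] by metis
  qed
  have "it (Suc n) (z - 1) w * ?U = sc (1 / tr (M (z - 1) w * ?Q1 * P (z - 1) w)) * (M (z - 1) w * ?Q1 * P (z - 1) w * ?U)"
    by (simp add: graph_step_def mult.assoc)
  also have "\<dots> = sc (1 / tr (?M * Q * C * ?P)) * (?U * (?M * Q * C * ?P))"
    unfolding N t1 mult.assoc[symmetric] sc_simps(6)[symmetric] using c[of w] by simp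
  also have "\<dots> = ?U * graph_step ?M Q ?P"
    unfolding gs[symmetric] by (rule sc_left[symmetric])
  finally show ?case by (simp add: Q_def)
qed (simp add: PU)

lemma proj_periodic:
  assumes "\<And>z w. M z (w + 1) = M z w" "\<And>z w. P z (w + 1) = P z w"
  shows "proj z (w + 1) = proj z w"
  using it_periodic[OF assms] by (simp add: pullback_lim_def)

lemma proj_equivariant:
  assumes "\<And>w. dt2 (U w) \<noteq> 0" and "\<And>z w. P (z - 1) w * U w = U w * P z w"
    and "\<And>z w. M (z - 1) w * U (w + of_real b) = sc (c w) * (U w * M z w)" and "\<And>w. c w \<noteq> 0"
    and zw: "z \<in> strip k" "w \<in> strip k"
  shows "proj (z - 1) w * U w = U w * proj z w"
proof -
  have z1: "z - 1 \<in> strip k" using zw by (simp add: strip_def)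
  have "(\<lambda>n. it n (z - 1) w * U w) \<longlonglongrightarrow> proj (z - 1) w * U w" "(\<lambda>n. U w * it n z w) \<longlonglongrightarrow> U w * proj z w"
    by (intro tendsto_intros it_lim(1) zw z1)+
  then show ?thesis using it_equivariant[OF assms] LIMSEQ_unique by auto
qed

end

section \<open>The unperturbed cubed operator\<close>

text \<open>A primitive sixth root of unity, \<open>exp (\<i> * pi / 3)\<close>: for frequencies 1/3
  the phases of the three shifts are powers of it.\<close>

definition om :: complex where "om = Complex (1 / 2) (sqrt 3 / 2)"

lemma om_facts: "om ^ 2 = om - 1" "norm om = 1" "om \<noteq> 0" "1 / om = 1 - om" "cnj om = 1 - om"
proof -
  show 1: "om ^ 2 = om - 1"
    by (simp add: om_def complex_eq_iff power2_eq_square field_simps)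
  show 2: "norm om = 1" by (simp add: om_def cmod_def power_divide)
  then show nz: "om \<noteq> 0" by auto
  have "om * (1 - om) = 1" using 1 by (simp add: algebra_simps power2_eq_square)
  then show "1 / om = 1 - om" using nz by (simp add: field_simps)
  show "cnj om = 1 - om" by (simp add: om_def complex_eq_iff)
qed

lemma sqrt3_bounds: "17320 / 10000 \<le> sqrt 3" "sqrt 3 \<le> 17321 / 10000"
  by (rule real_le_rsqrt, simp add: power2_eq_square, rule real_le_lsqrt, simp_all add: power2_eq_square)

text \<open>These matrices act on \<open>(G(t, y), om * G(t - 1, y))\<close>: \<open>umat\<close>
  moves \<open>t\<close> to \<open>t - 1\<close> up to a factor, \<open>amat\<close> is one
  application of the operator, and \<open>rmat\<close> absorbs the period that three shifts by 1/3
  make up. \<open>kmat0\<close> is the resulting cube without its scalar factor.\<close>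

definition umat :: "complex \<Rightarrow> mat2" where "umat X = Mat2 0 1 X 0"
definition amat :: "complex \<Rightarrow> complex \<Rightarrow> complex \<Rightarrow> complex \<Rightarrow> mat2" where
  "amat p q X E = Mat2 (1 + q * E / 2) (p / 2) (p * X / 2) (1 - q * E / 2)"
definition rmat :: "complex \<Rightarrow> complex \<Rightarrow> complex \<Rightarrow> mat2" where
  "rmat q X E = Mat2 0 (- E) (q * X * E) 0"
text \<open>The traceless part of \<open>kmat0\<close>, in closed form; \<open>htr\<close> below is
  half the trace.\<close>

definition nmat :: "complex \<Rightarrow> complex \<Rightarrow> mat2" where
  "nmat X E = (let a = - (E^2) - E^4 / 8 + X * E^2 / 4; b = X + X^2 / 8 - X * E^2 / 4; c = 1 + (X + E^2) / 2
     in Mat2 (b * E) (a - c * E) (X * (a + c * E)) (- (b * E)))"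
definition htr :: "complex \<Rightarrow> complex \<Rightarrow> complex" where
  "htr X E = 3 * (2 * om - 1) / 4 * X * E^2"
text \<open>Normalised discriminant: the eigenvalues of \<open>kmat0\<close> are
  \<open>htr * (1 + s)\<close> and \<open>htr * (1 - s)\<close> with \<open>s^2 = disc\<close>. The
  constant term is 8/9, and near the torus the real part stays positive, so the principal root is
  holomorphic there.\<close>

definition disc :: "complex \<Rightarrow> complex \<Rightarrow> complex" where
  "disc X E = 16 / 27 * (3 / 2 + 1 / (X * E^2) - (X^3 + E^6) / (64 * (X * E^2)))"
text \<open>The spectral projection of \<open>kmat0 X E\<close> for its smaller eigenvalue \<open>htr X E * (1 - csqrt (disc X E))\<close>.\<close>

definition pmat :: "complex \<Rightarrow> complex \<Rightarrow> mat2" where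
  "pmat X E = sc (1 / 2) * (1 - sc (1 / (htr X E * csqrt (disc X E))) * nmat X E)"
definition kmat0 :: "complex \<Rightarrow> complex \<Rightarrow> mat2" where
  "kmat0 X E = amat (1 / om) om X E * amat 1 1 X E * amat om (1 / om) X E * rmat 1 X E"

lemma kmat0_decomp: "kmat0 X E = sc (htr X E) + nmat X E"
proof -
  have o2: "om * om = om - 1" using om_facts(1) by (simp add: power2_eq_square)
  show ?thesis
    unfolding kmat0_def om_facts(4)
    \<comment> \<open>Each entry is a polynomial identity in \<open>X\<close> and \<open>E\<close>
      modulo \<open>om * om = om - 1\<close>.\<close>
    by (rule mat2_eqI; simp add: amat_def rmat_def htr_def nmat_def Let_def eval_nat_numeral field_simps; use o2 in algebra)
qed

lemma nmat_square:
  assumes "X \<noteq> 0" "E \<noteq> 0"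
  shows "nmat X E * nmat X E = sc ((htr X E)^2 * disc X E)"
proof -
  have o: "(2 * om - 1)^2 = - 3" using om_facts(1) by algebra
  have "(htr X E)^2 = - (27 / 16) * (X * E^2)^2"
  proof -
    have "htr X E = (2 * om - 1) * (3 / 4 * (X * E^2))" by (simp add: htr_def field_simps)
    then have "(htr X E)^2 = (2 * om - 1)^2 * (3 / 4 * (X * E^2))^2" by (simp only: power_mult_distrib)
    also have "\<dots> = - (27 / 16) * (X * E^2)^2"
      unfolding o by (simp add: power_mult_distrib power_divide)
    finally show ?thesis .
  qed
  then have sq: "(htr X E)^2 = - (27 / 16) * (X * E^2)^2" .
  have W: "- (27 / 16) * W^2 * (16 / 27 * (3 / 2 + 1 / W - V / (64 * W))) = - W * (1 + 3 / 2 * W - V / 64)"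
    if "W \<noteq> 0" for W V :: complex
    using that by (simp add: field_simps power2_eq_square)
  have eq: "(htr X E)^2 * disc X E = - (X * E^2) * (1 + 3 / 2 * (X * E^2) - (X^3 + E^6) / 64)"
    unfolding sq disc_def by (rule W) (use assms in simp)
  show ?thesis
    unfolding eq by (intro mat2_eqI; simp add: nmat_def Let_def eval_nat_numeral field_simps)
qed

lemma nmat_tr: "tr (nmat X E) = 0" by (simp add: tr_def nmat_def Let_def)

lemma Re_sqrt_ge_half:
  assumes "s ^ 2 = d" "Re d \<ge> 1/4" "Re s \<ge> 0"
  shows "Re s \<ge> 1/2"
proof -
  have "Re d = (Re s)^2 - (Im s)^2" using assms(1) by (auto simp: power2_eq_square)
  then have "1/4 \<le> (Re s)^2" using assms(2) zero_le_power2[of "Im s"] by linarith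
  then have "(1/2)^2 \<le> (Re s)^2" by (simp add: power2_eq_square)
  then show ?thesis using assms(3) by (rule power2_le_imp_le)
qed

text \<open>A neighbourhood of the torus \<open>norm X = norm E = 1\<close>. The bound 101/100 is
  what a strip of half-width 1/1000 provides, because it exceeds
  \<open>exp (8/1000)\<close>.\<close>

locale near_torus =
  fixes X E :: complex
  assumes X: "norm X \<le> 101/100" "norm (inverse X) \<le> 101/100" and E: "norm E \<le> 101/100" "norm (inverse E) \<le> 101/100"
    and nz: "X \<noteq> 0" "E \<noteq> 0"
begin

abbreviation "s \<equiv> csqrt (disc X E)"

lemma pow_bounds: "norm X ^ m * norm E ^ n \<le> (101/100)^(m + n)"
  unfolding power_add by (intro mult_mono power_mono X E) auto

text \<open>Besides the constant 8/9 the term with coefficient 16/27 dominates; on the torus 16/27 +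
  2/108 is about 0.611. The bound must stay below 8/9 - 1/4, so that \<open>Re (disc X E)\<close> is
  at least 1/4 and \<open>Re s\<close> at least 1/2.\<close>

lemma disc_bound: "norm (disc X E - 8 / 9) \<le> 635/1000"
proof -
  have 1: "norm (1 / (X * E^2)) \<le> (101/100)^3"
  proof -
    have "norm (1 / (X * E^2)) = norm (inverse X) * norm (inverse E) ^ 2"
      by (simp add: norm_divide norm_mult norm_inverse norm_power field_simps)
    also have "\<dots> \<le> (101/100) * (101/100)^2"
      by (intro mult_mono power_mono X E) auto
    finally show ?thesis by (simp add: power3_eq_cube power2_eq_square)
  qed
  have 2: "norm (X^3 / (X * E^2)) \<le> (101/100)^4"
  proof -
    have "norm (X^3 / (X * E^2)) = norm X ^ 2 * norm (inverse E) ^ 2"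
      using nz by (simp add: norm_divide norm_mult norm_inverse norm_power field_simps eval_nat_numeral)
    also have "\<dots> \<le> (101/100)^2 * (101/100)^2"
      by (intro mult_mono power_mono X E) auto
    finally show ?thesis by (simp flip: power_add)
  qed
  have 3: "norm (E^6 / (X * E^2)) \<le> (101/100)^5"
  proof -
    have "norm (E^6 / (X * E^2)) = norm E ^ 4 * norm (inverse X)"
      using nz by (simp add: norm_divide norm_mult norm_inverse norm_power field_simps eval_nat_numeral)
    also have "\<dots> \<le> (101/100)^4 * (101/100)"
      by (intro mult_mono power_mono X E) auto
    finally show ?thesis by (simp add: eval_nat_numeral)
  qed
  have eq: "disc X E - 8 / 9 = 16/27 * (1 / (X * E^2)) - (1/108 * (X^3 / (X * E^2)) + 1/108 * (E^6 / (X * E^2)))"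
    by (simp add: disc_def add_divide_distrib algebra_simps)
  have "norm (disc X E - 8 / 9) \<le> 16/27 * (101/100)^3 + (1/108 * (101/100)^4 + 1/108 * (101/100)^5)"
    unfolding eq
    by (intro order_trans[OF norm_triangle_ineq4] order_trans[OF norm_triangle_ineq] add_mono)
      (use 1 2 3 in \<open>simp_all only: norm_mult, auto\<close>)
  then show ?thesis by (rule order_trans) (simp add: power_divide)
qed

lemma s_facts: "s^2 = disc X E" "Re s \<ge> 1/2" "norm s \<le> 124/100" "s \<noteq> 0" "Re (disc X E) > 0"
proof -
  show 1: "s^2 = disc X E" by simp
  have "8/9 - Re (disc X E) \<le> norm (disc X E - 8/9)"
    using abs_Re_le_cmod[of "disc X E - 8/9"] by simp
  then have 2: "Re (disc X E) \<ge> 1/4" using disc_bound by simp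
  then show "Re (disc X E) > 0" by simp
  show 3: "Re s \<ge> 1/2"
    by (rule Re_sqrt_ge_half[OF 1 2]) (use csqrt_principal[of "disc X E"] in auto)
  then show "s \<noteq> 0" by auto
  have "norm s ^ 2 = norm (disc X E)" by (metis 1 norm_power)
  also have "\<dots> \<le> norm (disc X E - 8/9) + norm (8/9 :: complex)"
    using norm_triangle_ineq[of "disc X E - 8/9" "8/9"] by simp
  also have "\<dots> \<le> (124/100)^2" using disc_bound by (simp add: norm_divide power2_eq_square)
  finally show "norm s \<le> 124/100" by (rule power2_le_imp_le) simp
qed

lemma htr_bounds: "126/100 \<le> norm (htr X E)" "norm (htr X E) \<le> 134/100" "htr X E \<noteq> 0"
proof -
  have "2 * om - 1 = Complex 0 (sqrt 3)" by (simp add: om_def complex_eq_iff)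
  then have n: "norm (htr X E) = 3 * sqrt 3 / 4 * (norm X * norm E ^ 2)"
  proof -
    have "norm (2 * om - 1) = sqrt 3" unfolding \<open>2 * om - 1 = Complex 0 (sqrt 3)\<close> by (simp add: cmod_def)
    moreover have h: "htr X E = (2 * om - 1) * (3 / 4 * (X * E^2))" by (simp add: htr_def field_simps)
    ultimately show ?thesis unfolding h norm_mult norm_power by simp
  qed
  have u: "norm X * norm E ^ 2 \<le> (101/100)^3" using pow_bounds[of 1 2] by (simp add: power_divide)
  have "norm (inverse X) * norm (inverse E) ^ 2 \<le> (101/100) * (101/100)^2"
    by (intro mult_mono power_mono X E) auto
  then have "inverse (norm X * norm E ^ 2) \<le> (101/100)^3"
    by (simp add: norm_inverse power_inverse power3_eq_cube power2_eq_square)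
  then have l: "norm X * norm E ^ 2 \<ge> inverse ((101/100)^3)"
    using nz by (metis inverse_inverse_eq le_imp_inverse_le inverse_positive_iff_positive mult_pos_pos zero_less_norm_iff zero_less_power)
  have "126/100 \<le> 3 * (17320/10000) / 4 * inverse ((101/100 :: real)^3)" by (simp add: power_divide)
  also have "\<dots> \<le> 3 * sqrt 3 / 4 * (norm X * norm E ^ 2)"
    using sqrt3_bounds l by (intro mult_mono) auto
  finally show 1: "126/100 \<le> norm (htr X E)" unfolding n .
  then show "htr X E \<noteq> 0" by auto
  have "3 * sqrt 3 / 4 * (norm X * norm E ^ 2) \<le> 3 * (17321/10000) / 4 * (101/100)^3"
    using sqrt3_bounds u by (intro mult_mono) auto
  also have "\<dots> \<le> 134/100" by (simp add: power_divide)
  finally show "norm (htr X E) \<le> 134/100" unfolding n .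
qed

lemma nmat_bound: "norm (nmat X E) \<le> 49/10"
proof -
  define a where "a = - (E^2) - E^4 / 8 + X * E^2 / 4"
  define b where "b = X + X^2 / 8 - X * E^2 / 4"
  define c where "c = 1 + (X + E^2) / 2"
  let ?r = "101/100 :: real"
  have m: "norm (X^m * E^n) \<le> ?r^(m + n)" for m n
    using pow_bounds[of m n] by (simp add: norm_mult norm_power)
  have e: "norm (E^2) \<le> 10201/10000" "norm (E^4) \<le> 10407/10000" "norm (X * E^2) \<le> 10304/10000"
    "norm X \<le> 101/100" "norm (X^2) \<le> 10201/10000"
    using m[of 0 2] m[of 0 4] m[of 1 2] m[of 1 0] m[of 2 0] by (simp_all add: power_divide)
  have a: "norm a \<le> 10201/10000 + 10407/10000 / 8 + 10304/10000 / 4"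
    unfolding a_def
    by (intro order_trans[OF norm_triangle_ineq] order_trans[OF norm_triangle_ineq4] add_mono)
      (use e in \<open>simp_all add: norm_divide\<close>)
  have "norm b \<le> 101/100 + 10201/10000 / 8 + 10304/10000 / 4"
    unfolding b_def
    by (intro order_trans[OF norm_triangle_ineq4] order_trans[OF norm_triangle_ineq] add_mono)
      (use e in \<open>simp_all add: norm_divide\<close>)
  then have b: "norm (b * E) \<le> (101/100 + 10201/10000 / 8 + 10304/10000 / 4) * ?r"
    unfolding norm_mult by (intro mult_mono E) auto
  have "norm ((X + E^2) / 2) \<le> (101/100 + 10201/10000) / 2"
    using norm_triangle_ineq[of X "E^2"] e by (simp add: norm_divide)
  then have "norm c \<le> 1 + (101/100 + 10201/10000) / 2"
    unfolding c_def using norm_triangle_ineq[of 1 "(X + E^2) / 2"] by simp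
  then have c: "norm (c * E) \<le> (1 + (101/100 + 10201/10000) / 2) * ?r"
    unfolding norm_mult by (intro mult_mono E) auto
  have 1: "norm (a - c * E) \<le> 345/100" "norm (a + c * E) \<le> 345/100"
    using norm_triangle_ineq4[of a "c * E"] norm_triangle_ineq[of a "c * E"] a c by (simp_all add: eval_nat_numeral)
  have 2: "norm (b * E) \<le> 141/100" using b by (simp add: eval_nat_numeral)
  have "norm (X * (a + c * E)) \<le> ?r * (345/100)"
    unfolding norm_mult[of X] by (intro mult_mono X 1) auto
  then show ?thesis
    using 1 2 unfolding norm_mat2_def nmat_def Let_def a_def[symmetric] b_def[symmetric] c_def[symmetric]
    by (intro max.boundedI) simp_all
qed

abbreviation "Pm \<equiv> pmat X E"

lemma nmat_sq: "nmat X E * nmat X E = sc ((htr X E * s)^2)"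
  using nmat_square[OF nz] s_facts(1) by (simp add: power_mult_distrib)

text \<open>The adjugate of a scalar plus a traceless matrix is the scalar minus that matrix, which
  exchanges the eigenvalues. So \<open>Pm\<close>, which belongs to the smaller eigenvalue of
  \<open>kmat0\<close>, is the dominant projection of the adjugate.\<close>

lemma pmat_props: "dt2 Pm = 0" "tr Pm = 1" "norm Pm \<le> 5"
  "adj (kmat0 X E) = sc (htr X E * (1 + s)) * Pm + sc (htr X E * (1 - s)) * (1 - Pm)"
proof -
  define g where "g = htr X E * s"
  have g: "g \<noteq> 0" using htr_bounds s_facts by (simp add: g_def)
  define n where "n = nmat X E"
  have nn: "m11 n * m11 n + m12 n * m21 n = g^2" and n22: "m22 n = - m11 n"
    using nmat_sq[folded g_def n_def] nmat_tr[of X E, folded n_def]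
    by (auto simp: tr_def eq_neg_iff_add_eq_0 add.commute sc_def times_mat2_def)
  have P: "Pm = sc (1 / 2) * (1 - sc (1 / g) * n)" by (simp add: pmat_def g_def n_def)
  show "tr Pm = 1" by (simp add: P tr_def n22 add_divide_distrib diff_divide_distrib)
  have "dt2 Pm = (1 - (m11 n * m11 n + m12 n * m21 n) / g^2) / 4"
    using g by (simp add: P dt2_def n22 field_simps power2_eq_square)
  then show "dt2 Pm = 0" using nn g by simp
  have "norm s \<ge> 1/2" using complex_Re_le_cmod[of s] s_facts(2) by linarith
  then have "norm g \<ge> 126/100 * (1/2)"
    unfolding g_def norm_mult using htr_bounds by (intro mult_mono) simp_all
  then have "norm (1 / g) \<le> 100/63"
    using g by (simp add: norm_divide field_simps)
  then have "norm (sc (1 / g) * n) \<le> 100/63 * (49/10)"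
    unfolding norm_sc_mult using nmat_bound by (intro mult_mono) (auto simp: n_def)
  then have "norm (1 - sc (1 / g) * n) \<le> 1 + 100/63 * (49/10)"
    using norm_triangle_ineq4[of 1 "sc (1 / g) * n"] by simp
  then show "norm Pm \<le> 5" unfolding P by simp
  have ad: "adj (sc (htr X E) + n) = sc (htr X E) - n" by (rule mat2_eqI) (auto simp: n22)
  show "adj (kmat0 X E) = sc (htr X E * (1 + s)) * Pm + sc (htr X E * (1 - s)) * (1 - Pm)"
    unfolding kmat0_decomp n_def[symmetric] ad P
    using g by (intro mat2_eqI) (simp_all add: g_def n22 field_simps)
qed

text \<open>The factor \<open>1 - s\<close> is controlled through
  \<open>(1 - s) * (1 + s) = 1 - disc X E\<close>, where \<open>norm (1 + s)\<close> is at least 3/2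
  and \<open>disc\<close> is close to 8/9.\<close>

lemma eigen_bounds: "9/5 \<le> norm (htr X E * (1 + s))" "norm (htr X E * (1 + s)) \<le> 4" "norm (htr X E * (1 - s)) \<le> 7/10"
proof -
  have 1: "norm (1 + s) \<ge> 3/2" using complex_Re_le_cmod[of "1 + s"] s_facts(2) by simp
  have 2: "norm (1 + s) \<le> 224/100" using norm_triangle_ineq[of 1 s] s_facts(3) by simp
  have "9/5 \<le> (126/100) * (3/2 :: real)" by simp
  also have "\<dots> \<le> norm (htr X E * (1 + s))" unfolding norm_mult using htr_bounds 1 by (intro mult_mono) auto
  finally show "9/5 \<le> norm (htr X E * (1 + s))" .
  have "norm (htr X E * (1 + s)) \<le> (134/100) * (224/100)"
    unfolding norm_mult using htr_bounds 2 by (intro mult_mono) auto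
  then show "norm (htr X E * (1 + s)) \<le> 4" by simp
  have "(1 - s) * (1 + s) = 1 - disc X E" using s_facts(1) by (simp add: algebra_simps power2_eq_square)
  then have "norm (1 - s) * norm (1 + s) = norm (1 - disc X E)" by (metis norm_mult)
  also have "\<dots> \<le> norm (disc X E - 8/9) + norm (1/9 :: complex)"
    using norm_triangle_ineq4[of "1/9 :: complex" "disc X E - 8/9"] by simp
  also have "\<dots> \<le> 635/1000 + 1/9" using disc_bound by (simp add: norm_divide)
  finally have "norm (1 - s) * norm (1 + s) \<le> 635/1000 + 1/9" .
  moreover have "norm (1 - s) * (3/2) \<le> norm (1 - s) * norm (1 + s)" using 1 by (intro mult_left_mono) auto
  ultimately have "norm (1 - s) \<le> 1/2" by linarith
  then have "norm (htr X E * (1 - s)) \<le> (134/100) * (1/2)"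
    unfolding norm_mult using htr_bounds by (intro mult_mono) auto
  then show "norm (htr X E * (1 - s)) \<le> 7/10" by simp
qed

end

section \<open>Perturbation of the cubed operator\<close>

lemma norm_exp_i_minus_1: "norm (exp (\<i> * of_real x) - 1) \<le> \<bar>x\<bar>" for x :: real
proof -
  have "norm (exp (\<i> * of_real x) - 1) = 2 * \<bar>sin (x / 2)\<bar>" by (rule dist_exp_i_1)
  also have "\<dots> \<le> 2 * \<bar>x / 2\<bar>" using abs_sin_x_le_abs_x[of "x / 2"] by simp
  finally show ?thesis by simp
qed

lemma norm_mult_diff_le:
  fixes a b c d :: "'a::real_normed_algebra"
  assumes "norm a \<le> B" "norm d \<le> C" "norm (a - c) \<le> e" "norm (b - d) \<le> f"
  shows "norm (a * b - c * d) \<le> B * f + C * e"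
proof -
  have B: "0 \<le> B" "0 \<le> e" using assms(1,3) norm_ge_zero order_trans by blast+
  have "a * b - c * d = a * (b - d) + (a - c) * d" by (simp add: algebra_simps)
  then have "norm (a * b - c * d) \<le> norm (a * (b - d)) + norm ((a - c) * d)"
    using norm_triangle_ineq[of "a * (b - d)"] by simp
  also have "\<dots> \<le> B * f + e * C"
    by (intro add_mono order_trans[OF norm_mult_ineq] mult_mono assms B) auto
  finally show ?thesis by (simp add: mult.commute)
qed

text \<open>Coordinates of the complexified torus. The constants \<open>om^2\<close> and
  \<open>1 / om\<close> centre the phases: at frequencies 1/3 the three factors of the cube have
  first parameter \<open>1 / om\<close>, \<open>1\<close>, \<open>om\<close>.\<close>

definition Xf :: "complex \<Rightarrow> complex" where "Xf w = om^2 * exp (- (2 * of_real pi * \<i> * w))"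
definition Ef :: "complex \<Rightarrow> complex" where "Ef z = exp (of_real pi * \<i> * z) / om"

lemma exp_om: "exp (\<i> * of_real (pi / 3)) = om"
  using cis_conv_exp[of "pi / 3"] by (simp add: om_def complex_eq_iff cos_60 sin_60)

lemma XE_shift: "Xf (w + of_real b) = Xf w * exp (\<i> * of_real (- (2 * pi * b)))"
  "Ef (z + of_real a) = Ef z * exp (\<i> * of_real (pi * a))" "Xf (w + 1) = Xf w" "Ef (z - 1) = - Ef z"
proof -
  show "Xf (w + of_real b) = Xf w * exp (\<i> * of_real (- (2 * pi * b)))"
    "Ef (z + of_real a) = Ef z * exp (\<i> * of_real (pi * a))"
    by (simp_all add: Xf_def Ef_def mult.assoc exp_add[symmetric] algebra_simps)
  have "exp (- (2 * of_real pi * \<i> * (w + 1))) = exp (- (2 * of_real pi * \<i> * w)) * exp (- (2 * of_real pi * \<i>))"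
    by (simp add: exp_add[symmetric] algebra_simps)
  also have "exp (- (2 * of_real pi * \<i>)) = (1 :: complex)" by (simp add: exp_minus)
  finally show "Xf (w + 1) = Xf w" by (simp add: Xf_def)
  have "exp (of_real pi * \<i> * (z - 1)) = exp (of_real pi * \<i> * z) * exp (- (of_real pi * \<i>))"
    by (simp add: exp_add[symmetric] algebra_simps)
  also have "exp (- (of_real pi * \<i>)) = (- 1 :: complex)" by (simp add: exp_minus)
  finally show "Ef (z - 1) = - Ef z" by (simp add: Ef_def)
qed

lemma near_torus_strip:
  assumes "z \<in> strip (1/1000)" "w \<in> strip (1/1000)"
  shows "near_torus (Xf w) (Ef z)"
proof -
  have e: "exp x \<le> 101/100" if "x \<le> 8/1000" for x :: real
  proof -
    have "exp x \<le> exp (8/1000)" using that by simp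
    also have "\<dots> \<le> 1 + 8/1000 + (8/1000)^2" by (rule exp_bound) auto
    finally show ?thesis by (simp add: power2_eq_square)
  qed
  have p: "\<bar>c * x\<bar> \<le> 8/1000" if "\<bar>x\<bar> < 1/1000" "0 \<le> c" "c \<le> 8" for c x :: real
    using mult_mono[of c 8 "\<bar>x\<bar>" "1/1000"] that by (simp add: abs_mult)
  have z: "\<bar>pi * Im z\<bar> \<le> 8/1000" and w: "\<bar>(2 * pi) * Im w\<bar> \<le> 8/1000"
    using assms pi_less_4 pi_gt_zero p[of "Im z" pi] p[of "Im w" "2 * pi"] by (simp_all add: strip_def)
  have nX: "norm (Xf w) = exp (2 * pi * Im w)" by (simp add: Xf_def norm_mult norm_power om_facts(2))
  have nE: "norm (Ef z) = exp (- (pi * Im z))" by (simp add: Ef_def norm_divide om_facts(2))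
  show ?thesis
  proof
    show "norm (Xf w) \<le> 101/100" "norm (inverse (Xf w)) \<le> 101/100"
      unfolding norm_inverse nX exp_minus[symmetric] by (rule e; use w in linarith)+
    show "norm (Ef z) \<le> 101/100" "norm (inverse (Ef z)) \<le> 101/100"
      unfolding norm_inverse nE exp_minus[symmetric] by (rule e; use z in linarith)+
  qed (use om_facts(3) in \<open>auto simp: Xf_def Ef_def\<close>)
qed

lemma norm_XE_real [simp]: "norm (Xf (of_real y)) = 1" "norm (Ef (of_real t)) = 1"
  by (simp_all add: Xf_def Ef_def norm_mult norm_divide norm_power om_facts(2))

lemma sep_holo_XE [sep_holo_intros]: "sep_holo k (\<lambda>z w. Xf w)" "sep_holo k (\<lambda>z w. Ef z)"
  unfolding sep_holo_def Xf_def Ef_def using om_facts by (auto intro!: holomorphic_intros)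

definition Pf :: "complex \<Rightarrow> complex \<Rightarrow> mat2" where "Pf z w = pmat (Xf w) (Ef z)"

lemma XE_nz [simp]: "Xf w \<noteq> 0" "Ef z \<noteq> 0" using om_facts by (auto simp: Xf_def Ef_def)

lemma mat_holo_Pf: "mat_holo (1/1000) Pf"
proof -
  let ?k = "1/1000 :: real"
  have d: "sep_holo ?k (\<lambda>z w. disc (Xf w) (Ef z))"
    unfolding disc_def by (intro sep_holo_intros sep_holo_divide) auto
  have nr: "disc (Xf w) (Ef z) \<notin> \<real>\<^sub>\<le>\<^sub>0" if "z \<in> strip ?k" "w \<in> strip ?k" for z w
    using near_torus.s_facts(5)[OF near_torus_strip[OF that]] by (auto simp: complex_nonpos_Reals_iff)
  then have s: "sep_holo ?k (\<lambda>z w. csqrt (disc (Xf w) (Ef z)))"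
    using d unfolding sep_holo_def by (auto intro!: holomorphic_on_csqrt')
  have h: "sep_holo ?k (\<lambda>z w. htr (Xf w) (Ef z))"
    unfolding htr_def by (intro sep_holo_intros)
  have g: "sep_holo ?k (\<lambda>z w. 1 / (htr (Xf w) (Ef z) * csqrt (disc (Xf w) (Ef z))))"
  proof (intro sep_holo_divide sep_holo_intros h s)
    fix z w assume zw: "z \<in> strip ?k" "w \<in> strip ?k"
    show "htr (Xf w) (Ef z) * csqrt (disc (Xf w) (Ef z)) \<noteq> 0"
      using near_torus.htr_bounds(3)[OF near_torus_strip[OF zw]] near_torus.s_facts(4)[OF near_torus_strip[OF zw]]
      by simp
  qed
  have n: "mat_holo ?k (\<lambda>z w. nmat (Xf w) (Ef z))"
    unfolding mat_holo_def nmat_def Let_def mat2.sel by (intro conjI sep_holo_intros sep_holo_divide) auto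
  have sc: "mat_holo ?k (\<lambda>z w. sc (1 / (htr (Xf w) (Ef z) * csqrt (disc (Xf w) (Ef z)))))"
    using g by (simp only: mat_holo_def sc_sel) (simp add: sep_holo_arith(1))
  have c: "mat_holo ?k (\<lambda>z w. A)" for A
    by (simp add: mat_holo_def sep_holo_arith(1))
  have d: "mat_holo ?k (\<lambda>z w. F z w - G z w)" if "mat_holo ?k F" "mat_holo ?k G" for F G
    using that unfolding mat_holo_def mat2_sel by (auto intro: sep_holo_arith(3))
  show ?thesis
    unfolding Pf_def pmat_def by (intro mat_holo_mult c d sc n)
qed

text \<open>In the application \<open>e1\<close> and \<open>e2\<close> are at most
  \<open>3 * sqrt 3 / 10^12\<close>, so the bound has a margin of nearly a factor two.\<close>

locale params =
  fixes al be e1 e2 :: real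
  assumes e1: "e1 = 3 * al - 1" and e2: "e2 = 3 * be - 1" and small: "\<bar>e1\<bar> \<le> 1 / 10^11" "\<bar>e2\<bar> \<le> 1 / 10^11"
begin

text \<open>The phases arise when the matrix \<open>diag(1, exp(- \<i> \<pi> be))\<close> of a shift is moved to the right through the product
  of three factors; for \<open>e1 = e2 = 0\<close> the matrix \<open>kmat\<close> is \<open>kmat0\<close>.\<close>

definition "p1 = exp (\<i> * of_real (pi * be)) / om"
definition "q1 = om * exp (- (\<i> * of_real (pi * al)))"
definition "p2 = exp (\<i> * of_real (2 * pi * be)) / om"
definition "q2 = om * exp (- (\<i> * of_real (2 * pi * al)))"
definition "q3 = exp (\<i> * of_real (pi * e2))"

definition kmat :: "complex \<Rightarrow> complex \<Rightarrow> mat2" where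
  "kmat X E = amat (1 / om) om X E * amat p1 q1 X E * amat p2 q2 X E * rmat q3 X E"

text \<open>\<open>kmat\<close> at \<open>(z, w)\<close> maps the vector over
  \<open>(z - e1, w - e2)\<close> to the one over \<open>(z, w)\<close>. Its adjugate, the inverse
  up to the determinant, goes back, the direction in which the line of the small eigenvalue
  attracts.\<close>

definition Mf :: "complex \<Rightarrow> complex \<Rightarrow> mat2" where
  "Mf z w = adj (kmat (Xf (w + of_real e2)) (Ef (z + of_real e1)))"

lemma phase_norms: "norm p1 = 1" "norm q1 = 1" "norm p2 = 1" "norm q2 = 1" "norm q3 = 1" "norm (1 / om) = 1"
  by (simp_all add: p1_def q1_def p2_def q2_def q3_def norm_mult norm_divide om_facts(2) exp_minus norm_inverse)

text \<open>Inserting \<open>al = (1 + e1) / 3\<close> and \<open>be = (1 + e2) / 3\<close>, each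
  phase is its unperturbed value times the exponential of \<i> times a multiple of
  \<open>pi * e1\<close> or \<open>pi * e2\<close>, with factor at most 1.\<close>

lemma phase_diffs: "norm (p1 - 1) \<le> 1 / 10^10" "norm (q1 - 1) \<le> 1 / 10^10" "norm (p2 - om) \<le> 1 / 10^10"
  "norm (q2 - 1 / om) \<le> 1 / 10^10" "norm (q3 - 1) \<le> 1 / 10^10"
proof -
  have *: "norm (exp (\<i> * of_real (r * e)) - 1) \<le> 1 / 10^10" if "\<bar>e\<bar> \<le> 1 / 10^11" "\<bar>r\<bar> \<le> 4" for r e :: real
  proof -
    have "\<bar>r * e\<bar> \<le> 4 * (1 / 10^11)" unfolding abs_mult using that by (intro mult_mono) auto
    then show ?thesis using norm_exp_i_minus_1[of "r * e"] by simp
  qed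
  have o2: "exp (\<i> * of_real (2 * (pi / 3))) = om * om"
    unfolding exp_om[symmetric] by (simp add: exp_add[symmetric] algebra_simps)
  have p1: "p1 = exp (\<i> * of_real (pi / 3 * e2))"
  proof -
    have "exp (\<i> * of_real (pi * be)) = exp (\<i> * of_real (pi / 3)) * exp (\<i> * of_real (pi / 3 * e2))"
      by (simp add: exp_add[symmetric] e2 field_simps)
    then show ?thesis unfolding p1_def exp_om using om_facts(3) by simp
  qed
  have q1: "q1 = exp (\<i> * of_real (- (pi / 3) * e1))"
  proof -
    have "\<i> * of_real (pi / 3) + - (\<i> * of_real (pi * al)) = \<i> * of_real (- (pi / 3) * e1)"
      by (simp add: e1 field_simps)
    then have "exp (\<i> * of_real (pi / 3)) * exp (- (\<i> * of_real (pi * al))) = exp (\<i> * of_real (- (pi / 3) * e1))"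
      unfolding exp_add[symmetric] by simp
    then show ?thesis unfolding q1_def exp_om .
  qed
  have p2: "p2 = om * exp (\<i> * of_real (2 * pi / 3 * e2))"
  proof -
    have "exp (\<i> * of_real (2 * pi * be)) = exp (\<i> * of_real (2 * (pi / 3))) * exp (\<i> * of_real (2 * pi / 3 * e2))"
      by (simp add: exp_add[symmetric] e2 field_simps)
    then show ?thesis unfolding p2_def o2 using om_facts(3) by simp
  qed
  have q2: "q2 = 1 / om * exp (\<i> * of_real (- (2 * pi / 3) * e1))"
  proof -
    have "\<i> * of_real (2 * (pi / 3)) + - (\<i> * of_real (2 * pi * al)) = \<i> * of_real (- (2 * pi / 3) * e1)"
      by (simp add: e1 field_simps)
    then have "exp (\<i> * of_real (2 * (pi / 3))) * exp (- (\<i> * of_real (2 * pi * al))) = exp (\<i> * of_real (- (2 * pi / 3) * e1))"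
      unfolding exp_add[symmetric] by simp
    then show ?thesis unfolding q2_def o2 using om_facts(3) by (simp add: field_simps)
  qed
  have pi: "\<bar>pi / 3\<bar> \<le> 4" "\<bar>- (pi / 3)\<bar> \<le> 4" "\<bar>2 * pi / 3\<bar> \<le> 4" "\<bar>- (2 * pi / 3)\<bar> \<le> 4" "\<bar>pi\<bar> \<le> 4"
    using pi_less_4 pi_gt_zero by auto
  show "norm (p1 - 1) \<le> 1 / 10^10" unfolding p1 by (rule *[OF small(2) pi(1)])
  show "norm (q1 - 1) \<le> 1 / 10^10" unfolding q1 by (rule *[OF small(1) pi(2)])
  have "p2 - om = om * (exp (\<i> * of_real (2 * pi / 3 * e2)) - 1)" unfolding p2 by (simp add: algebra_simps)
  then show "norm (p2 - om) \<le> 1 / 10^10" using *[OF small(2) pi(3)] om_facts(2) by (simp add: norm_mult)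
  have "q2 - 1 / om = (1 / om) * (exp (\<i> * of_real (- (2 * pi / 3) * e1)) - 1)" unfolding q2 by (simp add: algebra_simps)
  then have "norm (q2 - 1 / om) = norm (1 / om) * norm (exp (\<i> * of_real (- (2 * pi / 3) * e1)) - 1)"
    by (simp only: norm_mult)
  then show "norm (q2 - 1 / om) \<le> 1 / 10^10"
    using *[OF small(1) pi(4)] unfolding phase_norms(6) by (simp only: mult_1)
  show "norm (q3 - 1) \<le> 1 / 10^10" unfolding q3_def by (rule *[OF small(2) pi(5)])
qed

lemma amat_norm:
  assumes "norm p = 1" "norm q = 1" "near_torus X E"
  shows "norm (amat p q X E) \<le> 21/10"
proof -
  interpret near_torus X E by fact
  have "norm (1 + q * E / 2) \<le> 1 + 101/200" "norm (1 - q * E / 2) \<le> 1 + 101/200"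
    using norm_triangle_ineq[of 1 "q * E / 2"] norm_triangle_ineq4[of 1 "q * E / 2"] E assms
    by (simp_all add: norm_mult norm_divide)
  then show ?thesis
    unfolding norm_mat2_def amat_def using X assms by (intro max.boundedI) (simp_all add: norm_mult norm_divide)
qed

lemma amat_diff:
  assumes "norm p = 1" "norm q = 1" "near_torus X E" "near_torus X' E'"
    and "norm (p - p') \<le> 1 / 10^10" "norm (q - q') \<le> 1 / 10^10" "norm (X - X') \<le> 1 / 10^10" "norm (E - E') \<le> 1 / 10^10"
  shows "norm (amat p q X E - amat p' q' X' E') \<le> 1 / 10^9"
proof -
  interpret a: near_torus X E by fact
  interpret b: near_torus X' E' by fact
  have 1: "norm (q * E - q' * E') \<le> 1 * (1 / 10^10) + 101/100 * (1 / 10^10)"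
    by (rule norm_mult_diff_le) (use assms b.E in auto)
  have 2: "norm (p * X - p' * X') \<le> 1 * (1 / 10^10) + 101/100 * (1 / 10^10)"
    by (rule norm_mult_diff_le) (use assms b.X in auto)
  have n2: "norm (x / 2 - y / 2) = norm (x - y) / 2" for x y :: complex
    by (metis diff_divide_distrib norm_divide_numeral)
  show ?thesis
    unfolding norm_mat2_def amat_def using 1 2 assms(5) norm_minus_commute[of "q' * E'" "q * E"]
    by (intro max.boundedI) (simp_all add: n2)
qed

lemma rmat_norm:
  assumes "near_torus X E" "norm q = 1" shows "norm (rmat q X E) \<le> 21/10"
proof -
  interpret near_torus X E by fact
  have "norm X * norm E \<le> (101/100) * (101/100)" using X E by (intro mult_mono) auto
  then show ?thesis unfolding norm_mat2_def rmat_def using assms E by (simp add: norm_mult)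
qed

lemma rmat_diff:
  assumes "near_torus X E" "near_torus X' E'" "norm q = 1"
    and "norm (q - q') \<le> 1 / 10^10" "norm (X - X') \<le> 1 / 10^10" "norm (E - E') \<le> 1 / 10^10"
  shows "norm (rmat q X E - rmat q' X' E') \<le> 1 / 10^9"
proof -
  interpret a: near_torus X E by fact
  interpret b: near_torus X' E' by fact
  have 1: "norm (q * X - q' * X') \<le> 1 * (1 / 10^10) + 101/100 * (1 / 10^10)"
    by (rule norm_mult_diff_le) (use assms b.X in auto)
  have 2: "norm (q * X * E - q' * X' * E') \<le> 101/100 * (1 / 10^10) + 101/100 * (1 * (1 / 10^10) + 101/100 * (1 / 10^10))"
    by (rule norm_mult_diff_le[OF _ _ 1]) (use assms a.X b.E in \<open>auto simp: norm_mult\<close>)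
  show ?thesis unfolding norm_mat2_def rmat_def using 2 assms(6)
    by (intro max.boundedI) (simp_all add: norm_minus_commute)
qed

lemma prod4_diff:
  fixes A B C D A' B' C' D' :: mat2
  assumes "norm A \<le> 21/10" "norm B \<le> 21/10" "norm C \<le> 21/10" "norm B' \<le> 21/10" "norm C' \<le> 21/10" "norm D' \<le> 21/10"
    and d: "norm (A - A') \<le> 1/10^9" "norm (B - B') \<le> 1/10^9" "norm (C - C') \<le> 1/10^9" "norm (D - D') \<le> 1/10^9"
  shows "norm (A * B * C * D - A' * B' * C' * D') \<le> 1/10^7"
proof -
  have AB: "norm (A * B) \<le> 21/10 * (21/10)" by (intro order_trans[OF norm_mult_ineq] mult_mono assms) auto
  then have ABC: "norm (A * B * C) \<le> 21/10 * (21/10) * (21/10)" by (intro order_trans[OF norm_mult_ineq] mult_mono assms) auto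
  have "norm (A * B * C * D - A' * B' * C' * D') \<le>
    21/10 * (21/10) * (21/10) * (1/10^9) + 21/10 * (21/10 * (21/10) * (1/10^9) + 21/10 * (21/10 * (1/10^9) + 21/10 * (1/10^9)))"
    by (intro norm_mult_diff_le AB ABC assms)
  then show ?thesis by (rule order_trans) (simp add: power_divide)
qed

lemma shift_diffs:
  assumes "near_torus (Xf w) (Ef z)"
  shows "norm (Xf (w + of_real e2) - Xf w) \<le> 1/10^10" "norm (Ef (z + of_real e1) - Ef z) \<le> 1/10^10"
proof -
  interpret near_torus "Xf w" "Ef z" by fact
  have "norm (exp (\<i> * of_real (- (2 * pi * e2))) - 1) \<le> \<bar>- (2 * pi * e2)\<bar>" by (rule norm_exp_i_minus_1)
  also have "\<dots> \<le> 8 * (1 / 10^11)"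
    using small pi_less_4 by (simp only: abs_minus_cancel abs_mult, intro mult_mono) auto
  finally have 1: "norm (exp (\<i> * of_real (- (2 * pi * e2))) - 1) \<le> 8 * (1 / 10^11)" .
  have "norm (exp (\<i> * of_real (pi * e1)) - 1) \<le> \<bar>pi * e1\<bar>" by (rule norm_exp_i_minus_1)
  also have "\<dots> \<le> 8 * (1 / 10^11)"
    using small pi_less_4 by (simp only: abs_mult, intro mult_mono) auto
  finally have 2: "norm (exp (\<i> * of_real (pi * e1)) - 1) \<le> 8 * (1 / 10^11)" .
  have "Xf (w + of_real e2) - Xf w = Xf w * (exp (\<i> * of_real (- (2 * pi * e2))) - 1)"
    unfolding XE_shift by (simp add: algebra_simps)
  then have "norm (Xf (w + of_real e2) - Xf w) \<le> 101/100 * (8 * (1 / 10^11))"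
    using X 1 by (simp only: norm_mult, intro mult_mono) auto
  then show "norm (Xf (w + of_real e2) - Xf w) \<le> 1/10^10" by (rule order_trans) simp
  have "Ef (z + of_real e1) - Ef z = Ef z * (exp (\<i> * of_real (pi * e1)) - 1)"
    unfolding XE_shift by (simp add: algebra_simps)
  then have "norm (Ef (z + of_real e1) - Ef z) \<le> 101/100 * (8 * (1 / 10^11))"
    using E 2 by (simp only: norm_mult, intro mult_mono) auto
  then show "norm (Ef (z + of_real e1) - Ef z) \<le> 1/10^10" by (rule order_trans) simp
qed

lemma kmat_diff:
  assumes "z \<in> strip (1/1000)" "w \<in> strip (1/1000)"
  shows "norm (kmat (Xf (w + of_real e2)) (Ef (z + of_real e1)) - kmat0 (Xf w) (Ef z)) \<le> 1/10^7"
proof -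
  have nt: "near_torus (Xf w) (Ef z)" "near_torus (Xf (w + of_real e2)) (Ef (z + of_real e1))"
    using assms by (auto intro!: near_torus_strip)
  note s = shift_diffs[OF nt(1)]
  show ?thesis unfolding kmat_def kmat0_def
    by (intro prod4_diff amat_norm amat_diff rmat_norm rmat_diff phase_norms nt s phase_diffs)
      (simp_all add: om_facts)
qed

lemma mat_holo_Mf: "mat_holo k Mf"
proof -
  have a: "mat_holo k (\<lambda>z w. amat p q (Xf w) (Ef z))" for p q
    unfolding mat_holo_def amat_def mat2.sel by (intro conjI sep_holo_intros sep_holo_divide) auto
  have r: "mat_holo k (\<lambda>z w. rmat q (Xf w) (Ef z))" for q
    unfolding mat_holo_def rmat_def mat2.sel by (intro conjI sep_holo_intros)
  have "mat_holo k (\<lambda>z w. kmat (Xf w) (Ef z))"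
    unfolding kmat_def by (intro mat_holo_mult a r)
  then have "mat_holo k (\<lambda>z w. kmat (Xf (w + of_real e2)) (Ef (z + of_real e1)))" by (rule mat_holo_shift)
  then show ?thesis unfolding Mf_def mat_holo_def adj_sel by (auto intro: sep_holo_intros)
qed

text \<open>Entries bounded by 5 on the strip of half-width 1/1000 have Lipschitz constant 5 /
  (1/1000 - 1/2000) = 10000 on the narrower one. This is why the invariant projection is constructed
  on half-width 1/2000.\<close>

lemma Pf_shift_diff:
  assumes "z \<in> strip (1/2000)" "w \<in> strip (1/2000)"
  shows "norm (Pf z w - Pf (z + of_real e1) (w + of_real e2)) \<le> 1 / 10^5"
proof -
  have g: "norm (g (Pf z w) - g (Pf (z + of_real e1) (w + of_real e2))) \<le> 1/10^6"
    if "sep_holo (1/1000) (\<lambda>z w. g (Pf z w))" "\<And>A. norm (g A) \<le> norm A" for g :: "mat2 \<Rightarrow> complex"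
  proof -
    have "strip_holo (1/1000) 5 (\<lambda>z w. g (Pf z w))"
      unfolding strip_holo_def using that near_torus.pmat_props(3)[OF near_torus_strip]
      unfolding sep_holo_def Pf_def by (blast intro: order_trans)
    then have "norm (g (Pf z w) - g (Pf (z + of_real e1) (w + of_real e2))) \<le>
      5 / (1/1000 - 1/2000) * (norm (z - (z + of_real e1)) + norm (w - (w + of_real e2)))"
      by (rule strip_holo_lipschitz) (use assms in auto)
    also have "\<dots> = 10000 * (\<bar>e1\<bar> + \<bar>e2\<bar>)" by simp
    also have "\<dots> \<le> 10000 * (1/10^11 + 1/10^11)" using small by (intro mult_left_mono add_mono) auto
    finally show ?thesis by simp
  qed
  show ?thesis
    using mat_holo_Pf unfolding mat_holo_def
    using g[of m11] g[of m12] g[of m21] g[of m22] norm_entries_le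
      norm_mat2_le_sum[of "Pf z w - Pf (z + of_real e1) (w + of_real e2)"] by simp
qed

abbreviation "mpf z w \<equiv> htr (Xf w) (Ef z) * (1 + csqrt (disc (Xf w) (Ef z)))"
abbreviation "mmf z w \<equiv> htr (Xf w) (Ef z) * (1 - csqrt (disc (Xf w) (Ef z)))"

sublocale split_field Mf Pf "1/2000" e1 e2 mpf mmf
proof
  show "0 < (1/2000 :: real)" by simp
  show "mat_holo (1/2000) Mf" by (rule mat_holo_Mf)
  have sub: "strip (1/2000) \<subseteq> strip (1/1000)" by (rule strip_mono) simp
  have "sep_holo (1/2000) f" if "sep_holo (1/1000) f" for f
    using that sub unfolding sep_holo_def by (blast intro: holomorphic_on_subset)
  then show "mat_holo (1/2000) Pf" using mat_holo_Pf by (simp add: mat_holo_def)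
  fix z w assume zw: "z \<in> strip (1/2000)" "w \<in> strip (1/2000)"
  then have zw': "z \<in> strip (1/1000)" "w \<in> strip (1/1000)" using sub by auto
  interpret near_torus "Xf w" "Ef z" by (rule near_torus_strip[OF zw'])
  have zws: "z + of_real e1 \<in> strip (1/1000)" "w + of_real e2 \<in> strip (1/1000)" using zw' by auto
  have "norm (Mf z w - adj (kmat0 (Xf w) (Ef z))) \<le> 2 * (1/10^7)"
    unfolding Mf_def adj_diff[symmetric]
    by (rule order_trans[OF norm_adj_le]) (use kmat_diff[OF zw'] in simp)
  then show "almost_split (Mf z w) (Pf z w) (Pf (z + of_real e1) (w + of_real e2)) (mpf z w) (mmf z w)"
    unfolding almost_split_def
    using pmat_props eigen_bounds Pf_shift_diff[OF zw] near_torus.pmat_props(2)[OF near_torus_strip[OF zws]]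
    by (simp add: Pf_def)
qed

section \<open>Compatibility with the period translations\<close>

definition Uf :: "complex \<Rightarrow> mat2" where "Uf w = umat (Xf w)"

lemma Uf_nz: "dt2 (Uf w) \<noteq> 0" by (simp add: Uf_def umat_def dt2_def)

text \<open>Moving \<open>z\<close> to \<open>z - 1\<close> turns \<open>E\<close> into
  \<open>- E\<close>; \<open>htr\<close> and \<open>disc\<close> are even in \<open>E\<close>, and
  \<open>umat X\<close> intertwines the two matrices \<open>nmat\<close>.\<close>

lemma Pf_equivariant: "Pf (z - 1) w * Uf w = Uf w * Pf z w"
proof -
  have "htr X (- E) = htr X E" "disc X (- E) = disc X E" "nmat X (- E) * umat X = umat X * nmat X E" for X E
    by (auto simp: htr_def disc_def intro!: mat2_eqI simp: nmat_def umat_def Let_def algebra_simps)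
  then show ?thesis unfolding Pf_def Uf_def pmat_def XE_shift
    by (auto intro!: mat2_eqI simp: umat_def nmat_def Let_def algebra_simps)
qed

text \<open>\<open>umat X\<close> passes unchanged through every \<open>amat\<close>. Only
  \<open>rmat\<close> carries the phase \<open>q3\<close> of the drift \<open>e2\<close>, and it
  replaces \<open>X\<close> by \<open>X * q3^2\<close>, the value of \<open>Xf\<close> one
  translation back.\<close>

lemma kmat_equivariant: "kmat X (- E) * umat (X * q3^2) = sc q3 * (umat X * kmat X E)"
proof -
  have a: "amat p q X (- E) * umat X = umat X * amat p q X E" for p q
    by (auto intro!: mat2_eqI simp: amat_def umat_def algebra_simps)
  have r: "rmat q3 X (- E) * umat (X * q3^2) = sc q3 * (umat X * rmat q3 X E)"
    by (auto intro!: mat2_eqI simp: rmat_def umat_def power2_eq_square algebra_simps)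
  have a': "amat p q X (- E) * (umat X * Z) = umat X * (amat p q X E * Z)" for p q Z
    using a by (metis mult.assoc)
  have "kmat X (- E) * umat (X * q3^2) = amat (1 / om) om X (- E) * (amat p1 q1 X (- E) * (amat p2 q2 X (- E) * (sc q3 * (umat X * rmat q3 X E))))"
    unfolding kmat_def by (simp only: mult.assoc r)
  also have "\<dots> = sc q3 * (amat (1 / om) om X (- E) * (amat p1 q1 X (- E) * (amat p2 q2 X (- E) * (umat X * rmat q3 X E))))"
    unfolding sc_left[of "amat p q X (- E)" for p q] ..
  also have "\<dots> = sc q3 * (umat X * kmat X E)"
    unfolding a' kmat_def mult.assoc ..
  finally show ?thesis .
qed

lemma adj_mult_rev: "adj (A * B) = adj B * adj A"
  by (auto intro!: mat2_eqI simp: algebra_simps)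

lemma Mf_equivariant: "Mf (z - 1) w * Uf (w + of_real e2) = sc (1 / q3) * (Uf w * Mf z w)"
proof -
  define X where "X = Xf (w + of_real e2)"
  define E where "E = Ef (z + of_real e1)"
  have E1: "Ef (z - 1 + of_real e1) = - E"
    using XE_shift(4)[of "z + of_real e1"] by (simp add: E_def diff_add_eq)
  have q: "q3 * q3 = exp (\<i> * of_real (2 * pi * e2))"
    by (simp add: q3_def exp_add[symmetric] algebra_simps)
  have "Xf w = X * q3^2"
    unfolding X_def XE_shift power2_eq_square q by (simp add: exp_minus)
  then have U: "Uf w = umat (X * q3^2)" "Uf (w + of_real e2) = umat X" by (simp_all add: Uf_def X_def)
  have q3: "q3 \<noteq> 0" by (simp add: q3_def)
  have "adj (kmat X E * umat (X * q3^2)) = adj (sc q3 * (umat X * kmat X (- E)))"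
    using kmat_equivariant[of X "- E"] by simp
  then have "adj (umat (X * q3^2)) * adj (kmat X E) = sc q3 * (adj (kmat X (- E)) * adj (umat X))"
    unfolding adj_mult_rev by (auto intro!: mat2_eqI dest!: arg_cong[where f=m11] simp: mat2_eqI)
  moreover have "adj (umat Y) = - umat Y" for Y by (auto intro!: mat2_eqI simp: umat_def)
  ultimately have "umat (X * q3^2) * adj (kmat X E) = sc q3 * (adj (kmat X (- E)) * umat X)"
    by simp
  then show ?thesis
    unfolding Mf_def E1 X_def[symmetric] E_def[symmetric] U by (simp add: sc_cancel(1)[OF q3])
qed

lemma Mf_periodic: "Mf z (w + 1) = Mf z w" and Pf_periodic: "Pf z (w + 1) = Pf z w"
proof -
  have "Xf (w + 1 + of_real e2) = Xf (w + of_real e2)" using XE_shift(3)[of "w + of_real e2"] by (simp add: add_ac)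
  then show "Mf z (w + 1) = Mf z w" by (simp add: Mf_def)
  show "Pf z (w + 1) = Pf z w" by (simp add: Pf_def XE_shift)
qed

lemma proj_w_periodic: "proj z (w + 1) = proj z w"
  by (rule proj_periodic[OF Mf_periodic Pf_periodic])

lemma proj_z_equivariant: "z \<in> strip (1/2000) \<Longrightarrow> w \<in> strip (1/2000) \<Longrightarrow> proj (z - 1) w * Uf w = Uf w * proj z w"
  by (rule proj_equivariant[OF Uf_nz Pf_equivariant Mf_equivariant]) (auto simp: q3_def)

end

section \<open>Eigenvector estimates on the torus\<close>

text \<open>The cubic is \<open>(1 - F/2) * (1 - F/2 + F^2/4)\<close>, and multiplying the second
  factor by \<open>1 + F/2\<close> gives \<open>1 + F^3/8\<close>. In the right half plane
  \<open>1 - F/2\<close> is no longer than \<open>1 + F/2\<close>. The triangle inequality alone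
  would give 21/8.\<close>

lemma cubic_bound:
  assumes "norm F = 1" "Re F \<ge> 0"
  shows "norm (1 - F + F^2 / 2 - F^3 / 8) \<le> 9/8"
proof -
  let ?C = "1 - F + F^2 / 2 - F^3 / 8"
  have le: "norm (1 - F / 2) \<le> norm (1 + F / 2)"
    using assms(2) by (simp add: cmod_def power2_eq_square algebra_simps)
  have nz: "norm (1 + F / 2) > 0"
  proof -
    have "Re (1 + F / 2) > 0" using assms(2) by simp
    then show ?thesis by (metis less_irrefl zero_complex.simps(1) zero_less_norm_iff)
  qed
  have "?C * (1 + F / 2) = (1 - F / 2) * (1 + F^3 / 8)"
    by (simp add: field_simps power2_eq_square power3_eq_cube)
  then have "norm ?C * norm (1 + F / 2) = norm (1 - F / 2) * norm (1 + F^3 / 8)"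
    by (metis norm_mult)
  also have "\<dots> \<le> norm (1 + F / 2) * (9/8)"
  proof (intro mult_mono le)
    show "norm (1 + F^3 / 8) \<le> 9/8"
      using norm_triangle_ineq[of 1 "F^3 / 8"] assms by (simp add: norm_divide norm_power)
  qed auto
  finally show ?thesis using nz by (simp add: mult.commute)
qed

context near_torus begin

text \<open>\<open>2 * om - 1\<close> is \<i> times \<open>sqrt 3\<close>, so the lower bound on
  \<open>Re s\<close> becomes one on an imaginary part. This is the main term of the two entry
  estimates below.\<close>

lemma Im_top: "Im (3 * (2 * om - 1) / 4 * s) \<ge> 6495/10000"
proof -
  have J: "2 * om - 1 = Complex 0 (sqrt 3)" by (simp add: om_def complex_eq_iff)
  have "Im (3 * (2 * om - 1) / 4 * s) = 3 * sqrt 3 / 4 * Re s"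
    unfolding J by (simp del: csqrt.simps)
  moreover have "3 * (17320/10000) / 4 * (1/2) \<le> 3 * sqrt 3 / 4 * Re s"
    using sqrt3_bounds(1) s_facts(2) by (intro mult_mono) (auto simp del: csqrt.simps)
  ultimately show ?thesis by simp
qed

lemma gap_norm: "norm (htr X E * s) \<le> 17/10" "htr X E * s \<noteq> 0"
proof -
  have "norm (htr X E * s) \<le> 134/100 * (124/100)"
    unfolding norm_mult using htr_bounds s_facts by (intro mult_mono) (auto simp del: csqrt.simps)
  then show "norm (htr X E * s) \<le> 17/10" by simp
  show "htr X E * s \<noteq> 0" using htr_bounds s_facts(4) by simp
qed

end

lemma complex_cis_sum_ge_1:
  fixes c m :: real
  assumes "c^2 + m^2 = 1" "0 \<le> c" "0 \<le> m" shows "c + m \<ge> 1"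
proof -
  have "(1::real)^2 \<le> (c + m)^2" using assms by (simp add: power2_sum)
  then show ?thesis by (rule power2_le_imp_le) (use assms in simp)
qed

text \<open>A vector in the window where the first entry dominates is not an eigenvector for the large
  eigenvalue: after division by \<open>- X F\<^sup>2\<close> the two sides of the eigenvector equation have imaginary
  parts separated by a fixed amount.\<close>

lemma pmat_first_entry:
  assumes unit: "norm X = 1" "norm F = 1" and F: "Re F \<ge> 0" "Im F \<le> 0" and g: "0 \<le> g2" "g2 \<le> g1"
  shows "norm (m11 (pmat X (- F)) * of_real g1 - m12 (pmat X (- F)) * (om * of_real g2)) \<ge> g1 / 100"
proof -
  have nz: "X \<noteq> 0" "F \<noteq> 0" using unit by auto
  interpret near_torus X "- F"
    by unfold_locales (use unit nz in \<open>auto simp: norm_inverse\<close>)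
  let ?g = "htr X (- F) * s"
  define C where "C = 1 - F + F^2 / 2 - F^3 / 8"
  define Z where "Z = 1 / F + X / (8 * F) - F / 4"
  define Y where "Y = om / (2 * F) + om / 4 + om * C / (X * F)"
  define Br where "Br = 3 * (2 * om - 1) / 4 * s * of_real g1 + Z * of_real g1 + Y * of_real g2"
  have key: "m11 (nmat X (- F)) * of_real g1 - m12 (nmat X (- F)) * (om * of_real g2) - ?g * of_real g1 = - X * F^2 * Br"
  proof -
    have 1: "m11 (nmat X (- F)) = - X * F^2 * Z" and 2: "m12 (nmat X (- F)) * om = X * F^2 * Y"
      unfolding C_def Z_def Y_def nmat_def Let_def mat2.sel
      using nz by (simp_all add: field_simps eval_nat_numeral)
    have 3: "htr X (- F) = X * F^2 * (3 * (2 * om - 1) / 4)" by (simp add: htr_def)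
    have "a * g - b * (om * h) - t * r * g = - X * F^2 * (k * r * g + z * g + y * h)"
      if "a = - X * F^2 * z" "b * om = X * F^2 * y" "t = X * F^2 * k" for a b t g h r k z y
      using that by algebra
    from this[OF 1 2 3] show ?thesis unfolding Br_def .
  qed
  have P: "m11 (pmat X (- F)) * of_real g1 - m12 (pmat X (- F)) * (om * of_real g2) = X * F^2 * Br / (2 * ?g)"
  proof -
    have "m11 (pmat X (- F)) * of_real g1 - m12 (pmat X (- F)) * (om * of_real g2)
      = - (m11 (nmat X (- F)) * of_real g1 - m12 (nmat X (- F)) * (om * of_real g2) - ?g * of_real g1) / (2 * ?g)"
      using gap_norm(2) by (simp add: pmat_def field_simps del: csqrt.simps)
    then show ?thesis unfolding key by simp
  qed
  define c m where "c = Re F" and "m = - Im F"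
  have cm: "c^2 + m^2 = 1" "0 \<le> c" "0 \<le> m"
    using unit F by (auto simp: c_def m_def cmod_def)
  then have cm1: "c + m \<ge> 1" by (rule complex_cis_sum_ge_1)
  have iF: "1 / F = cnj F" using unit complex_div_cnj[of 1 F] by simp
  have "Im Z \<ge> 5/4 * m - 1/8"
  proof -
    have "\<bar>Im (X / (8 * F))\<bar> \<le> 1/8"
      by (rule order_trans[OF abs_Im_le_cmod]) (use unit in \<open>simp add: norm_divide norm_mult\<close>)
    then show ?thesis unfolding Z_def iF by (simp add: m_def)
  qed
  then have Z: "Im (Z * of_real g1) \<ge> (5/4 * m - 1/8) * g1" using g by (simp add: mult_right_mono)
  have "Im Y \<ge> sqrt 3 / 4 * c + m / 4 + sqrt 3 / 8 - 9/8"
  proof -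
    have "norm (om * C / (X * F)) \<le> 9/8"
      using cubic_bound[OF unit(2) F(1)] unit by (simp add: norm_divide norm_mult om_facts(2) C_def)
    then have "\<bar>Im (om * C / (X * F))\<bar> \<le> 9/8" using abs_Im_le_cmod order_trans by blast
    moreover have "Y = om * cnj F / 2 + om / 4 + om * C / (X * F)" unfolding Y_def iF[symmetric] by simp
    moreover have "Im (om * cnj F / 2) = sqrt 3 / 4 * c + m / 4" by (simp add: om_def c_def m_def field_simps)
    moreover have "Im (om / 4) = sqrt 3 / 8" by (simp add: om_def)
    ultimately show ?thesis by (simp only: plus_complex.simps)
  qed
  moreover have "sqrt 3 / 4 * c \<ge> 433/1000 * c" using sqrt3_bounds(1) cm(2) by (intro mult_right_mono) auto
  \<comment> \<open>By \<open>c + m \<ge> 1\<close>, \<open>433/1000 * c + m / 4\<close> is at least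
    \<open>433/1000 - 183/1000 * m\<close>; adding \<open>sqrt 3 / 8 - 9/8\<close> gives the
    constant.\<close>
  ultimately have Yb: "Im Y \<ge> - (4755/10000) - 183/1000 * m" using cm1 sqrt3_bounds(1) by linarith
  have Y: "Im (Y * of_real g2) \<ge> (- (4755/10000) - 183/1000 * m) * g1"
  proof -
    have "(- (4755/10000) - 183/1000 * m) * g1 \<le> (- (4755/10000) - 183/1000 * m) * g2"
      using g cm by (intro mult_left_mono_neg) auto
    also have "\<dots> \<le> Im Y * g2" using Yb g by (intro mult_right_mono) auto
    finally show ?thesis by simp
  qed
  have "Im (3 * (2 * om - 1) / 4 * s * of_real g1) \<ge> 6495/10000 * g1"
    using mult_right_mono[OF Im_top, of g1] g by (simp del: csqrt.simps)
  then have "Im Br \<ge> 6495/10000 * g1 + (5/4 * m - 1/8) * g1 + (- (4755/10000) - 183/1000 * m) * g1"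
    unfolding Br_def using Z Y by (simp del: csqrt.simps)
  moreover have "m * g1 \<ge> 0" using cm g by simp
  \<comment> \<open>0.6495 - 0.125 - 0.4755 leaves 0.049, and the coefficient 5/4 - 183/1000 of
    \<open>m * g1\<close> is positive.\<close>
  ultimately have "Im Br \<ge> 48/1000 * g1" using g by (simp add: algebra_simps del: csqrt.simps)
  then have nb: "norm Br \<ge> 48/1000 * g1" using abs_Im_le_cmod[of Br] by linarith
  have "g1 / 100 \<le> (48/1000 * g1) / (2 * (17/10))" using g by simp
  also have "\<dots> \<le> norm Br / (2 * norm ?g)"
    using nb gap_norm g by (intro frac_le) (simp_all del: csqrt.simps add: norm_mult[symmetric])
  also have "\<dots> = norm (X * F^2 * Br / (2 * ?g))"
    using unit by (simp add: norm_divide norm_mult norm_power)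
  finally show ?thesis unfolding P .
qed

text \<open>The mirror case in the second row, divided by \<open>X * F^2 * om\<close>. Here
  \<open>Im Y\<close> is nonpositive, so the term of the smaller entry \<open>g1\<close> only
  enlarges the imaginary part, and \<open>Im_top\<close> against \<open>Im Z \<le> 1/8\<close>
  decides.\<close>

lemma pmat_second_entry:
  assumes unit: "norm X = 1" "norm F = 1" and F: "Re F \<ge> 0" "Im F \<ge> 0" and g: "0 \<le> g1" "g1 \<le> g2"
  shows "norm (m21 (pmat X (- F)) * of_real g1 - m22 (pmat X (- F)) * (om * of_real g2)) \<ge> g2 / 100"
proof -
  have nz: "X \<noteq> 0" "F \<noteq> 0" using unit by auto
  interpret near_torus X "- F"
    by unfold_locales (use unit nz in \<open>auto simp: norm_inverse\<close>)
  let ?g = "htr X (- F) * s"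
  define Z where "Z = 1 / F + X / (8 * F) - F / 4"
  define W where "W = 1 / F + 1 + F / 2 + F^2 / 8"
  define Y where "Y = (1 / om) * W + (1 / om) * (X / (2 * F) - X / 4)"
  define Br where "Br = 3 * (2 * om - 1) / 4 * s * of_real g2 - Z * of_real g2 - Y * of_real g1"
  have key: "m21 (nmat X (- F)) * of_real g1 - m22 (nmat X (- F)) * (om * of_real g2) + ?g * (om * of_real g2) = X * F^2 * om * Br"
  proof -
    have 1: "m22 (nmat X (- F)) = X * F^2 * Z" and 2: "m21 (nmat X (- F)) = - X * F^2 * (om * Y)"
      unfolding Z_def Y_def W_def nmat_def Let_def mat2.sel
      using nz om_facts(3) by (simp_all add: field_simps eval_nat_numeral)
    have 3: "htr X (- F) = X * F^2 * (3 * (2 * om - 1) / 4)" by (simp add: htr_def)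
    have "b * g - a * (om * h) + t * r * (om * h) = X * F^2 * om * (k * r * h - z * h - y * g)"
      if "a = X * F^2 * z" "b = - X * F^2 * (om * y)" "t = X * F^2 * k" for a b t g h r k z y
      using that by algebra
    from this[OF 1 2 3] show ?thesis unfolding Br_def .
  qed
  have P: "m21 (pmat X (- F)) * of_real g1 - m22 (pmat X (- F)) * (om * of_real g2) = - (X * F^2 * om * Br / (2 * ?g))"
  proof -
    have "m21 (pmat X (- F)) * of_real g1 - m22 (pmat X (- F)) * (om * of_real g2)
      = - (m21 (nmat X (- F)) * of_real g1 - m22 (nmat X (- F)) * (om * of_real g2) + ?g * (om * of_real g2)) / (2 * ?g)"
      using gap_norm(2) by (simp add: pmat_def field_simps del: csqrt.simps)
    then show ?thesis unfolding key by simp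
  qed
  define c n where "c = Re F" and "n = Im F"
  have cm: "c^2 + n^2 = 1" "0 \<le> c" "0 \<le> n"
    using unit F by (auto simp: c_def n_def cmod_def)
  then have cm1: "c + n \<ge> 1" by (rule complex_cis_sum_ge_1)
  have iF: "1 / F = cnj F" using unit complex_div_cnj[of 1 F] by simp
  have io: "1 / om = cnj om" using om_facts by simp
  have "Im Z \<le> 1/8"
  proof -
    have "\<bar>Im (X / (8 * F))\<bar> \<le> 1/8"
      by (rule order_trans[OF abs_Im_le_cmod]) (use unit in \<open>simp add: norm_divide norm_mult\<close>)
    then show ?thesis unfolding Z_def iF using cm by (simp add: n_def)
  qed
  then have Z: "Im (Z * of_real g2) \<le> 1/8 * g2" using mult_right_mono[of "Im Z" "1/8" g2] g by simp
  have "Im Y \<le> 0"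
  proof -
    have "norm ((1 / om) * (X / (2 * F) - X / 4)) \<le> 3/4"
    proof -
      have "norm (X / (2 * F) - X / 4) \<le> 1/2 + 1/4"
        by (rule order_trans[OF norm_triangle_ineq4]) (use unit in \<open>simp add: norm_divide norm_mult\<close>)
      moreover have "norm (1 / om) = 1" unfolding io using om_facts(2) by simp
      ultimately show ?thesis unfolding norm_mult by simp
    qed
    then have 1: "\<bar>Im ((1 / om) * (X / (2 * F) - X / 4))\<bar> \<le> 3/4" using abs_Im_le_cmod order_trans by blast
    have "norm ((1 / om) * (F^2 / 8)) \<le> 1/8"
      unfolding io using unit om_facts(2) by (simp add: norm_mult norm_divide norm_power)
    then have 2: "\<bar>Im ((1 / om) * (F^2 / 8))\<bar> \<le> 1/8" using abs_Im_le_cmod order_trans by blast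
    have 3: "Im ((1 / om) * (1 / F + 1 + F / 2)) = - (n / 4) - 3 * sqrt 3 / 4 * c - sqrt 3 / 2"
      unfolding io iF by (simp add: om_def c_def n_def field_simps)
    have "(1 / om) * W = (1 / om) * (1 / F + 1 + F / 2) + (1 / om) * (F^2 / 8)"
      unfolding W_def by (simp only: distrib_left)
    then have "Im Y \<le> - (n / 4) - 3 * sqrt 3 / 4 * c - sqrt 3 / 2 + 1/8 + 3/4"
      unfolding Y_def using 1 2 3 by simp
    moreover have "3 * sqrt 3 / 4 * c \<ge> 1 / 4 * c" using sqrt3_bounds(1) cm(2) by (intro mult_right_mono) auto
    ultimately show ?thesis using cm1 sqrt3_bounds(1) by linarith
  qed
  then have Y: "Im (Y * of_real g1) \<le> 0" using g by (simp add: mult_nonpos_nonneg)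
  have "Im (3 * (2 * om - 1) / 4 * s * of_real g2) \<ge> 6495/10000 * g2"
    using mult_right_mono[OF Im_top, of g2] g by (simp del: csqrt.simps)
  then have "Im Br \<ge> 6495/10000 * g2 - 1/8 * g2"
    unfolding Br_def minus_complex.simps using Z Y by linarith
  then have nb: "norm Br \<ge> 48/1000 * g2" using abs_Im_le_cmod[of Br] g by simp
  have "g2 / 100 \<le> (48/1000 * g2) / (2 * (17/10))" using g by simp
  also have "\<dots> \<le> norm Br / (2 * norm ?g)"
    using nb gap_norm g by (intro frac_le) (simp_all del: csqrt.simps add: norm_mult[symmetric])
  also have "\<dots> = norm (- (X * F^2 * om * Br / (2 * ?g)))"
    using unit om_facts(2) by (simp add: norm_divide norm_mult norm_power)
  finally show ?thesis unfolding P .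
qed

text \<open>The small eigenvalue is \<open>htr * (1 - disc) / (1 + s)\<close>. The monomial
  \<open>X * E^2\<close> of \<open>htr\<close> cancels the leading term of \<open>1 - disc\<close>,
  which leaves a constant plus a small \<open>\<zeta>\<close>: this eigenvalue does not wind around
  zero. The factor \<i> is the approximate value of the phase \<open>kap\<close> on the
  window.\<close>

lemma small_eigenvalue_Re:
  assumes unit: "norm X = 1" "norm E = 1"
  shows "Re (\<i> * (htr X E * (1 - csqrt (disc X E)))) \<ge> 1/10"
proof -
  have nz: "X \<noteq> 0" "E \<noteq> 0" using unit by auto
  interpret near_torus X E
    by unfold_locales (use unit nz in \<open>auto simp: norm_inverse\<close>)
  define \<zeta> where "\<zeta> = (X^3 + E^6) / 64 + 3/16 * (X * E^2)"
  define W where "W = of_real (4 * sqrt 3 / 9) * (1 - \<zeta>)"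
  have J: "\<i> * (2 * om - 1) = - of_real (sqrt 3)" by (simp add: om_def complex_eq_iff)
  have "\<i> * htr X E * (1 - disc X E) = 3 / 4 * (\<i> * (2 * om - 1)) * (X * E^2) * (1 - disc X E)"
    by (simp add: htr_def)
  also have "\<dots> = W"
    unfolding J W_def \<zeta>_def disc_def using nz by (simp add: field_simps)
  finally have W: "\<i> * htr X E * (1 - disc X E) = W" .
  have z: "norm \<zeta> \<le> 22/100"
  proof -
    have "norm ((X^3 + E^6) / 64) \<le> 2/64"
      using norm_triangle_ineq[of "X^3" "E^6"] unit by (simp add: norm_divide norm_power)
    moreover have "norm (3/16 * (X * E^2)) = 3/16" using unit by (simp add: norm_mult norm_power)
    ultimately show ?thesis unfolding \<zeta>_def using norm_triangle_ineq[of "(X^3 + E^6) / 64" "3/16 * (X * E^2)"] by simp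
  qed
  have ReW: "Re W \<ge> 6/10"
  proof -
    have "4 * (17320/10000) / 9 * (78/100) \<le> 4 * sqrt 3 / 9 * Re (1 - \<zeta>)"
      using sqrt3_bounds(1) z abs_Re_le_cmod[of \<zeta>] by (intro mult_mono) auto
    then show ?thesis by (simp add: W_def)
  qed
  have ImW: "\<bar>Im W\<bar> \<le> 2/10"
  proof -
    have "\<bar>Im W\<bar> = 4 * sqrt 3 / 9 * \<bar>Im \<zeta>\<bar>" by (simp add: W_def abs_mult)
    also have "\<dots> \<le> 4 * (17321/10000) / 9 * (22/100)"
      using sqrt3_bounds z abs_Im_le_cmod[of \<zeta>] by (intro mult_mono) auto
    finally show ?thesis by simp
  qed
  have s1: "1 + s \<noteq> 0"
  proof
    assume "1 + s = 0"
    then have "Re (1 + s) = 0" by (simp only: zero_complex.simps)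
    then show False using s_facts(2) by (simp del: csqrt.simps)
  qed
  have "(1 - s) * (1 + s) = 1 - disc X E"
    using s_facts(1) by (simp add: algebra_simps power2_eq_square)
  then have "\<i> * (htr X E * (1 - s)) * (1 + s) = W"
    using W by (metis mult.assoc)
  then have eq: "\<i> * (htr X E * (1 - s)) = W / (1 + s)"
    by (simp only: nonzero_eq_divide_eq[OF s1])
  have ns: "(norm (1 + s))^2 \<le> (224/100)^2"
    using norm_triangle_ineq[of 1 s] s_facts(3) by (intro power_mono) (auto simp del: csqrt.simps)
  have Ims: "\<bar>Im s\<bar> \<le> 124/100" using abs_Im_le_cmod[of s] s_facts(3) by linarith
  have "Re W * (1 + Re s) \<ge> 6/10 * (3/2)" using ReW s_facts(2) by (intro mult_mono) (auto simp del: csqrt.simps)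
  moreover have "\<bar>Im W * Im s\<bar> \<le> 2/10 * (124/100)" unfolding abs_mult using ImW Ims by (intro mult_mono) auto
  ultimately have num: "Re W * (1 + Re s) + Im W * Im s \<ge> 6/10" by (simp add: abs_le_iff del: csqrt.simps)
  have "1/10 \<le> (6/10) / (224/100 :: real)^2" by (simp add: power2_eq_square)
  also have "\<dots> \<le> (Re W * (1 + Re s) + Im W * Im s) / (norm (1 + s))^2"
    using num ns s1 by (intro frac_le) (auto simp del: csqrt.simps)
  also have "\<dots> = Re (W / (1 + s))"
    by (simp add: Re_divide cmod_power2 del: csqrt.simps)
  finally show ?thesis unfolding eq .
qed

section \<open>Diophantine approximation\<close>

text \<open>Infinite descent: a prime dividing \<open>d\<close> exactly once must divide both
  \<open>x\<close> and \<open>y\<close>, and then cancels.\<close>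

lemma square_eq_mult_square_zero:
  fixes x y d :: int and p :: int
  assumes "prime p" "d = p * d'" "\<not> p dvd d'" "x^2 = d * y^2"
  shows "y = 0"
  using assms(4)
proof (induction "nat \<bar>y\<bar>" arbitrary: x y rule: less_induct)
  case less
  show ?case
  proof (rule ccontr)
    assume y: "y \<noteq> 0"
    have "p dvd x^2" using less.prems assms(2) by simp
    then have "p dvd x" using assms(1) prime_dvd_power by blast
    then obtain x' where x': "x = p * x'" by blast
    have p0: "p \<noteq> 0" using assms(1) by auto
    have "p * (p * x'^2) = p * (d' * y^2)" using less.prems unfolding x' assms(2) by (simp add: power2_eq_square mult_ac)
    then have eq: "p * x'^2 = d' * y^2" using p0 by simp
    then have "p dvd d' * y^2" by (metis dvd_triv_left)
    then have "p dvd y^2" using assms(1,3) prime_dvd_multD by blast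
    then have "p dvd y" using assms(1) prime_dvd_power by blast
    then obtain y' where y': "y = p * y'" by blast
    have "p * x'^2 = p * (d * y'^2)" using eq unfolding y' assms(2) by (simp add: power2_eq_square mult_ac)
    then have "x'^2 = d * y'^2" using p0 by simp
    moreover have "nat \<bar>y'\<bar> < nat \<bar>y\<bar>"
    proof -
      have "y' \<noteq> 0" "\<bar>p\<bar> \<ge> 2" using y y' prime_ge_2_int[OF assms(1)] by auto
      then have "\<bar>y'\<bar> < \<bar>p\<bar> * \<bar>y'\<bar>"
        using mult_right_mono[of 2 "\<bar>p\<bar>" "\<bar>y'\<bar>"] by linarith
      then show ?thesis by (simp add: y' abs_mult)
    qed
    ultimately have "y' = 0" using less.hyps by blast
    then show False using y y' by simp
  qed
qed

text \<open>The expression is the norm over the rationals of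
  \<open>a * sqrt 2 + b * sqrt 3 - N\<close>. If it vanished, 24 would be a rational square unless
  \<open>a * b = 0\<close>, and in that case 2 or 3 would be one.\<close>

lemma quartic_norm_nonzero:
  fixes a b N :: int
  assumes "a \<noteq> 0 \<or> b \<noteq> 0"
  shows "(N^2 - 2 * a^2 - 3 * b^2)^2 - 24 * a^2 * b^2 \<noteq> 0"
proof
  assume "(N^2 - 2 * a^2 - 3 * b^2)^2 - 24 * a^2 * b^2 = 0"
  then have eq: "(N^2 - 2 * a^2 - 3 * b^2)^2 = 24 * (a * b)^2" by (simp add: power_mult_distrib)
  then have ab: "a * b = 0" by (rule square_eq_mult_square_zero[of 3 24 8, rotated 3]) auto
  with eq have S: "N^2 = 2 * a^2 + 3 * b^2" by auto
  from ab show False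
  proof (cases "a = 0")
    case True
    then have "N^2 = 3 * b^2" using S by simp
    then have "b = 0" by (rule square_eq_mult_square_zero[of 3 3 1, rotated 3]) auto
    with True assms show False by simp
  next
    case False
    with ab S have "N^2 = 2 * a^2" by simp
    then have "a = 0" by (rule square_eq_mult_square_zero[of 2 2 1, rotated 3]) auto
    with False show False by simp
  qed
qed

text \<open>Liouville's argument: the product of the four conjugates is a nonzero integer, and if
  the first is below 1 then the other three are at most \<open>B\<close>.\<close>

lemma sqrt2_sqrt3_linear_form:
  fixes a b N :: int
  assumes "a \<noteq> 0 \<or> b \<noteq> 0"
  shows "\<bar>of_int a * sqrt 2 + of_int b * sqrt 3 - of_int N\<bar> \<ge> 1 / (4 * (1 + \<bar>of_int a\<bar> + \<bar>of_int b\<bar>)) ^ 3"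
proof -
  define x where "x = of_int a * sqrt 2 + of_int b * sqrt 3 - of_int N"
  define x2 where "x2 = of_int a * sqrt 2 - of_int b * sqrt 3 - of_int N"
  define x3 where "x3 = - (of_int a * sqrt 2) + of_int b * sqrt 3 - of_int N"
  define x4 where "x4 = - (of_int a * sqrt 2) - of_int b * sqrt 3 - of_int N"
  define B where "B = 4 * (1 + \<bar>of_int a :: real\<bar> + \<bar>of_int b\<bar>)"
  have B4: "B \<ge> 4" by (simp add: B_def)
  have s: "sqrt 2 \<le> 2" "sqrt 3 \<le> 2" by (auto intro: real_le_lsqrt)
  have as: "\<bar>of_int a * sqrt 2\<bar> \<le> \<bar>of_int a\<bar> * 2" "\<bar>of_int b * sqrt 3\<bar> \<le> \<bar>of_int b\<bar> * 2"
    unfolding abs_mult using s by (auto intro!: mult_left_mono)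
  show ?thesis
  proof (cases "\<bar>x\<bar> \<ge> 1")
    case True
    have "1 / B ^ 3 \<le> 1" using B4 one_le_power[of B 3] by simp
    with True show ?thesis unfolding x_def B_def by linarith
  next
    case False
    then have N: "\<bar>of_int N\<bar> \<le> \<bar>of_int a\<bar> * 2 + \<bar>of_int b\<bar> * 2 + (1::real)" using as unfolding x_def by linarith
    have sum: "\<bar>of_int a * sqrt 2\<bar> + \<bar>of_int b * sqrt 3\<bar> + \<bar>of_int N\<bar> \<le> B"
      using add_mono[OF add_mono[OF as] N] by (simp add: B_def)
    have tri: "\<bar>u - v - n\<bar> \<le> \<bar>u\<bar> + \<bar>v\<bar> + \<bar>n\<bar>" "\<bar>- u + v - n\<bar> \<le> \<bar>u\<bar> + \<bar>v\<bar> + \<bar>n\<bar>"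
      "\<bar>- u - v - n\<bar> \<le> \<bar>u\<bar> + \<bar>v\<bar> + \<bar>n\<bar>" for u v n :: real by simp_all
    have xs: "\<bar>x2\<bar> \<le> B" "\<bar>x3\<bar> \<le> B" "\<bar>x4\<bar> \<le> B"
      unfolding x2_def x3_def x4_def by (rule order_trans[OF tri(1) sum], rule order_trans[OF tri(2) sum], rule order_trans[OF tri(3) sum])
    have sq: "sqrt 2 * sqrt 2 = 2" "sqrt 3 * sqrt 3 = 3" by simp_all
    have "x * x4 * (x2 * x3) = of_int ((N^2 - 2 * a^2 - 3 * b^2)^2 - 24 * a^2 * b^2)"
    proof -
      have id: "(P + Q - M) * (- P - Q - M) * ((P - Q - M) * (- P + Q - M)) = (M^2 - P^2 - Q^2)^2 - 4 * P^2 * Q^2"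
        for P Q M :: real by (simp add: algebra_simps power2_eq_square)
      have "(A * p + C * q - M) * (- (A * p) - C * q - M) * ((A * p - C * q - M) * (- (A * p) + C * q - M))
        = (M^2 - 2 * A^2 - 3 * C^2)^2 - 24 * A^2 * C^2" if "p * p = 2" "q * q = 3" for A C M p q :: real
      proof -
        have "p^2 = 2" "q^2 = 3" using that by (simp_all add: power2_eq_square)
        then have "(A * p)^2 = 2 * A^2" "(C * q)^2 = 3 * C^2" by (simp_all add: power_mult_distrib)
        then show ?thesis unfolding id by simp
      qed
      from this[OF sq, of "of_int a" "of_int b" "of_int N"] show ?thesis
        by (simp add: x_def x2_def x3_def x4_def)
    qed
    moreover have "(1::real) \<le> \<bar>of_int n\<bar>" if "n \<noteq> 0" for n :: int
      using that by (metis of_int_abs of_int_1_le_iff zero_less_abs_iff int_one_le_iff_zero_less)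
    ultimately have "\<bar>x * x4 * (x2 * x3)\<bar> \<ge> 1"
      using quartic_norm_nonzero[OF assms, of N] by metis
    then have "1 \<le> \<bar>x\<bar> * (\<bar>x4\<bar> * (\<bar>x2\<bar> * \<bar>x3\<bar>))" by (simp add: abs_mult mult.assoc)
    also have "\<dots> \<le> \<bar>x\<bar> * (B * (B * B))" using xs B4 by (intro mult_left_mono mult_mono) auto
    finally have "1 \<le> \<bar>x\<bar> * B ^ 3" by (simp add: power3_eq_cube mult.assoc)
    then show ?thesis using B4 unfolding x_def[symmetric] B_def[symmetric] by (simp add: field_simps)
  qed
qed

text \<open>The exponent 3 is the number of remaining conjugates in
  \<open>sqrt2_sqrt3_linear_form\<close>.\<close>

definition diophantine :: "real \<Rightarrow> real \<Rightarrow> bool" where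
  "diophantine a b \<longleftrightarrow> (\<exists>c>0. \<forall>k l j :: int. (k \<noteq> 0 \<or> l \<noteq> 0) \<longrightarrow>
     \<bar>of_int k * a + of_int l * b - of_int j\<bar> \<ge> c / (1 + \<bar>of_int k\<bar> + \<bar>of_int l\<bar>) ^ 3)"

lemma diophantine_sqrt2_sqrt3: "diophantine (3 / 10^12 * sqrt 2) (3 / 10^12 * sqrt 3)"
  unfolding diophantine_def
proof (intro exI conjI allI impI)
  \<comment> \<open>Multiplying the form by \<open>10^12\<close> makes its coefficients the integers
    \<open>3 * k\<close>, \<open>3 * l\<close> and \<open>10^12 * j\<close>; the 12 is 4 times this
    3.\<close>
  show "(0::real) < 1 / (10^12 * 12^3)" by simp
  fix k l j :: int assume kl: "k \<noteq> 0 \<or> l \<noteq> 0"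
  let ?w = "1 + \<bar>of_int k :: real\<bar> + \<bar>of_int l\<bar>"
  have "1 / (12 * ?w) ^ 3 \<le> 1 / (4 * (1 + \<bar>of_int (3 * k)\<bar> + \<bar>of_int (3 * l)\<bar>)) ^ 3"
    by (intro divide_left_mono power_mono) (auto simp: abs_mult)
  also have "\<dots> \<le> \<bar>of_int (3 * k) * sqrt 2 + of_int (3 * l) * sqrt 3 - of_int (10^12 * j)\<bar>"
    by (rule sqrt2_sqrt3_linear_form) (use kl in auto)
  also have "\<dots> = 10^12 * \<bar>of_int k * (3 / 10^12 * sqrt 2) + of_int l * (3 / 10^12 * sqrt 3) - of_int j\<bar>"
  proof -
    have "of_int (3 * k) * sqrt 2 + of_int (3 * l) * sqrt 3 - of_int (10^12 * j)
      = 10^12 * (of_int k * (3 / 10^12 * sqrt 2) + of_int l * (3 / 10^12 * sqrt 3) - of_int j)"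
      by (simp add: field_simps)
    then show ?thesis by (simp only: abs_mult) simp
  qed
  finally have "1 / (12^3 * ?w ^ 3) \<le> 10^12 * \<bar>of_int k * (3 / 10^12 * sqrt 2) + of_int l * (3 / 10^12 * sqrt 3) - of_int j\<bar>"
    unfolding power_mult_distrib .
  moreover have "1 / (10^12 * 12^3) / W \<le> D" if "1 / (12^3 * W) \<le> 10^12 * D" for W D :: real
    using that by simp
  ultimately show "1 / (10^12 * 12^3) / ?w ^ 3 \<le> \<bar>of_int k * (3 / 10^12 * sqrt 2) + of_int l * (3 / 10^12 * sqrt 3) - of_int j\<bar>"
    by blast
qed

section \<open>Fourier series in one variable\<close>

definition chr :: "int \<Rightarrow> real \<Rightarrow> complex" where
  "chr n t = exp (2 * of_real pi * \<i> * of_int n * of_real t)"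

lemma chr_simps [simp]: "chr 0 t = 1" "chr n 0 = 1" "norm (chr n t) = 1" "chr n t \<noteq> 0"
  by (simp_all add: chr_def)

lemma chr_add: "chr (m + n) t = chr m t * chr n t" "chr n (s + t) = chr n s * chr n t"
  by (simp_all add: chr_def exp_add[symmetric] algebra_simps)

lemma chr_one [simp]: "chr n 1 = 1"
  using exp_integer_2pi[of "of_int n"] by (simp add: chr_def mult_ac)

lemma chr_periodic: "chr n (t + 1) = chr n t"
  by (simp add: chr_add)

lemma chr_deriv: "(chr n has_vector_derivative 2 * of_real pi * \<i> * of_int n * chr n t) (at t within S)"
proof -
  have "((\<lambda>z. exp (2 * of_real pi * \<i> * of_int n * z)) has_field_derivative
     2 * of_real pi * \<i> * of_int n * exp (2 * of_real pi * \<i> * of_int n * of_real t)) (at (of_real t))"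
    by (auto intro!: derivative_eq_intros)
  from has_vector_derivative_real_field[OF this] have "(chr n has_vector_derivative 2 * of_real pi * \<i> * of_int n * chr n t) (at t)"
    by (simp add: chr_def[abs_def])
  then show ?thesis by (rule has_vector_derivative_at_within)
qed

lemma continuous_on_chr [continuous_intros]: "continuous_on S (chr n)"
  unfolding chr_def[abs_def] by (intro continuous_intros)

lemma continuous_on_chr' [continuous_intros]: "continuous_on S f \<Longrightarrow> continuous_on S (\<lambda>x. chr n (f x))"
  unfolding chr_def by (intro continuous_intros)

lemma integral_chr: "integral {0..1} (chr n) = (if n = 0 then 1 else 0)"
proof (cases "n = 0")
  case True
  then have "chr n = (\<lambda>t. 1)" by (auto simp: chr_def)
  then show ?thesis using True by simp
next
  case False
  let ?c = "2 * of_real pi * \<i> * of_int n :: complex"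
  have "((\<lambda>t. ?c * chr n t) has_integral (chr n 1 - chr n 0)) {0..1}"
    by (rule fundamental_theorem_of_calculus) (auto intro: chr_deriv)
  then have "integral {0..1} (\<lambda>t. ?c * chr n t) = 0" by (auto dest: integral_unique)
  then show ?thesis using False by simp
qed

lemma periodic_int:
  assumes "\<And>t::real. f (t + 1) = f t" shows "f (t + of_int n) = f t"
proof -
  have p: "f (t + of_nat m) = f t" for m t
  proof (induction m)
    case (Suc m)
    then show ?case using assms[of "t + of_nat m"] by (simp add: add_ac)
  qed simp
  show ?thesis
  proof (cases "n \<ge> 0")
    case True
    then show ?thesis using p[of t "nat n"] by simp
  next
    case False
    then show ?thesis using p[of "t + of_int n" "nat (- n)"] by simp
  qed
qed

section \<open>Uniqueness of Fourier coefficients in one variable\<close>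

definition orth :: "(real \<Rightarrow> complex) \<Rightarrow> bool" where
  "orth \<psi> \<longleftrightarrow> continuous_on UNIV \<psi> \<and> (\<forall>n. integral {0..1} (\<lambda>t. \<psi> t * chr n t) = 0)"

text \<open>Multipliers preserving orthogonality to all characters. They form an algebra that
  contains the characters, hence all polynomials in the real and imaginary part of
  \<open>chr 1\<close>.\<close>

definition orth_mult :: "(real \<Rightarrow> complex) \<Rightarrow> bool" where
  "orth_mult \<phi> \<longleftrightarrow> (\<forall>\<psi>. orth \<psi> \<longrightarrow> orth (\<lambda>t. \<phi> t * \<psi> t))"

lemma orth_mult_const: "orth_mult (\<lambda>t. c)"
  by (auto simp: orth_mult_def orth_def mult.assoc intro!: continuous_intros)

lemma orth_mult_mult: "orth_mult f \<Longrightarrow> orth_mult g \<Longrightarrow> orth_mult (\<lambda>t. f t * g t)"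
  by (auto simp: orth_mult_def mult.assoc)

lemma orth_mult_chr: "orth_mult (chr m)"
  unfolding orth_mult_def
proof (intro allI impI)
  fix \<psi> assume o: "orth \<psi>"
  have "(\<lambda>t. chr m t * \<psi> t * chr n t) = (\<lambda>t. \<psi> t * chr (m + n) t)" for n
    by (auto simp: chr_add)
  then show "orth (\<lambda>t. chr m t * \<psi> t)" using o by (auto simp: orth_def intro!: continuous_intros)
qed

lemma orth_mult_add:
  assumes "orth_mult f" "orth_mult g" shows "orth_mult (\<lambda>t. f t + g t)"
  unfolding orth_mult_def
proof (intro allI impI)
  fix \<psi> assume "orth \<psi>"
  then have o: "orth (\<lambda>t. f t * \<psi> t)" "orth (\<lambda>t. g t * \<psi> t)" using assms by (auto simp: orth_mult_def)
  then have c: "continuous_on {0..1} (\<lambda>t. f t * \<psi> t)" "continuous_on {0..1} (\<lambda>t. g t * \<psi> t)"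
    by (auto simp: orth_def intro: continuous_on_subset)
  have "integral {0..1} (\<lambda>t. (f t + g t) * \<psi> t * chr n t) =
    integral {0..1} (\<lambda>t. f t * \<psi> t * chr n t) + integral {0..1} (\<lambda>t. g t * \<psi> t * chr n t)" for n
    unfolding distrib_right
    by (intro integral_add integrable_continuous_interval c continuous_on_mult continuous_on_chr)
  then show "orth (\<lambda>t. (f t + g t) * \<psi> t)"
    using o continuous_on_add[of UNIV "\<lambda>t. f t * \<psi> t" "\<lambda>t. g t * \<psi> t"] by (simp add: orth_def distrib_right)
qed

lemma orth_mult_polynomial: "real_polynomial_function g \<Longrightarrow> orth_mult (\<lambda>t. of_real (g (chr 1 t)))"
proof (induction g rule: real_polynomial_function.induct)
  case (linear g)
  have inv: "chr (- 1) t = cnj (chr 1 t)" for t by (simp add: chr_def exp_cnj)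
  have gz: "g z = Re z * g 1 + Im z * g \<i>" for z
  proof -
    have "z = Re z *\<^sub>R 1 + Im z *\<^sub>R \<i>" by (simp add: complex_eq_iff)
    then have "g z = g (Re z *\<^sub>R 1 + Im z *\<^sub>R \<i>)" by simp
    also have "\<dots> = Re z * g 1 + Im z * g \<i>"
      using linear by (simp add: bounded_linear.linear linear_add linear_scale)
    finally show ?thesis .
  qed
  have "of_real (g (chr 1 t)) = (of_real (g 1) / 2 + of_real (g \<i>) / (2 * \<i>)) * chr 1 t
      + (of_real (g 1) / 2 - of_real (g \<i>) / (2 * \<i>)) * chr (- 1) t" for t
  proof -
    let ?z = "chr 1 t"
    have "(of_real (g 1) / 2 + of_real (g \<i>) / (2 * \<i>)) * ?z + (of_real (g 1) / 2 - of_real (g \<i>) / (2 * \<i>)) * cnj ?z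
      = of_real (g 1) * ((?z + cnj ?z) / 2) + of_real (g \<i>) * ((?z - cnj ?z) / (2 * \<i>))"
      by (simp add: algebra_simps add_divide_distrib diff_divide_distrib)
    also have "(?z + cnj ?z) / 2 = of_real (Re ?z)" by (simp add: complex_add_cnj)
    also have "?z - cnj ?z = (2 * \<i>) * of_real (Im ?z)" by (simp add: complex_eq_iff)
    also have "\<dots> / (2 * \<i>) = of_real (Im ?z)" by (rule nonzero_mult_div_cancel_left) simp
    finally show ?thesis unfolding inv gz[of ?z] by (simp add: mult.commute)
  qed
  then show ?case by (auto intro!: orth_mult_add orth_mult_mult orth_mult_const orth_mult_chr)
next
  case (const c) show ?case by (rule orth_mult_const)
next
  case (add f g) then show ?case by (auto intro!: orth_mult_add)
next
  case (mult f g) then show ?case by (auto intro!: orth_mult_mult)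
qed

text \<open>Stone-Weierstrass on the unit circle approximates the conjugate of \<open>f\<close> by
  polynomials in the coordinates of \<open>chr 1\<close>. Their product with \<open>f\<close> has
  integral zero, hence so does the square of \<open>norm (f t)\<close>.\<close>

lemma fourier_uniqueness:
  assumes o: "orth f" and per: "\<And>t. f (t + 1) = f t"
  shows "f t = 0"
proof -
  have cf: "continuous_on S f" for S using o by (auto simp: orth_def intro: continuous_on_subset)
  define F where "F z = f (Arg z / (2 * pi))" for z
  have same: "f (x / (2 * pi)) = f (y / (2 * pi))" if e: "exp (\<i> * of_real x) = exp (\<i> * of_real y)" for x y
  proof -
    obtain n :: int where n: "\<i> * of_real x = \<i> * of_real y + of_real (of_int (2 * n) * pi) * \<i>"
      using e[unfolded exp_eq] by blast
    have "Im (\<i> * of_real x) = Im (\<i> * of_real y + of_real (of_int (2 * n) * pi) * \<i>)" unfolding n ..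
    then have "x = y + 2 * of_int n * pi" by simp
    then have "x / (2 * pi) = y / (2 * pi) + of_int n" by (simp add: field_simps)
    then show ?thesis using periodic_int[of f, OF per] by simp
  qed
  \<comment> \<open>Two branches of the argument with different cuts define the same
    \<open>F\<close>; each proves continuity away from its own cut.\<close>
  have F2: "F = (\<lambda>z. f (Arg2pi z / (2 * pi)))"
  proof
    fix z show "F z = f (Arg2pi z / (2 * pi))"
    proof (cases "z = 0")
      case False
      have "of_real (norm z) * exp (\<i> * of_real (Arg z)) = of_real (norm z) * exp (\<i> * of_real (Arg2pi z))"
        using Arg_eq[OF False] Arg2pi_eq[of z] by simp
      then show ?thesis unfolding F_def using False by (intro same) simp
    qed (simp add: F_def Arg_zero)
  qed
  have Fchr: "F (chr 1 t) = f t" for t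
  proof -
    have "chr 1 t = exp (\<i> * of_real (2 * pi * t))" by (simp add: chr_def mult_ac)
    moreover have "chr 1 t = exp (\<i> * of_real (Arg (chr 1 t)))" using Arg_eq[of "chr 1 t"] by simp
    ultimately have "F (chr 1 t) = f (2 * pi * t / (2 * pi))" unfolding F_def by (intro same) simp
    then show ?thesis by simp
  qed
  have fc: "isCont f x" for x using cf[of UNIV] by (simp add: continuous_on_eq_continuous_at)
  have "isCont F z" if "z \<noteq> 0" for z
  proof (cases "z \<in> \<real>\<^sub>\<le>\<^sub>0")
    case False
    then have "isCont (\<lambda>z. Arg z / (2 * pi)) z" by (intro continuous_intros continuous_at_Arg) auto
    then show ?thesis unfolding F_def by (rule isCont_o2[OF _ fc])
  next
    case True
    then have "z \<notin> \<real>\<^sub>\<ge>\<^sub>0" using that by (auto simp: complex_nonpos_Reals_iff complex_nonneg_Reals_iff complex_eq_iff)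
    then have "isCont (\<lambda>z. Arg2pi z / (2 * pi)) z" by (intro continuous_intros continuous_at_Arg2pi) auto
    then show ?thesis unfolding F2 by (rule isCont_o2[OF _ fc])
  qed
  then have "\<forall>z\<in>sphere 0 1. isCont F z" by (metis mem_sphere_0 norm_zero zero_neq_one)
  then have cF: "continuous_on (sphere 0 1) (\<lambda>z. cnj (F z))"
    by (intro continuous_on_cnj continuous_at_imp_continuous_on)
  have "bounded (f ` {0..1})" by (intro compact_imp_bounded compact_continuous_image cf) auto
  then obtain B where "B > 0" "\<forall>x\<in>f ` {0..1}. norm x \<le> B" unfolding bounded_pos by blast
  then have B: "\<And>t. t \<in> {0..1} \<Longrightarrow> norm (f t) \<le> B" "B > 0" by auto
  have small: "norm (integral {0..1} (\<lambda>t. f t * cnj (f t))) \<le> B * e" if ep: "e > 0" for e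
  proof -
    obtain g where g: "polynomial_function g" "\<And>z. z \<in> sphere 0 1 \<Longrightarrow> norm (cnj (F z) - g z) < e"
      using Stone_Weierstrass_polynomial_function[OF _ cF ep] by auto
    have "real_polynomial_function (Re \<circ> g)" "real_polynomial_function (Im \<circ> g)"
      using g(1) bounded_linear_Re bounded_linear_Im by (auto simp: polynomial_function_def)
    then have om: "orth_mult (\<lambda>t. of_real ((Re \<circ> g) (chr 1 t)) + \<i> * of_real ((Im \<circ> g) (chr 1 t)))"
      by (intro orth_mult_add orth_mult_mult orth_mult_const orth_mult_polynomial)
    have eqf: "(\<lambda>t. of_real ((Re \<circ> g) (chr 1 t)) + \<i> * of_real ((Im \<circ> g) (chr 1 t))) = (\<lambda>t. g (chr 1 t))"
      by (auto simp: complex_eq_iff)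
    have "orth_mult (\<lambda>t. g (chr 1 t))" using om unfolding eqf .
    then have og: "orth (\<lambda>t. g (chr 1 t) * f t)" using o unfolding orth_mult_def by blast
    then have "integral {0..1} (\<lambda>t. g (chr 1 t) * f t * chr 0 t) = 0" unfolding orth_def by blast
    then have z: "integral {0..1} (\<lambda>t. g (chr 1 t) * f t) = 0" by simp
    have cg: "continuous_on {0..1} (\<lambda>t. g (chr 1 t) * f t)" using og by (auto simp: orth_def intro: continuous_on_subset)
    have c2: "continuous_on {0..1} (\<lambda>t. f t * cnj (f t))" by (intro continuous_intros cf)
    have eq: "integral {0..1} (\<lambda>t. f t * cnj (f t)) = integral {0..1} (\<lambda>t. f t * cnj (f t) - g (chr 1 t) * f t)"
      by (subst integral_diff) (auto intro: integrable_continuous_interval cg c2 simp: z)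
    have "norm (integral {0..1} (\<lambda>t. f t * cnj (f t))) \<le> B * e * (1 - 0)"
      unfolding eq
    proof (rule integral_bound)
      show "continuous_on {0..1} (\<lambda>t. f t * cnj (f t) - g (chr 1 t) * f t)" by (intro continuous_intros cg c2)
      fix t :: real assume t: "t \<in> {0..1}"
      have eq: "f t * cnj (f t) - g (chr 1 t) * f t = f t * (cnj (F (chr 1 t)) - g (chr 1 t))" by (simp add: Fchr algebra_simps)
      show "norm (f t * cnj (f t) - g (chr 1 t) * f t) \<le> B * e"
        unfolding eq norm_mult using B t g(2)[of "chr 1 t"] by (intro mult_mono) auto
    qed simp
    then show ?thesis by simp
  qed
  have "integral {0..1} (\<lambda>t. f t * cnj (f t)) = 0"
  proof (rule ccontr)
    assume "\<not> ?thesis"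
    then have "norm (integral {0..1} (\<lambda>t. f t * cnj (f t))) > 0" by simp
    then show False
      using small[of "norm (integral {0..1} (\<lambda>t. f t * cnj (f t))) / (2 * B)"] B(2) by (simp add: field_simps)
  qed
  moreover have "integral {0..1} (\<lambda>t. f t * cnj (f t)) = of_real (integral {0..1} (\<lambda>t. (norm (f t))^2))"
  proof -
    have eq: "(\<lambda>t. f t * cnj (f t)) = (\<lambda>t. of_real ((norm (f t))^2))"
      by (rule ext) (simp only: complex_norm_square)
    have "((\<lambda>t. (norm (f t))^2) has_integral integral {0..1} (\<lambda>t. (norm (f t))^2)) {0..1}"
      by (intro integrable_integral integrable_continuous_interval continuous_intros cf)
    then have "((\<lambda>t. of_real ((norm (f t))^2) :: complex) has_integral of_real (integral {0..1} (\<lambda>t. (norm (f t))^2))) {0..1}"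
      by (rule has_integral_of_real)
    then show ?thesis unfolding eq by (rule integral_unique)
  qed
  ultimately have "integral {0..1} (\<lambda>t. (norm (f t))^2) = 0" by simp
  then have "\<forall>t\<in>{0..1}. (norm (f t))^2 = 0"
    by (subst (asm) integral_eq_0_iff) (auto intro!: continuous_intros cf)
  then have z: "f x = 0" if "x \<in> {0..1}" for x using that by simp
  have "t = frac t + of_int \<lfloor>t\<rfloor>" by (simp add: frac_def)
  then have "f t = f (frac t)" using periodic_int[of f, OF per, of "frac t" "\<lfloor>t\<rfloor>"] by simp
  then show ?thesis using z[of "frac t"] frac_lt_1[of t] by (simp add: less_imp_le)
qed

section \<open>The cohomological equation\<close>

definition per2 :: "(real \<Rightarrow> real \<Rightarrow> complex) \<Rightarrow> bool" where
  "per2 f \<longleftrightarrow> (\<forall>t y. f (t + 1) y = f t y \<and> f t (y + 1) = f t y)"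

lemma smooth2_swap: "smooth2 f \<Longrightarrow> smooth2 (\<lambda>t y. f y t)"
proof (rule smooth2_coinduct[where P="\<lambda>g. \<exists>f. smooth2 f \<and> g = (\<lambda>t y. f y t)"])
  fix g :: "real \<Rightarrow> real \<Rightarrow> complex" assume "\<exists>f. smooth2 f \<and> g = (\<lambda>t y. f y t)"
  then obtain f where f: "smooth2 f" "g = (\<lambda>t y. f y t)" by blast
  have c: "continuous_on UNIV (\<lambda>p. g (fst p) (snd p))"
    unfolding f(2)
    using continuous_on_compose2[OF smooth2_continuous[OF f(1)], of UNIV "\<lambda>p. (snd p, fst p)"]
    by (simp add: continuous_on_Pair continuous_on_fst continuous_on_snd continuous_on_id)
  show "continuous_on UNIV (\<lambda>p. g (fst p) (snd p)) \<and>
    (\<exists>f1 f2. (\<forall>t y. ((\<lambda>t. g t y) has_vector_derivative f1 t y) (at t)) \<and>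
      (\<forall>t y. (g t has_vector_derivative f2 t y) (at y)) \<and>
      (\<exists>f. smooth2 f \<and> f1 = (\<lambda>t y. f y t)) \<and> (\<exists>f. smooth2 f \<and> f2 = (\<lambda>t y. f y t)))"
    by (intro conjI c exI[of _ "\<lambda>t y. dy f y t"] exI[of _ "\<lambda>t y. dt f y t"] exI[of _ "dy f"] exI[of _ "dt f"] allI
        smooth2_dy smooth2_dt f refl) (use smooth2_dt_deriv[OF f(1)] smooth2_dy_deriv[OF f(1)] f(2) in auto)
qed blast

lemma smooth2_integral_deriv:
  assumes "smooth2 G"
  shows "((\<lambda>t. integral {0..1} (G t)) has_vector_derivative integral {0..1} (dt G t)) (at t)"
proof -
  have "((\<lambda>t. integral (cbox 0 1) (G t)) has_vector_derivative integral (cbox 0 1) (dt G t)) (at t within UNIV)"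
  proof (rule leibniz_rule_vector_derivative)
    show "((\<lambda>t. G t y) has_vector_derivative dt G t y) (at t within UNIV)" for t y
      using smooth2_dt_deriv[OF assms] by simp
    show "G t integrable_on cbox 0 1" for t
      using continuous_on_slice2[OF smooth2_continuous[OF assms]] by (intro integrable_continuous)
    have "continuous_on (UNIV \<times> cbox 0 1) (\<lambda>p. dt G (fst p) (snd p))"
      using smooth2_continuous[OF smooth2_dt[OF assms]] continuous_on_subset by blast
    then show "continuous_on (UNIV \<times> cbox 0 1) (\<lambda>(x, t). dt G x t)" by (simp add: case_prod_unfold)
  qed auto
  then show ?thesis by simp
qed

lemma smooth2_chr [smooth2_intros]: "smooth2 (\<lambda>t y. chr n t)" "smooth2 (\<lambda>t y. chr n y)"
proof -
  have "smooth2 (\<lambda>t y. exp ((2 * of_real pi * \<i> * of_int n) * of_real t + 0 * of_real y + 0))"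
    by (intro smooth2_exp smooth2_linear)
  then show 1: "smooth2 (\<lambda>t y. chr n t)" by (simp add: chr_def)
  from smooth2_swap[OF this] show "smooth2 (\<lambda>t y. chr n y)" .
qed

lemma dt_per2: assumes "smooth2 f" "per2 f" shows "per2 (dt f)"
proof -
  have "dt f (t + 1) y = dt f t y" for t y
  proof -
    have "((\<lambda>s. f (s + 1) y) has_vector_derivative dt f (t + 1) y) (at t)"
    proof -
      have "((\<lambda>s. s + 1) has_real_derivative 1) (at t)" by (auto intro!: derivative_eq_intros)
      from vector_diff_chain_at[OF this[unfolded has_real_derivative_iff_has_vector_derivative] smooth2_dt_deriv[OF assms(1)]]
      show ?thesis by (simp add: o_def)
    qed
    moreover have "(\<lambda>s. f (s + 1) y) = (\<lambda>s. f s y)" using assms(2) by (auto simp: per2_def)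
    ultimately show ?thesis using smooth2_dt_deriv[OF assms(1)] vector_derivative_unique_at by metis
  qed
  moreover have "dt f t (y + 1) = dt f t y" for t y
    using assms(2) by (simp add: dt_def per2_def)
  ultimately show ?thesis by (simp add: per2_def)
qed

section \<open>Fourier coefficients in two variables\<close>

definition coef :: "(real \<Rightarrow> real \<Rightarrow> complex) \<Rightarrow> int \<times> int \<Rightarrow> complex" where
  "coef f p = integral {0..1} (\<lambda>t. integral {0..1} (\<lambda>y. f t y * (chr (- fst p) t * chr (- snd p) y)))"

definition cont2 :: "(real \<Rightarrow> real \<Rightarrow> complex) \<Rightarrow> bool" where
  "cont2 f \<longleftrightarrow> continuous_on UNIV (\<lambda>p. f (fst p) (snd p))"

lemma smooth2_cont2: "smooth2 f \<Longrightarrow> cont2 f" by (simp add: cont2_def smooth2_continuous)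

lemma cont2_inner:
  assumes "cont2 f"
  shows "f t integrable_on {0..1}" "continuous_on S (\<lambda>t. integral {0..1} (f t))"
    "(\<lambda>t. integral {0..1} (f t)) integrable_on {0..1}"
proof -
  show "f t integrable_on {0..1}"
    using continuous_on_slice2[OF assms[unfolded cont2_def]] by (intro integrable_continuous_interval)
  have "continuous_on (UNIV \<times> cbox 0 1) (\<lambda>p. f (fst p) (snd p))"
    using assms continuous_on_subset unfolding cont2_def by blast
  then have "continuous_on UNIV (\<lambda>t. integral (cbox 0 1) (f t))"
    by (intro integral_continuous_on_param) (simp add: case_prod_unfold)
  then show c: "continuous_on S (\<lambda>t. integral {0..1} (f t))" for S by (auto elim: continuous_on_subset)
  show "(\<lambda>t. integral {0..1} (f t)) integrable_on {0..1}"
    by (intro integrable_continuous_interval c)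
qed

lemma cont2_ops:
  "cont2 f \<Longrightarrow> cont2 g \<Longrightarrow> cont2 (\<lambda>t y. f t y + g t y)"
  "cont2 f \<Longrightarrow> cont2 g \<Longrightarrow> cont2 (\<lambda>t y. f t y - g t y)"
  "cont2 f \<Longrightarrow> cont2 g \<Longrightarrow> cont2 (\<lambda>t y. f t y * g t y)"
  "cont2 (\<lambda>t y. chr m t * chr n y)" "cont2 (\<lambda>t y. c)"
  by (auto simp: cont2_def intro!: continuous_intros)

lemma coef_integrand: "cont2 f \<Longrightarrow> cont2 (\<lambda>t y. f t y * (chr m t * chr n y))"
  by (intro cont2_ops)

lemma coef_diff:
  assumes "cont2 f" "cont2 g" shows "coef (\<lambda>t y. f t y - g t y) p = coef f p - coef g p"
  unfolding coef_def left_diff_distrib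
  by (subst integral_diff, (rule cont2_inner coef_integrand assms)+)+ simp

lemma coef_add:
  assumes "cont2 f" "cont2 g" shows "coef (\<lambda>t y. f t y + g t y) p = coef f p + coef g p"
  unfolding coef_def distrib_right
  by (subst integral_add, (rule cont2_inner coef_integrand assms)+)+ simp

lemma coef_scale: "coef (\<lambda>t y. c * f t y) p = c * coef f p"
  by (simp add: coef_def mult.assoc)

lemma coef_bound:
  assumes "cont2 f" "\<And>t y. t \<in> {0..1} \<Longrightarrow> y \<in> {0..1} \<Longrightarrow> norm (f t y) \<le> B"
  shows "norm (coef f p) \<le> B"
proof -
  note c = coef_integrand[OF assms(1), of "- fst p" "- snd p"]
  have "norm (integral {0..1} (\<lambda>y. f t y * (chr (- fst p) t * chr (- snd p) y))) \<le> B * (1 - 0)" if t: "t \<in> {0..1}" for t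
  proof (rule integral_bound)
    show "continuous_on {0..1} (\<lambda>y. f t y * (chr (- fst p) t * chr (- snd p) y))"
      using continuous_on_slice2[OF c[unfolded cont2_def]] .
  qed (use assms(2) t in \<open>auto simp: norm_mult\<close>)
  then have "norm (coef f p) \<le> B * (1 - 0)"
    unfolding coef_def by (intro integral_bound cont2_inner(2) c) auto
  then show ?thesis by simp
qed

lemma coef_char: "coef (\<lambda>t y. chr k t * chr l y) p = (if p = (k, l) then 1 else 0)"
proof -
  have eq: "chr k t * chr l y * (chr (- fst p) t * chr (- snd p) y) = chr (k - fst p) t * chr (l - snd p) y" for t y
    using chr_add(1)[of k "- fst p" t] chr_add(1)[of l "- snd p" y] by simp
  have "coef (\<lambda>t y. chr k t * chr l y) p = integral {0..1} (\<lambda>t. integral {0..1} (\<lambda>y. chr (k - fst p) t * chr (l - snd p) y))"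
    unfolding coef_def eq ..
  also have "\<dots> = integral {0..1} (chr (k - fst p)) * integral {0..1} (chr (l - snd p))"
    by simp
  finally show ?thesis by (cases p) (auto simp: integral_chr)
qed

text \<open>One-variable uniqueness is used twice: in \<open>t\<close> for each
  \<open>y\<close>-coefficient, then in \<open>y\<close> for each slice.\<close>

lemma coef_unique:
  assumes c: "cont2 f" and p: "per2 f" and z: "\<And>p. coef f p = 0"
  shows "f t y = 0"
proof -
  have inner: "orth (\<lambda>t. integral {0..1} (\<lambda>y. f t y * chr n y))" for n
    unfolding orth_def
  proof (intro conjI allI)
    have c': "cont2 (\<lambda>t y. f t y * chr n y)" for n using coef_integrand[OF c, of 0 n] by simp
    show "continuous_on UNIV (\<lambda>t. integral {0..1} (\<lambda>y. f t y * chr n y))" by (rule cont2_inner[OF c'])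
    fix m
    have "coef f (- m, - n) = integral {0..1} (\<lambda>t. integral {0..1} (\<lambda>y. chr m t * (f t y * chr n y)))"
      unfolding coef_def by (simp add: mult_ac)
    also have "\<dots> = integral {0..1} (\<lambda>t. integral {0..1} (\<lambda>y. f t y * chr n y) * chr m t)"
      by (simp add: mult.commute)
    finally show "integral {0..1} (\<lambda>t. integral {0..1} (\<lambda>y. f t y * chr n y) * chr m t) = 0" using z by simp
  qed
  have "integral {0..1} (\<lambda>y. f t y * chr n y) = 0" for t n
    by (rule fourier_uniqueness[OF inner]) (use p in \<open>simp add: per2_def\<close>)
  then have "orth (f t)" for t
    using continuous_on_slice2[OF c[unfolded cont2_def]] by (simp add: orth_def)
  then show ?thesis by (rule fourier_uniqueness) (use p in \<open>simp add: per2_def\<close>)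
qed

section \<open>Rapidly decreasing coefficients and their series\<close>

definition wt :: "int \<times> int \<Rightarrow> real" where "wt p = 1 + \<bar>of_int (fst p)\<bar> + \<bar>of_int (snd p)\<bar>"

definition rapid :: "(int \<times> int \<Rightarrow> complex) \<Rightarrow> bool" where
  "rapid d \<longleftrightarrow> (\<forall>N. \<exists>C. \<forall>p. norm (d p) * wt p ^ N \<le> C)"

lemma rapidD: "rapid d \<Longrightarrow> \<exists>C. \<forall>p. norm (d p) * wt p ^ N \<le> C"
  unfolding rapid_def by blast

lemma wt_ge_1: "wt p \<ge> 1" by (simp add: wt_def)

lemma rapid_mono:
  assumes "rapid d" "\<And>p. norm (d' p) \<le> K * wt p ^ m * norm (d p)" "K \<ge> 0"
  shows "rapid d'"
  unfolding rapid_def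
proof
  fix N
  obtain C where C: "\<And>p. norm (d p) * wt p ^ (m + N) \<le> C" using rapidD[OF assms(1)] by blast
  have "norm (d' p) * wt p ^ N \<le> K * C" for p
  proof -
    have "norm (d' p) * wt p ^ N \<le> (K * wt p ^ m * norm (d p)) * wt p ^ N"
      using assms(2) wt_ge_1[of p] by (intro mult_right_mono) auto
    also have "\<dots> = K * (norm (d p) * wt p ^ (m + N))" by (simp add: power_add)
    also have "\<dots> \<le> K * C" using C assms(3) by (intro mult_left_mono) auto
    finally show ?thesis .
  qed
  then show "\<exists>C. \<forall>p. norm (d' p) * wt p ^ N \<le> C" by blast
qed

text \<open>The enumeration turns sums over the lattice into ordinary series. Pairing grows at most
  quadratically (\<open>idx_wt\<close>), so rapid decay in \<open>wt\<close> becomes rapid decay in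
  the index.\<close>

definition idx :: "nat \<Rightarrow> int \<times> int" where
  "idx n = (int_decode (fst (prod_decode n)), int_decode (snd (prod_decode n)))"

lemma bij_idx: "bij idx"
proof (rule o_bij)
  show "(\<lambda>p. prod_encode (int_encode (fst p), int_encode (snd p))) \<circ> idx = id" by (auto simp: idx_def)
  show "idx \<circ> (\<lambda>p. prod_encode (int_encode (fst p), int_encode (snd p))) = id" by (auto simp: idx_def)
qed

lemma idx_wt: "1 + real n \<le> 16 * wt (idx n) ^ 2"
proof -
  obtain a b where ab: "prod_decode n = (a, b)" by fastforce
  then have n: "n = prod_encode (a, b)" by (metis prod_decode_inverse)
  have tri: "triangle m \<le> m * m" for m by (simp add: triangle_def) (cases m; simp)
  have "n \<le> (a + b + 1) * (a + b + 1)"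
    using tri[of "a + b"] by (simp add: n prod_encode_def algebra_simps)
  then have 1: "real n \<le> (real a + real b + 1) ^ 2"
  proof -
    have "real n \<le> real ((a + b + 1) * (a + b + 1))" using \<open>n \<le> (a + b + 1) * (a + b + 1)\<close> by (simp only: of_nat_le_iff)
    then show ?thesis unfolding power2_eq_square by (simp add: algebra_simps)
  qed
  have e: "real m \<le> 2 * \<bar>of_int (int_decode m)\<bar> + 1" for m
  proof -
    have "m = int_encode (int_decode m)" by simp
    moreover have "real (int_encode i) \<le> 2 * \<bar>of_int i\<bar> + 1" for i by (auto simp: int_encode_def sum_encode_def)
    ultimately show ?thesis by metis
  qed
  have "(real a + real b + 1) ^ 2 \<le> (3 * wt (idx n)) ^ 2"
    using e[of a] e[of b] by (intro power_mono) (auto simp: wt_def idx_def ab)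
  moreover have "1 \<le> wt (idx n) ^ 2" using wt_ge_1 by (intro one_le_power)
  ultimately show ?thesis using 1 by (simp add: power_mult_distrib)
qed

lemma rapid_summable: assumes "rapid d" shows "summable (\<lambda>n. norm (d (idx n)))"
proof -
  obtain C where C: "\<And>p. norm (d p) * wt p ^ 4 \<le> C" using rapidD[OF assms] by blast
  have "norm (norm (d (idx n))) \<le> 256 * C * (1 / (real (Suc n))^2)" for n
  proof -
    have "(1 + real n)^2 \<le> (16 * wt (idx n) ^ 2) ^ 2" by (intro power_mono idx_wt) auto
    also have "\<dots> = 256 * wt (idx n) ^ 4" by (simp add: power_mult_distrib)
    finally have "norm (d (idx n)) * (1 + real n)^2 \<le> norm (d (idx n)) * (256 * wt (idx n) ^ 4)"
      by (intro mult_left_mono) auto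
    also have "\<dots> \<le> 256 * C" using C[of "idx n"] by simp
    finally show ?thesis by (simp add: field_simps)
  qed
  moreover have "summable (\<lambda>n. 256 * C * (1 / (real (Suc n))^2))"
    using inverse_squares_sums by (intro summable_mult) (auto simp: sums_iff add.commute)
  ultimately show ?thesis by (rule summable_comparison_test'[rotated])
qed

definition fser :: "(int \<times> int \<Rightarrow> complex) \<Rightarrow> real \<Rightarrow> real \<Rightarrow> complex" where
  "fser d t y = (\<Sum>n. d (idx n) * (chr (fst (idx n)) t * chr (snd (idx n)) y))"

abbreviation fpart :: "(int \<times> int \<Rightarrow> complex) \<Rightarrow> nat \<Rightarrow> real \<Rightarrow> real \<Rightarrow> complex" where
  "fpart d n t y \<equiv> (\<Sum>i<n. d (idx i) * (chr (fst (idx i)) t * chr (snd (idx i)) y))"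

lemma fser_uniform:
  assumes "rapid d"
  shows "uniform_limit UNIV (\<lambda>n p. fpart d n (fst p) (snd p)) (\<lambda>p. fser d (fst p) (snd p)) sequentially"
  unfolding fser_def
  by (rule Weierstrass_m_test[OF _ rapid_summable[OF assms]]) (simp add: norm_mult)

lemma fser_sums:
  assumes "rapid d"
  shows "(\<lambda>n. d (idx n) * (chr (fst (idx n)) t * chr (snd (idx n)) y)) sums fser d t y"
  unfolding fser_def
  by (rule summable_sums, rule summable_norm_cancel) (use rapid_summable[OF assms] in \<open>simp add: norm_mult\<close>)

lemma fpart_cont2: "cont2 (fpart d n)"
  by (auto simp: cont2_def intro!: continuous_intros)

lemma fser_cont2: assumes "rapid d" shows "cont2 (fser d)"
proof -
  have "\<forall>\<^sub>F n in sequentially. continuous_on UNIV (\<lambda>p. fpart d n (fst p) (snd p))"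
    using fpart_cont2 unfolding cont2_def by simp
  from uniform_limit_theorem[OF this fser_uniform[OF assms]] show ?thesis by (simp add: cont2_def)
qed

lemma fser_eps:
  assumes "rapid d" "e > 0"
  shows "\<exists>N. \<forall>n\<ge>N. \<forall>t y. norm (fpart d n t y - fser d t y) \<le> e"
proof -
  have "\<forall>\<^sub>F n in sequentially. \<forall>p\<in>UNIV. dist (fpart d n (fst p) (snd p)) (fser d (fst p) (snd p)) < e"
    using fser_uniform[OF assms(1)] assms(2) unfolding uniform_limit_iff by blast
  then obtain N where N: "\<forall>n\<ge>N. \<forall>p\<in>UNIV. dist (fpart d n (fst p) (snd p)) (fser d (fst p) (snd p)) < e"
    unfolding eventually_sequentially by blast
  have "norm (fpart d n t y - fser d t y) \<le> e" if "n \<ge> N" for n t y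
    using N[rule_format, OF that, of "(t, y)"] by (simp add: dist_norm)
  then show ?thesis by blast
qed

lemma coef_fpart: "coef (fpart d n) p = (\<Sum>i<n. if p = idx i then d (idx i) else 0)"
proof (induction n)
  case 0 then show ?case by (simp add: coef_def)
next
  case (Suc n)
  have "coef (\<lambda>t y. fpart d n t y + d (idx n) * (chr (fst (idx n)) t * chr (snd (idx n)) y)) p
    = coef (fpart d n) p + coef (\<lambda>t y. d (idx n) * (chr (fst (idx n)) t * chr (snd (idx n)) y)) p"
    by (intro coef_add fpart_cont2 cont2_ops)
  also have "coef (\<lambda>t y. d (idx n) * (chr (fst (idx n)) t * chr (snd (idx n)) y)) p = (if p = idx n then d (idx n) else 0)"
    unfolding coef_scale coef_char by simp
  finally show ?case using Suc by simp
qed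

lemma coef_fser: assumes "rapid d" shows "coef (fser d) p = d p"
proof -
  obtain m where m: "idx m = p" using bij_is_surj[OF bij_idx] by (metis surjD)
  have inj: "idx i = idx j \<longleftrightarrow> i = j" for i j using bij_idx by (meson bij_def injD)
  have part: "coef (fpart d n) p = d p" if "n > m" for n
  proof -
    have "coef (fpart d n) p = (\<Sum>i<n. if i = m then d p else 0)"
      unfolding coef_fpart by (rule sum.cong) (auto simp: m[symmetric] inj)
    then show ?thesis using that by simp
  qed
  have "norm (coef (fser d) p - d p) \<le> e" if e: "e > 0" for e
  proof -
    obtain N where N: "\<forall>n\<ge>N. \<forall>t y. norm (fpart d n t y - fser d t y) \<le> e" using fser_eps[OF assms e] by blast
    define n where "n = max N (Suc m)"
    have "norm (coef (\<lambda>t y. fpart d n t y - fser d t y) p) \<le> e"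
      by (rule coef_bound) (use N in \<open>auto simp: n_def intro!: cont2_ops fpart_cont2 fser_cont2 assms\<close>)
    then have "norm (coef (fpart d n) p - coef (fser d) p) \<le> e"
      by (simp add: coef_diff fpart_cont2 fser_cont2 assms)
    then show ?thesis using part[of n] by (simp add: n_def norm_minus_commute)
  qed
  then have "norm (coef (fser d) p - d p) \<le> 0" by (rule field_le_epsilon) simp
  then show ?thesis by simp
qed

lemma fser_dt:
  assumes d: "rapid d" and d': "rapid (\<lambda>p. 2 * of_real pi * \<i> * of_int (fst p) * d p)"
  shows "((\<lambda>t. fser d t y) has_vector_derivative fser (\<lambda>p. 2 * of_real pi * \<i> * of_int (fst p) * d p) t y) (at t)"
proof -
  let ?d = "\<lambda>p. 2 * of_real pi * \<i> * of_int (fst p) * d p"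
  have "\<exists>g. \<forall>t\<in>UNIV. (\<lambda>n. d (idx n) * (chr (fst (idx n)) t * chr (snd (idx n)) y)) sums g t \<and>
     (g has_derivative (\<lambda>h. h *\<^sub>R fser ?d t y)) (at t within UNIV)"
  proof (rule has_derivative_series[where f'="\<lambda>n t h. h *\<^sub>R (?d (idx n) * (chr (fst (idx n)) t * chr (snd (idx n)) y))" and x=0])
    fix n :: nat and t :: real
    have "((\<lambda>t. d (idx n) * (chr (fst (idx n)) t * chr (snd (idx n)) y)) has_vector_derivative
       d (idx n) * (2 * of_real pi * \<i> * of_int (fst (idx n)) * chr (fst (idx n)) t * chr (snd (idx n)) y)) (at t within UNIV)"
      by (intro has_vector_derivative_mult_right has_vector_derivative_mult_left chr_deriv)
    then show "((\<lambda>t. d (idx n) * (chr (fst (idx n)) t * chr (snd (idx n)) y)) has_derivative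
       (\<lambda>h. h *\<^sub>R (?d (idx n) * (chr (fst (idx n)) t * chr (snd (idx n)) y)))) (at t within UNIV)"
      by (simp add: has_vector_derivative_def mult_ac)
  next
    fix e :: real assume "e > 0"
    then obtain N where N: "\<forall>n\<ge>N. \<forall>t y. norm (fpart ?d n t y - fser ?d t y) \<le> e" using fser_eps[OF d'] by blast
    have "norm ((\<Sum>i<n. h *\<^sub>R (?d (idx i) * (chr (fst (idx i)) t * chr (snd (idx i)) y))) - h *\<^sub>R fser ?d t y) \<le> e * norm h"
      if "n \<ge> N" for n t h
    proof -
      have "(\<Sum>i<n. h *\<^sub>R (?d (idx i) * (chr (fst (idx i)) t * chr (snd (idx i)) y))) - h *\<^sub>R fser ?d t y
        = h *\<^sub>R (fpart ?d n t y - fser ?d t y)" by (simp add: scaleR_sum_right scaleR_diff_right)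
      then show ?thesis using N that mult_right_mono[of "norm (fpart ?d n t y - fser ?d t y)" e "\<bar>h\<bar>"]
        by (simp add: mult.commute)
    qed
    then show "\<forall>\<^sub>F n in sequentially. \<forall>t\<in>UNIV. \<forall>h. norm ((\<Sum>i<n. h *\<^sub>R (?d (idx i) * (chr (fst (idx i)) t * chr (snd (idx i)) y))) - h *\<^sub>R fser ?d t y) \<le> e * norm h"
      unfolding eventually_sequentially by blast
  qed (use fser_sums[OF d, of 0 y] in auto)
  then obtain g where g: "\<And>t. (\<lambda>n. d (idx n) * (chr (fst (idx n)) t * chr (snd (idx n)) y)) sums g t"
    "\<And>t. (g has_derivative (\<lambda>h. h *\<^sub>R fser ?d t y)) (at t)" by auto
  have "g = (\<lambda>t. fser d t y)" using sums_unique2[OF g(1) fser_sums[OF d]] by auto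
  with g(2) show ?thesis by (simp add: has_vector_derivative_def)
qed

definition swapd :: "(int \<times> int \<Rightarrow> complex) \<Rightarrow> int \<times> int \<Rightarrow> complex" where "swapd d p = d (snd p, fst p)"

lemma rapid_swap: "rapid d \<Longrightarrow> rapid (swapd d)"
  unfolding rapid_def
proof
  fix N assume "\<forall>N. \<exists>C. \<forall>p. norm (d p) * wt p ^ N \<le> C"
  then obtain C where C: "\<And>p. norm (d p) * wt p ^ N \<le> C" by blast
  have "wt (snd p, fst p) = wt p" for p by (simp add: wt_def)
  then have "norm (swapd d p) * wt p ^ N \<le> C" for p
    using C[of "(snd p, fst p)"] by (simp add: swapd_def)
  then show "\<exists>C. \<forall>p. norm (swapd d p) * wt p ^ N \<le> C" by blast
qed

text \<open>\<open>idx\<close> is not symmetric, so the two sides are different arrangements of one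
  series; they agree because their Fourier coefficients do.\<close>

lemma fser_swap: assumes "rapid d" shows "fser d t y = fser (swapd d) y t"
proof -
  have "fser d t y - fser (swapd d) y t = 0"
  proof (rule coef_unique[where f="\<lambda>t y. fser d t y - fser (swapd d) y t"])
    have c: "cont2 (\<lambda>t y. fser (swapd d) y t)"
      using continuous_on_compose2[OF fser_cont2[OF rapid_swap[OF assms], unfolded cont2_def], of UNIV "\<lambda>p. (snd p, fst p)"]
      by (simp add: cont2_def continuous_on_Pair continuous_on_fst continuous_on_snd continuous_on_id)
    show "cont2 (\<lambda>t y. fser d t y - fser (swapd d) y t)" by (intro cont2_ops c fser_cont2 assms)
    show "per2 (\<lambda>t y. fser d t y - fser (swapd d) y t)" by (simp add: per2_def fser_def chr_periodic)
    fix p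
    let ?f = "\<lambda>t y. fser (swapd d) t y * (chr (- snd p) t * chr (- fst p) y)"
    have cf: "cont2 ?f" by (intro cont2_ops fser_cont2 rapid_swap assms)
    have "continuous_on (cbox (0,0) (1,1)) (\<lambda>(x, y). ?f x y)"
      using cf continuous_on_subset by (fastforce simp: cont2_def case_prod_unfold)
    then have "integral (cbox 0 1) (\<lambda>x. integral (cbox 0 1) (?f x)) = integral (cbox 0 1) (\<lambda>y. integral (cbox 0 1) (\<lambda>x. ?f x y))"
      by (rule integral_swap_continuous)
    then have "coef (\<lambda>t y. fser (swapd d) y t) p = coef (fser (swapd d)) (snd p, fst p)"
      by (simp add: coef_def mult_ac)
    also have "\<dots> = d p" by (simp add: coef_fser rapid_swap assms swapd_def)
    finally show "coef (\<lambda>t y. fser d t y - fser (swapd d) y t) p = 0"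
      by (simp add: coef_diff c fser_cont2 coef_fser assms)
  qed
  then show ?thesis by simp
qed

lemma rapid_deriv: "rapid d \<Longrightarrow> rapid (\<lambda>p. 2 * of_real pi * \<i> * of_int (fst p) * d p)"
proof (rule rapid_mono[where K="2 * pi" and m=1])
  fix p
  have "norm (2 * of_real pi * \<i> * of_int (fst p) * d p) = 2 * pi * (\<bar>of_int (fst p)\<bar> * norm (d p))"
    by (simp add: norm_mult)
  also have "\<dots> \<le> 2 * pi * (wt p * norm (d p))"
    by (intro mult_left_mono mult_right_mono) (auto simp: wt_def)
  finally show "norm (2 * of_real pi * \<i> * of_int (fst p) * d p) \<le> 2 * pi * wt p ^ 1 * norm (d p)" by simp
qed auto

text \<open>The derivative in \<open>y\<close> comes from the one in \<open>t\<close> by swapping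
  the variables before and after.\<close>

lemma fser_smooth2: "rapid d \<Longrightarrow> smooth2 (fser d)"
proof (rule smooth2_coinduct[where P="\<lambda>g. \<exists>d. rapid d \<and> g = fser d"])
  fix g assume "\<exists>d. rapid d \<and> g = fser d"
  then obtain d where d: "rapid d" and g: "g = fser d" by blast
  let ?D = "\<lambda>d p. 2 * of_real pi * \<i> * of_int (fst p) * d p"
  let ?d2 = "swapd (?D (swapd d))"
  have r2: "rapid ?d2" by (intro rapid_swap rapid_deriv d)
  have sw: "swapd ?d2 = ?D (swapd d)" by (auto simp: swapd_def)
  have e1: "(\<lambda>s. fser (swapd d) s t) = fser d t" for t using fser_swap[OF d] by auto
  have e2: "fser (?D (swapd d)) y t = fser ?d2 t y" for t y using fser_swap[OF r2, of t y] unfolding sw by simp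
  have d2: "(fser d t has_vector_derivative fser ?d2 t y) (at y)" for t y
    using fser_dt[OF rapid_swap[OF d] rapid_deriv[OF rapid_swap[OF d]], of t y] unfolding e1 e2 .
  show "continuous_on UNIV (\<lambda>p. g (fst p) (snd p)) \<and>
    (\<exists>f1 f2. (\<forall>t y. ((\<lambda>t. g t y) has_vector_derivative f1 t y) (at t)) \<and>
      (\<forall>t y. (g t has_vector_derivative f2 t y) (at y)) \<and> (\<exists>d. rapid d \<and> f1 = fser d) \<and> (\<exists>d. rapid d \<and> f2 = fser d))"
    unfolding g
    by (intro conjI exI[of _ "fser (?D d)"] exI[of _ "fser ?d2"] exI[of _ "?D d"] exI[of _ ?d2] allI
        fser_dt d2 rapid_deriv d r2 refl fser_cont2[unfolded cont2_def])
qed blast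

section \<open>Decay of Fourier coefficients and inversion\<close>

lemma coef_dt:
  assumes s: "smooth2 f" and p: "per2 f"
  shows "coef (dt f) (k, l) = 2 * of_real pi * \<i> * of_int k * coef f (k, l)"
proof -
  let ?g = "\<lambda>t y. f t y * (chr (- k) t * chr (- l) y)"
  have sg: "smooth2 ?g" by (intro smooth2_intros s)
  have dg: "dt ?g t y = dt f t y * (chr (- k) t * chr (- l) y) - 2 * of_real pi * \<i> * of_int k * ?g t y" for t y
  proof -
    have "((\<lambda>t. ?g t y) has_vector_derivative
       f t y * ((2 * of_real pi * \<i> * of_int (- k) * chr (- k) t) * chr (- l) y) + dt f t y * (chr (- k) t * chr (- l) y)) (at t)"
      by (intro has_vector_derivative_mult has_vector_derivative_mult_left smooth2_dt_deriv[OF s] chr_deriv)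
    from vector_derivative_at[OF this] show ?thesis unfolding dt_def[of ?g] by (simp add: algebra_simps)
  qed
  have "((\<lambda>t. integral {0..1} (dt ?g t)) has_integral (integral {0..1} (?g 1) - integral {0..1} (?g 0))) {0..1}"
    by (rule fundamental_theorem_of_calculus) (auto intro: has_vector_derivative_at_within smooth2_integral_deriv[OF sg])
  moreover have "?g 1 = ?g 0"
    using p[unfolded per2_def, rule_format, of 0] by auto
  ultimately have "integral {0..1} (\<lambda>t. integral {0..1} (dt ?g t)) = 0" by (simp add: integral_unique)
  then have "coef (\<lambda>t y. dt f t y - 2 * of_real pi * \<i> * of_int k * f t y) (k, l) = 0"
    unfolding coef_def dg by (simp add: algebra_simps)
  then show ?thesis
    by (simp add: coef_diff smooth2_cont2 smooth2_dt s cont2_ops coef_scale)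
qed

lemma coef_swap:
  assumes "cont2 f" shows "coef (\<lambda>t y. f y t) p = coef f (snd p, fst p)"
proof -
  let ?f = "\<lambda>t y. f t y * (chr (- snd p) t * chr (- fst p) y)"
  have cf: "cont2 ?f" by (intro cont2_ops assms)
  have "continuous_on (cbox (0,0) (1,1)) (\<lambda>(x, y). ?f x y)"
    using cf continuous_on_subset by (fastforce simp: cont2_def case_prod_unfold)
  then have "integral (cbox 0 1) (\<lambda>x. integral (cbox 0 1) (?f x)) = integral (cbox 0 1) (\<lambda>y. integral (cbox 0 1) (\<lambda>x. ?f x y))"
    by (rule integral_swap_continuous)
  then show ?thesis by (simp add: coef_def mult_ac)
qed

lemma coef_decay_fst:
  assumes "smooth2 f" "per2 f"
  shows "\<exists>C. \<forall>k l. norm (coef f (k, l)) * \<bar>of_int k\<bar> ^ N \<le> C"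
  using assms
proof (induction N arbitrary: f)
  case 0
  have "bounded ((\<lambda>p. f (fst p) (snd p)) ` ({0..1} \<times> {0..1}))"
    by (intro compact_imp_bounded compact_continuous_image compact_Times)
      (use smooth2_continuous[OF 0(1)] continuous_on_subset in auto)
  then obtain B where "\<forall>x\<in>(\<lambda>p. f (fst p) (snd p)) ` ({0..1} \<times> {0..1}). norm x \<le> B" unfolding bounded_pos by blast
  then have "norm (f t y) \<le> B" if "t \<in> {0..1}" "y \<in> {0..1}" for t y using that by force
  then have "norm (coef f p) \<le> B" for p by (intro coef_bound smooth2_cont2 0)
  then show ?case by auto
next
  case (Suc N)
  from Suc.IH[OF smooth2_dt dt_per2] Suc.prems obtain C where
    C: "\<And>k l. norm (coef (dt f) (k, l)) * \<bar>of_int k\<bar> ^ N \<le> C" by blast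
  have "norm (coef f (k, l)) * \<bar>of_int k\<bar> ^ Suc N \<le> C" for k l
  proof -
    have "norm (coef f (k, l)) * \<bar>of_int k\<bar> * 1 \<le> norm (coef f (k, l)) * \<bar>of_int k\<bar> * (2 * pi)"
      using pi_ge_two by (intro mult_left_mono) auto
    also have "\<dots> = norm (coef (dt f) (k, l))"
      using coef_dt[OF Suc.prems] by (simp add: norm_mult)
    finally have "norm (coef f (k, l)) * \<bar>of_int k\<bar> * \<bar>of_int k\<bar> ^ N \<le> norm (coef (dt f) (k, l)) * \<bar>of_int k\<bar> ^ N"
      by (intro mult_right_mono) auto
    then show ?thesis using C[of k l] by (simp add: mult.assoc)
  qed
  then show ?case by blast
qed

lemma coef_rapid:
  assumes "smooth2 f" "per2 f" shows "rapid (coef f)"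
  unfolding rapid_def
proof
  fix N
  obtain C0 where C0: "\<And>k l. norm (coef f (k, l)) * \<bar>of_int k\<bar> ^ 0 \<le> C0" using coef_decay_fst[OF assms] by blast
  obtain C1 where C1: "\<And>k l. norm (coef f (k, l)) * \<bar>of_int k\<bar> ^ N \<le> C1" using coef_decay_fst[OF assms] by blast
  have "smooth2 (\<lambda>t y. f y t)" "per2 (\<lambda>t y. f y t)" using assms smooth2_swap by (auto simp: per2_def)
  from coef_decay_fst[OF this] obtain C2 where C2': "\<And>k l. norm (coef (\<lambda>t y. f y t) (k, l)) * \<bar>of_int k\<bar> ^ N \<le> C2" by blast
  have C2: "norm (coef f (k, l)) * \<bar>of_int l\<bar> ^ N \<le> C2" for k l
    using C2'[of l k] by (simp add: coef_swap smooth2_cont2 assms)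
  have "norm (coef f (k, l)) * wt (k, l) ^ N \<le> 3 ^ N * (C0 + C1 + C2)" for k l
  proof -
    define m where "m = max 1 (max \<bar>of_int k :: real\<bar> \<bar>of_int l\<bar>)"
    have "wt (k, l) ^ N \<le> (3 * m) ^ N" by (intro power_mono) (auto simp: wt_def m_def)
    moreover have "m ^ N \<le> 1 + \<bar>of_int k\<bar> ^ N + \<bar>of_int l\<bar> ^ N" by (auto simp: m_def max_def)
    ultimately have "wt (k, l) ^ N \<le> 3 ^ N * (1 + \<bar>of_int k\<bar> ^ N + \<bar>of_int l\<bar> ^ N)"
      unfolding power_mult_distrib using mult_left_mono[of "m ^ N" _ "3 ^ N :: real"] by (meson order_trans zero_le_numeral zero_le_power)
    then have "norm (coef f (k, l)) * wt (k, l) ^ N \<le> norm (coef f (k, l)) * (3 ^ N * (1 + \<bar>of_int k\<bar> ^ N + \<bar>of_int l\<bar> ^ N))"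
      by (intro mult_left_mono) auto
    also have "\<dots> = 3 ^ N * (norm (coef f (k, l)) + norm (coef f (k, l)) * \<bar>of_int k\<bar> ^ N + norm (coef f (k, l)) * \<bar>of_int l\<bar> ^ N)"
      by (simp add: algebra_simps)
    also have "\<dots> \<le> 3 ^ N * (C0 + C1 + C2)"
      using C0[of k l] C1[of k l] C2[of k l] by (intro mult_left_mono) auto
    finally show ?thesis .
  qed
  then show "\<exists>C. \<forall>p. norm (coef f p) * wt p ^ N \<le> C" by (metis prod.collapse)
qed

lemma fourier_inversion:
  assumes "smooth2 f" "per2 f" shows "fser (coef f) t y = f t y"
proof -
  have r: "rapid (coef f)" by (rule coef_rapid[OF assms])
  have "fser (coef f) t y - f t y = 0"
  proof (rule coef_unique[where f="\<lambda>t y. fser (coef f) t y - f t y"])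
    show "cont2 (\<lambda>t y. fser (coef f) t y - f t y)" by (intro cont2_ops fser_cont2 r smooth2_cont2 assms)
    show "per2 (\<lambda>t y. fser (coef f) t y - f t y)" using assms(2) by (simp add: per2_def fser_def chr_periodic)
    show "coef (\<lambda>t y. fser (coef f) t y - f t y) p = 0" for p
      by (simp add: coef_diff fser_cont2 r smooth2_cont2 assms coef_fser)
  qed
  then show ?thesis by simp
qed

text \<open>The norm is \<open>2 * sin (pi * \<bar>f\<bar>)\<close> with
  \<open>\<bar>f\<bar>\<close> the distance of \<open>x\<close> to the nearest integer. The cubic
  Taylor bound gives \<open>sin u \<ge> u / 2\<close> on \<open>[0, pi / 2]\<close>, which suffices
  since \<open>pi \<ge> 2\<close>.\<close>

lemma norm_one_minus_exp:
  assumes "\<And>j::int. \<bar>x - of_int j\<bar> \<ge> c" "c \<le> 1/2"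
  shows "norm (1 - exp (2 * of_real pi * \<i> * of_real x)) \<ge> 2 * c"
proof (cases "c \<le> 0")
  case True
  then show ?thesis using norm_ge_zero[of "1 - exp (2 * of_real pi * \<i> * of_real x)"] by linarith
next
  case False
  define f where "f = x - of_int (round x)"
  have f: "\<bar>f\<bar> \<le> 1/2" "c \<le> \<bar>f\<bar>"
    using of_int_round_abs_le[of x] assms(1)[of "round x"] by (auto simp: f_def abs_minus_commute)
  have "exp (2 * of_real pi * \<i> * of_real x) = exp (2 * of_real pi * \<i> * of_real f) * exp (2 * of_real pi * \<i> * of_int (round x))"
    by (simp add: f_def exp_add[symmetric] algebra_simps)
  also have "exp (2 * of_real pi * \<i> * of_int (round x)) = (1::complex)" using exp_integer_2pi[of "of_int (round x)"] by (simp add: mult_ac)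
  finally have "norm (1 - exp (2 * of_real pi * \<i> * of_real x)) = norm (exp (\<i> * of_real (2 * pi * f)) - 1)"
    by (simp add: norm_minus_commute mult_ac)
  also have "\<dots> = 2 * \<bar>sin (pi * f)\<bar>" unfolding dist_exp_i_1 by simp
  also have "\<bar>sin (pi * f)\<bar> = sin (pi * \<bar>f\<bar>)"
  proof -
    have "pi * \<bar>f\<bar> \<le> pi * 1" using f by (intro mult_left_mono) auto
    then have "sin (pi * \<bar>f\<bar>) \<ge> 0" by (intro sin_ge_zero) auto
    then show ?thesis by (cases "f \<ge> 0") auto
  qed
  finally have n: "norm (1 - exp (2 * of_real pi * \<i> * of_real x)) = 2 * sin (pi * \<bar>f\<bar>)" .
  have "sin (pi * \<bar>f\<bar>) \<ge> \<bar>f\<bar>"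
  proof -
    let ?u = "pi * \<bar>f\<bar>"
    have u: "0 \<le> ?u" "?u \<le> pi / 2" using f pi_gt_zero by auto
    have "\<bar>sin ?u - (\<Sum>m<3. sin_coeff m * ?u ^ m)\<bar> \<le> inverse (fact 3) * \<bar>?u\<bar> ^ 3"
      by (rule Maclaurin_sin_bound)
    moreover have "(\<Sum>m<3. sin_coeff m * ?u ^ m) = ?u"
      by (simp add: sin_coeff_def eval_nat_numeral)
    ultimately have "\<bar>sin ?u - ?u\<bar> \<le> inverse (fact 3) * \<bar>?u\<bar> ^ 3" by (simp only:)
    moreover have "inverse (fact 3) * \<bar>?u\<bar> ^ 3 = ?u ^ 3 / 6" unfolding abs_of_nonneg[OF u(1)] by (simp add: fact_numeral)
    ultimately have 1: "sin ?u \<ge> ?u - ?u ^ 3 / 6" by linarith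
    have "pi \<le> 32 / 10" using pi_approx by simp
    then have "?u \<le> 8 / 5" using u(2) by linarith
    then have "?u ^ 2 \<le> (8 / 5) ^ 2" using u by (intro power_mono)
    then have "?u * ?u ^ 2 \<le> ?u * (8 / 5) ^ 2" using u by (intro mult_left_mono)
    moreover have "?u * ?u ^ 2 = ?u ^ 3" by (simp add: power3_eq_cube power2_eq_square)
    ultimately have "?u ^ 3 \<le> ?u * (8 / 5) ^ 2" by simp
    then have "?u ^ 3 \<le> ?u * (64 / 25)" by (simp add: power2_eq_square)
    then have "?u - ?u ^ 3 / 6 \<ge> ?u * (1 / 2)" using u(1) by linarith
    moreover have "?u * (1 / 2) \<ge> \<bar>f\<bar>" using pi_ge_two mult_right_mono[of 2 pi "\<bar>f\<bar>"] by simp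
    ultimately show ?thesis using 1 by linarith
  qed
  then show ?thesis using n f by simp
qed

text \<open>On the Fourier side the equation is a division by
  \<open>1 - chr k (- a) * chr l (- b)\<close>. The mean \<open>c\<close> has to be removed because
  this vanishes at \<open>(0, 0)\<close>; elsewhere the Diophantine bound costs a factor
  \<open>wt ^ 3\<close>, which rapid decay absorbs.\<close>

theorem cohomological_equation:
  assumes f: "smooth2 f" "per2 f" and ab: "diophantine a b"
  obtains \<phi> c where "smooth2 \<phi>" "per2 \<phi>" "\<And>t y. \<phi> t y - \<phi> (t - a) (y - b) = f t y - c"
proof -
  define c where "c = coef f (0, 0)"
  define g where "g t y = f t y - c" for t y
  have g: "smooth2 g" "per2 g"
    unfolding g_def[abs_def] using f by (auto intro!: smooth2_intros simp: per2_def)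
  have cc: "coef (\<lambda>t y. c) (0, 0) = c" by (simp add: coef_def)
  have g0: "coef g (0, 0) = 0"
  proof -
    have "coef g (0, 0) = coef f (0, 0) - coef (\<lambda>t y. c) (0, 0)"
      unfolding g_def[abs_def] by (intro coef_diff smooth2_cont2 f cont2_ops)
    then show ?thesis unfolding cc by (simp add: c_def)
  qed
  define m where "m p = 1 - chr (fst p) (- a) * chr (snd p) (- b)" for p :: "int \<times> int"
  \<comment> \<open>At \<open>(0, 0)\<close> numerator and denominator vanish and the quotient is 0
    by convention; the mean of the solution is free, so this is a valid choice.\<close>
  define u where "u p = coef g p / m p" for p
  obtain c0 where c0: "c0 > 0" "\<And>k l j :: int. (k \<noteq> 0 \<or> l \<noteq> 0) \<Longrightarrow>
     \<bar>of_int k * a + of_int l * b - of_int j\<bar> \<ge> c0 / (1 + \<bar>of_int k\<bar> + \<bar>of_int l\<bar>) ^ 3"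
    using ab unfolding diophantine_def by blast
  \<comment> \<open>\<open>norm_one_minus_exp\<close> is stated for bounds up to 1/2, the largest
    possible distance to the integers.\<close>
  define c1 where "c1 = min c0 (1/2)"
  have c1: "c1 > 0" "c1 \<le> c0" "c1 \<le> 1/2" using c0 by (auto simp: c1_def)
  have m: "norm (m p) \<ge> 2 * (c1 / wt p ^ 3)" if p: "p \<noteq> (0, 0)" for p
  proof -
    let ?x = "- (of_int (fst p) * a + of_int (snd p) * b)"
    have w: "wt p ^ 3 \<ge> 1" using wt_ge_1 by (intro one_le_power)
    have "m p = 1 - exp (2 * of_real pi * \<i> * of_real ?x)"
      unfolding m_def chr_def by (simp add: exp_add[symmetric] algebra_simps)
    moreover have "norm (1 - exp (2 * of_real pi * \<i> * of_real ?x)) \<ge> 2 * (c1 / wt p ^ 3)"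
    proof (rule norm_one_minus_exp)
      fix j :: int
      have "c1 / wt p ^ 3 \<le> c0 / wt p ^ 3" using c1 w wt_ge_1[of p] by (intro divide_right_mono) auto
      also have "\<dots> \<le> \<bar>of_int (fst p) * a + of_int (snd p) * b - of_int (- j)\<bar>"
        using c0(2)[of "fst p" "snd p" "- j"] p by (cases p) (auto simp: wt_def)
      also have "\<dots> = \<bar>?x - of_int j\<bar>" by simp
      finally show "c1 / wt p ^ 3 \<le> \<bar>?x - of_int j\<bar>" .
      have "c1 / wt p ^ 3 \<le> c1 / 1" using c1 w wt_ge_1[of p] by (intro divide_left_mono) auto
      then show "c1 / wt p ^ 3 \<le> 1/2" using c1 by linarith
    qed
    ultimately show ?thesis by simp
  qed
  have um: "u p * m p = coef g p" for p
  proof (cases "p = (0, 0)")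
    case False
    have "0 < 2 * (c1 / wt p ^ 3)" using c1 wt_ge_1[of p] by simp
    then have "m p \<noteq> 0" using m[OF False] by auto
    then show ?thesis by (simp add: u_def)
  qed (simp add: u_def g0)
  have ru: "rapid u"
  proof (rule rapid_mono[OF coef_rapid[OF g], where K="1 / c1" and m=3])
    fix p
    show "norm (u p) \<le> 1 / c1 * wt p ^ 3 * norm (coef g p)"
    proof (cases "p = (0, 0)")
      case False
      have pos: "0 < c1 / wt p ^ 3" using c1 wt_ge_1[of p] by simp
      have "c1 / wt p ^ 3 \<le> norm (m p)" using m[OF False] pos by linarith
      then have "norm (coef g p) / norm (m p) \<le> norm (coef g p) / (c1 / wt p ^ 3)"
        by (intro divide_left_mono mult_pos_pos) (use pos \<open>c1 / wt p ^ 3 \<le> norm (m p)\<close> norm_ge_zero[of "coef g p"] in linarith)+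
      then show ?thesis by (simp add: u_def norm_divide mult_ac)
    qed (simp add: u_def g0)
  qed (use c1 in auto)
  have "fser u t y - fser u (t - a) (y - b) = f t y - c" for t y
  proof -
    have "(\<lambda>n. u (idx n) * (chr (fst (idx n)) t * chr (snd (idx n)) y)
        - u (idx n) * (chr (fst (idx n)) (t - a) * chr (snd (idx n)) (y - b))) sums (fser u t y - fser u (t - a) (y - b))"
      by (intro sums_diff fser_sums ru)
    moreover have "u p * (chr (fst p) t * chr (snd p) y) - u p * (chr (fst p) (t - a) * chr (snd p) (y - b))
        = coef g p * (chr (fst p) t * chr (snd p) y)" for p
      using chr_add(2)[of "fst p" t "- a"] chr_add(2)[of "snd p" y "- b"]
      unfolding um[symmetric] m_def by (simp add: algebra_simps)
    ultimately have "(\<lambda>n. coef g (idx n) * (chr (fst (idx n)) t * chr (snd (idx n)) y)) sums (fser u t y - fser u (t - a) (y - b))"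
      by simp
    with fser_sums[OF coef_rapid[OF g]] have "fser u t y - fser u (t - a) (y - b) = fser (coef g) t y"
      using sums_unique2 by blast
    then show ?thesis using fourier_inversion[OF g] by (simp add: g_def)
  qed
  moreover have "per2 (fser u)" by (simp add: per2_def fser_def chr_periodic)
  ultimately show ?thesis using that fser_smooth2[OF ru] by blast
qed

section \<open>Quasi-periodic functions and the shift operator\<close>

lemma continuous_on_smooth2_slice: "smooth2 f \<Longrightarrow> continuous_on S (f t)"
  by (rule continuous_on_slice2[OF smooth2_continuous])

text \<open>The symmetry of a Zak transform with periods 2 and 1. Its inverse is
  \<open>zint\<close>: the values \<open>zint G (t + 2 * j)\<close> are the Fourier coefficients of
  the slice \<open>G t\<close>.\<close>

definition zak_class :: "(real \<Rightarrow> real \<Rightarrow> complex) \<Rightarrow> bool" where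
  "zak_class G \<longleftrightarrow> smooth2 G \<and> (\<forall>t y. G (t + 2) y = chr 1 y * G t y) \<and> (\<forall>t y. G t (y + 1) = G t y)"

lemma zak_class_shift:
  assumes "zak_class G" shows "G (t + 2 * of_int j) y = chr j y * G t y"
proof -
  have p: "G (t + 2 * of_nat n) y = chr (int n) y * G t y" for n t
  proof (induction n)
    case (Suc n)
    have "G (t + 2 * of_nat (Suc n)) y = G ((t + 2 * of_nat n) + 2) y" by (simp add: algebra_simps)
    also have "\<dots> = chr 1 y * (chr (int n) y * G t y)" using assms Suc by (simp add: zak_class_def)
    finally show ?case using chr_add(1)[of 1 "int n" y] by (simp add: mult.assoc)
  qed simp
  show ?thesis
  proof (cases "j \<ge> 0")
    case True
    then show ?thesis using p[of t "nat j"] by simp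
  next
    case False
    have "G t y = chr (- j) y * G (t + 2 * of_int j) y"
      using p[of "t + 2 * of_int j" "nat (- j)"] False by simp
    then have "chr j y * G t y = chr j y * chr (- j) y * G (t + 2 * of_int j) y" by (simp add: mult.assoc)
    also have "chr j y * chr (- j) y = 1" using chr_add(1)[of j "- j" y] by simp
    finally show ?thesis by simp
  qed
qed

lemma dt_shift:
  assumes "smooth2 G" shows "dt (\<lambda>t y. G (t + a) (y + b)) t y = dt G (t + a) (y + b)"
proof -
  have "((\<lambda>s. s + a) has_real_derivative 1) (at t)" by (auto intro!: derivative_eq_intros)
  from vector_diff_chain_at[OF this[unfolded has_real_derivative_iff_has_vector_derivative] smooth2_dt_deriv[OF assms]]
  have "((\<lambda>s. G (s + a) (y + b)) has_vector_derivative dt G (t + a) (y + b)) (at t)" by (simp add: o_def)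
  then show ?thesis unfolding dt_def[of "\<lambda>t y. G (t + a) (y + b)"] by (rule vector_derivative_at)
qed

lemma zak_class_dt: assumes "zak_class G" shows "zak_class (dt G)"
proof -
  have s: "smooth2 G" using assms by (simp add: zak_class_def)
  have "dt G (t + 2) y = chr 1 y * dt G t y" for t y
  proof -
    have "((\<lambda>t. chr 1 y * G t y) has_vector_derivative chr 1 y * dt G t y) (at t)"
      by (intro has_vector_derivative_mult_right smooth2_dt_deriv s)
    moreover have "(\<lambda>t. chr 1 y * G t y) = (\<lambda>t. G (t + 2) (y + 0))" using assms by (auto simp: zak_class_def)
    ultimately show ?thesis
      using dt_shift[OF s, of 2 0 t y] by (simp add: dt_def vector_derivative_at)
  qed
  moreover have "dt G t (y + 1) = dt G t y" for t y
    using assms by (simp add: dt_def zak_class_def)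
  ultimately show ?thesis using smooth2_dt[OF s] by (simp add: zak_class_def)
qed

definition zint :: "(real \<Rightarrow> real \<Rightarrow> complex) \<Rightarrow> real \<Rightarrow> complex" where
  "zint G t = integral {0..1} (G t)"

text \<open>For an antiderivative \<open>A\<close>, periodicity makes the derivative of
  \<open>A (x + 1) - A x\<close> zero, so integrals over intervals of length one agree.\<close>

lemma periodic_integral_shift:
  fixes f :: "real \<Rightarrow> complex"
  assumes c: "\<And>S. continuous_on S f" and p: "\<And>y. f (y + 1) = f y"
  shows "integral {0..1} (\<lambda>y. f (y - b)) = integral {0..1} f"
proof -
  define M where "M = \<bar>b\<bar> + 3"
  define A where "A x = integral {- M..x} f" for x
  have A: "(A has_vector_derivative f x) (at x within T)" if "x \<in> {- M<..<M}" for x T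
  proof -
    have "(A has_vector_derivative f x) (at x within {- M..M})"
      unfolding A_def[abs_def] using that by (intro integral_has_vector_derivative c) auto
    moreover have "at x within {- M..M} = at x" using that by (intro at_within_interior) auto
    ultimately show ?thesis using has_vector_derivative_at_within by metis
  qed
  have sh: "((\<lambda>x. A (x + d)) has_vector_derivative f (x + d)) (at x within T)" if "x + d \<in> {- M<..<M}" for x d T
  proof -
    have "((\<lambda>s. s + d) has_real_derivative 1) (at x)" by (auto intro!: derivative_eq_intros)
    from vector_diff_chain_at[OF this[unfolded has_real_derivative_iff_has_vector_derivative] A[OF that]]
    have "((\<lambda>x. A (x + d)) has_vector_derivative f (x + d)) (at x)" by (simp add: o_def)
    then show ?thesis by (rule has_vector_derivative_at_within)
  qed
  let ?S = "{- \<bar>b\<bar> - 1..\<bar>b\<bar> + 1}"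
  have z: "((\<lambda>x. A (x + 1) - A (x + 0)) has_vector_derivative 0) (at x within ?S)" if "x \<in> ?S" for x
  proof -
    have "((\<lambda>x. A (x + 1) - A (x + 0)) has_vector_derivative f (x + 1) - f (x + 0)) (at x within ?S)"
      by (intro has_vector_derivative_diff sh) (use that in \<open>auto simp: M_def\<close>)
    then show ?thesis by (simp add: p)
  qed
  obtain k where "\<And>x. x \<in> ?S \<Longrightarrow> A (x + 1) - A (x + 0) = k"
    using has_vector_derivative_zero_constant[OF convex_real_interval(5) z] by blast
  then have k: "\<And>x. x \<in> ?S \<Longrightarrow> A (x + 1) - A x = k" by simp
  have int: "integral {0..1} (\<lambda>y. f (y + d)) = A (1 + d) - A (0 + d)" if "\<bar>d\<bar> \<le> \<bar>b\<bar>" for d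
    by (rule integral_unique, rule fundamental_theorem_of_calculus, simp, rule sh) (use that in \<open>auto simp: M_def\<close>)
  show ?thesis
  proof -
    have "- b \<in> ?S" "0 \<in> ?S" unfolding atLeastAtMost_iff by linarith+
    from this[THEN k] show ?thesis using int[of "- b"] int[of 0] by (simp add: add.commute)
  qed
qed

lemma integral_dy_chr:
  assumes s: "smooth2 g" and p: "\<And>t y. g t (y + 1) = g t y"
  shows "integral {0..1} (\<lambda>y. dy g t y * chr j y) = - (2 * of_real pi * \<i> * of_int j) * integral {0..1} (\<lambda>y. g t y * chr j y)"
proof -
  have d: "((\<lambda>y. g t y * chr j y) has_vector_derivative g t y * (2 * of_real pi * \<i> * of_int j * chr j y) + dy g t y * chr j y) (at y within {0..1})" for y
    by (rule has_vector_derivative_at_within) (intro has_vector_derivative_mult smooth2_dy_deriv[OF s] chr_deriv)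
  have "((\<lambda>y. g t y * (2 * of_real pi * \<i> * of_int j * chr j y) + dy g t y * chr j y) has_integral (g t 1 * chr j 1 - g t 0 * chr j 0)) {0..1}"
    by (rule fundamental_theorem_of_calculus) (auto intro: d)
  moreover have "g t 1 = g t 0" using p[of t 0] by simp
  ultimately have z: "integral {0..1} (\<lambda>y. g t y * (2 * of_real pi * \<i> * of_int j * chr j y) + dy g t y * chr j y) = 0"
    by (simp add: integral_unique)
  have c: "continuous_on {0..1} (g t)" "continuous_on {0..1} (dy g t)"
    by (intro continuous_on_smooth2_slice s smooth2_dy)+
  have "integral {0..1} (\<lambda>y. g t y * (2 * of_real pi * \<i> * of_int j * chr j y) + dy g t y * chr j y)
    = integral {0..1} (\<lambda>y. (2 * of_real pi * \<i> * of_int j) * (g t y * chr j y)) + integral {0..1} (\<lambda>y. dy g t y * chr j y)"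
    by (subst integral_add[symmetric]) (auto intro!: integrable_continuous_interval continuous_intros c simp: mult_ac)
  with z show ?thesis by (simp add: eq_neg_iff_add_eq_0 add.commute)
qed

lemma zint_coeff_decay:
  assumes "smooth2 g" "\<And>t y. g t (y + 1) = g t y"
  shows "\<exists>C. \<forall>t\<in>{0..2}. \<forall>j::int. norm (integral {0..1} (\<lambda>y. g t y * chr j y)) * \<bar>of_int j\<bar> ^ k \<le> C"
  using assms
proof (induction k arbitrary: g)
  case 0
  have "bounded ((\<lambda>p. g (fst p) (snd p)) ` ({0..2} \<times> {0..1}))"
    by (intro compact_imp_bounded compact_continuous_image compact_Times)
      (use smooth2_continuous[OF 0(1)] continuous_on_subset in auto)
  then obtain B where B: "\<forall>x\<in>(\<lambda>p. g (fst p) (snd p)) ` ({0..2} \<times> {0..1}). norm x \<le> B" unfolding bounded_pos by blast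
  have "norm (integral {0..1} (\<lambda>y. g t y * chr j y)) \<le> B * (1 - 0)" if "t \<in> {0..2}" for t j
  proof (rule integral_bound)
    show "continuous_on {0..1} (\<lambda>y. g t y * chr j y)"
      by (intro continuous_intros continuous_on_slice2[OF smooth2_continuous[OF 0(1)]])
    show "norm (g t y * chr j y) \<le> B" if y: "y \<in> {0..1}" for y
      using B y \<open>t \<in> {0..2}\<close> by (force simp: norm_mult)
  qed simp
  then show ?case by (intro exI[of _ B]) auto
next
  case (Suc k)
  have "dy g t (y + 1) = dy g t y" for t y
  proof -
    have "((\<lambda>s. s + 1) has_real_derivative 1) (at y)" by (auto intro!: derivative_eq_intros)
    from vector_diff_chain_at[OF this[unfolded has_real_derivative_iff_has_vector_derivative] smooth2_dy_deriv[OF Suc.prems(1)]]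
    have "((\<lambda>s. g t (s + 1)) has_vector_derivative dy g t (y + 1)) (at y)" by (simp add: o_def)
    then show ?thesis using smooth2_dy_deriv[OF Suc.prems(1), of t y] vector_derivative_unique_at
      unfolding Suc.prems(2) by blast
  qed
  from Suc.IH[OF smooth2_dy this] Suc.prems obtain C where
    C: "\<And>t j. t \<in> {0..2} \<Longrightarrow> norm (integral {0..1} (\<lambda>y. dy g t y * chr j y)) * \<bar>of_int j\<bar> ^ k \<le> C" by blast
  have "norm (integral {0..1} (\<lambda>y. g t y * chr j y)) * \<bar>of_int j\<bar> ^ Suc k \<le> C" if t: "t \<in> {0..2}" for t j
  proof -
    let ?I = "norm (integral {0..1} (\<lambda>y. g t y * chr j y))"
    have "?I * \<bar>of_int j\<bar> * 1 \<le> ?I * \<bar>of_int j\<bar> * (2 * pi)"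
      using pi_ge_two by (intro mult_left_mono) auto
    also have "\<dots> = norm (integral {0..1} (\<lambda>y. dy g t y * chr j y))"
      unfolding integral_dy_chr[OF Suc.prems] by (simp add: norm_mult)
    finally have "?I * \<bar>of_int j\<bar> * \<bar>of_int j\<bar> ^ k \<le> norm (integral {0..1} (\<lambda>y. dy g t y * chr j y)) * \<bar>of_int j\<bar> ^ k"
      by (intro mult_right_mono) auto
    then show ?thesis using C[OF t, of j] by (simp add: mult.assoc)
  qed
  then show ?case by blast
qed

text \<open>With \<open>t = t0 + 2 * j\<close> and \<open>t0\<close> in \<open>[0, 2]\<close>, the
  value at \<open>t\<close> is a Fourier coefficient of index \<open>j\<close> of the slice at
  \<open>t0\<close>, and these decay in \<open>j\<close> uniformly in \<open>t0\<close>.\<close>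

lemma zint_decay:
  assumes "zak_class G"
  shows "\<exists>C. \<forall>t. \<bar>t\<bar> ^ k * norm (zint G t) \<le> C"
proof -
  have G: "smooth2 G" "\<And>t y. G t (y + 1) = G t y" using assms by (auto simp: zak_class_def)
  obtain C0 where C0: "\<And>t j. t \<in> {0..2} \<Longrightarrow> norm (integral {0..1} (\<lambda>y. G t y * chr j y)) * \<bar>of_int j\<bar> ^ 0 \<le> C0"
    using zint_coeff_decay[OF G] by blast
  obtain C1 where C1: "\<And>t j. t \<in> {0..2} \<Longrightarrow> norm (integral {0..1} (\<lambda>y. G t y * chr j y)) * \<bar>of_int j\<bar> ^ k \<le> C1"
    using zint_coeff_decay[OF G] by blast
  have "\<bar>t\<bar> ^ k * norm (zint G t) \<le> 4 ^ k * (C0 + C1)" for t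
  proof -
    define j where "j = \<lfloor>t / 2\<rfloor>"
    define t0 where "t0 = t - 2 * of_int j"
    have t0: "t0 \<in> {0..2}" unfolding t0_def j_def by (simp, linarith)
    have "t = t0 + 2 * of_int j" by (simp add: t0_def)
    then have z: "zint G t = integral {0..1} (\<lambda>y. G t0 y * chr j y)"
      unfolding zint_def using zak_class_shift[OF assms, of t0 j] by (metis (no_types, lifting) mult.commute integral_cong)
    define m where "m = max 1 \<bar>of_int j :: real\<bar>"
    have "\<bar>t\<bar> \<le> 4 * m" using t0 \<open>t = t0 + 2 * of_int j\<close> by (auto simp: m_def)
    then have "\<bar>t\<bar> ^ k \<le> (4 * m) ^ k" by (intro power_mono) auto
    also have "\<dots> \<le> 4 ^ k * (1 + \<bar>of_int j\<bar> ^ k)"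
      unfolding power_mult_distrib by (intro mult_left_mono) (auto simp: m_def max_def)
    finally have "\<bar>t\<bar> ^ k * norm (zint G t) \<le> (4 ^ k * (1 + \<bar>of_int j\<bar> ^ k)) * norm (zint G t)"
      by (intro mult_right_mono) auto
    also have "\<dots> = 4 ^ k * (norm (zint G t) + norm (zint G t) * \<bar>of_int j\<bar> ^ k)" by (simp add: algebra_simps)
    also have "\<dots> \<le> 4 ^ k * (C0 + C1)"
      using C0[OF t0, of j] C1[OF t0, of j] unfolding z by (intro mult_left_mono) auto
    finally show ?thesis .
  qed
  then show ?thesis by blast
qed

lemma nth_vderiv_zint:
  assumes "zak_class G"
  shows "\<exists>F. zak_class F \<and> nth_vderiv n (zint G) = zint F"
proof (induction n)
  case 0 then show ?case using assms by (auto simp: nth_vderiv_def)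
next
  case (Suc n)
  then obtain F where F: "zak_class F" "nth_vderiv n (zint G) = zint F" by blast
  have "nth_vderiv (Suc n) (zint G) = (\<lambda>t. vector_derivative (zint F) (at t))"
    using F(2) by (simp add: nth_vderiv_def)
  also have "\<dots> = zint (dt F)"
  proof
    fix t
    have "smooth2 F" using F(1) by (simp add: zak_class_def)
    from smooth2_integral_deriv[OF this, of t] show "vector_derivative (zint F) (at t) = zint (dt F) t"
      unfolding zint_def[abs_def] by (rule vector_derivative_at)
  qed
  finally show ?case using zak_class_dt[OF F(1)] by blast
qed

lemma zint_schwartz:
  assumes "zak_class G" shows "schwartz (zint G)"
  unfolding schwartz_def
proof (intro conjI allI)
  fix n t
  obtain F where F: "zak_class F" "nth_vderiv n (zint G) = zint F" using nth_vderiv_zint[OF assms] by blast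
  have "smooth2 F" using F(1) by (simp add: zak_class_def)
  from differentiableI_vector[OF smooth2_integral_deriv[OF this]] show "nth_vderiv n (zint G) differentiable at t"
    unfolding F(2) by (simp add: zint_def[abs_def])
next
  fix k n
  obtain F where F: "zak_class F" "nth_vderiv n (zint G) = zint F" using nth_vderiv_zint[OF assms] by blast
  obtain C where "\<forall>t. \<bar>t\<bar> ^ k * norm (zint F t) \<le> C" using zint_decay[OF F(1)] by blast
  then show "bounded (range (\<lambda>t. t ^ k *\<^sub>R nth_vderiv n (zint G) t))"
    unfolding F(2) by (intro boundedI[where B=C]) (auto simp: power_abs)
qed

text \<open>Every Fourier coefficient of \<open>G t0\<close> is a value of \<open>zint G\<close>, so
  \<open>zint G = 0\<close> would force \<open>G t0 = 0\<close>.\<close>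

lemma zint_nonzero:
  assumes G: "zak_class G" and nz: "G t0 y0 \<noteq> 0"
  shows "\<exists>t. zint G t \<noteq> 0"
proof (rule ccontr)
  assume "\<not> ?thesis"
  then have z: "zint G t = 0" for t by blast
  have "orth (G t0)"
    unfolding orth_def
  proof (intro conjI allI)
    show "continuous_on UNIV (G t0)"
      using G by (intro continuous_on_smooth2_slice) (simp add: zak_class_def)
    fix n
    have "integral {0..1} (\<lambda>y. G t0 y * chr n y) = zint G (t0 + 2 * of_int n)"
      unfolding zint_def using zak_class_shift[OF G, of t0 n] by (metis (no_types, lifting) mult.commute integral_cong)
    then show "integral {0..1} (\<lambda>y. G t0 y * chr n y) = 0" using z by simp
  qed
  then have "G t0 y0 = 0" by (rule fourier_uniqueness) (use G in \<open>simp add: zak_class_def\<close>)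
  with nz show False by simp
qed

section \<open>The operator on quasi-periodic functions\<close>

locale shift_op =
  fixes al be :: real
begin

text \<open>Under \<open>zint\<close> the shift \<open>weyl al (be / 2)\<close> corresponds to \<open>WW\<close>, and \<open>trinomial_op\<close> applied after it to \<open>TT\<close>.\<close>

definition ph :: "real \<Rightarrow> complex" where "ph t = exp (of_real pi * \<i> * of_real (be * (t - al / 2)))"

definition WW :: "(real \<Rightarrow> real \<Rightarrow> complex) \<Rightarrow> real \<Rightarrow> real \<Rightarrow> complex" where
  "WW G t y = ph t * G (t - al) (y - be)"

definition TT :: "(real \<Rightarrow> real \<Rightarrow> complex) \<Rightarrow> real \<Rightarrow> real \<Rightarrow> complex" where
  "TT G t y = (1 + exp (of_real pi * \<i> * of_real t) / 2) * WW G t y + WW G (t - 1) y / 2"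

lemma smooth2_shift: "smooth2 G \<Longrightarrow> smooth2 (\<lambda>t y. G (t - a) (y - b))"
  using smooth2_translate[of G "- a" "- b"] by simp

lemma smooth2_expt: "smooth2 (\<lambda>t y. exp (of_real pi * \<i> * of_real (b * (t - a))))"
proof -
  have "smooth2 (\<lambda>t y. exp ((of_real pi * \<i> * of_real b) * of_real t + 0 * of_real y + - (of_real pi * \<i> * of_real (b * a))))"
    by (intro smooth2_exp smooth2_linear)
  then show ?thesis by (simp add: algebra_simps)
qed

lemma smooth2_TT: assumes "smooth2 G" shows "smooth2 (TT G)"
proof -
  have W: "smooth2 (\<lambda>t y. WW G t y)"
    unfolding WW_def ph_def by (intro smooth2_mult smooth2_expt smooth2_shift assms)
  have e: "smooth2 (\<lambda>t y. exp (of_real pi * \<i> * of_real t))" using smooth2_expt[of 1 0] by simp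
  have "smooth2 (\<lambda>t y. (1 + exp (of_real pi * \<i> * of_real t) * (1/2)) * WW G t y + WW G (t - 1) (y - 0) * (1/2))"
    by (intro smooth2_add smooth2_mult smooth2_const e W smooth2_shift[OF W])
  then show ?thesis by (simp add: TT_def[abs_def])
qed

lemma ph_add: "ph (t + s) = ph t * exp (of_real pi * \<i> * of_real (be * s))"
  by (simp add: ph_def exp_add[symmetric] algebra_simps)

lemma exp_two_pi_i: "exp (of_real pi * \<i> * 2) = (1 :: complex)"
  using exp_two_pi_i' by (simp add: mult_ac)

text \<open>When \<open>t\<close> grows by 2, \<open>ph\<close> gains the factor
  \<open>exp (2 * pi * \<i> * be)\<close>; the shift of \<open>y\<close> by \<open>be\<close> in
  \<open>WW\<close> is there to cancel it.\<close>

lemma zak_class_TT: assumes "zak_class G" shows "zak_class (TT G)"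
proof -
  have W2: "WW G (t + 2) y = chr 1 y * WW G t y" for t y
  proof -
    have "WW G (t + 2) y = ph t * exp (of_real pi * \<i> * of_real (be * 2)) * (chr 1 (y - be) * G (t - al) (y - be))"
      using assms unfolding WW_def ph_add by (metis diff_add_eq zak_class_def)
    moreover have "exp (of_real pi * \<i> * of_real (be * 2)) * chr 1 (y - be) = chr 1 y"
      by (simp add: chr_def exp_add[symmetric] algebra_simps)
    ultimately show ?thesis by (simp add: WW_def mult_ac)
  qed
  have e2: "exp (of_real pi * \<i> * of_real (t + 2)) = exp (of_real pi * \<i> * of_real t)" for t
    using exp_two_pi_i by (simp add: exp_add distrib_left)
  have "TT G (t + 2) y = chr 1 y * TT G t y" for t y
    using W2[of t y] W2[of "t - 1" y] unfolding TT_def e2 by (simp add: algebra_simps)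
  moreover have "TT G t (y + 1) = TT G t y" for t y
  proof -
    have "G s (y + 1 - be) = G s (y - be)" for s using assms unfolding zak_class_def by (metis add_diff_eq add.commute diff_add_eq)
    then show ?thesis by (simp add: TT_def WW_def)
  qed
  ultimately show ?thesis using smooth2_TT assms by (simp add: zak_class_def)
qed

lemma TT_lin: "TT (\<lambda>t y. a * G t y + b * H t y) = (\<lambda>t y. a * TT G t y + b * TT H t y)"
  by (intro ext) (simp add: TT_def WW_def field_simps)

lemma zak_class_lin:
  assumes "zak_class G" "zak_class H" shows "zak_class (\<lambda>t y. a * G t y + b * H t y)"
  using assms by (auto simp: zak_class_def algebra_simps intro!: smooth2_intros)

text \<open>\<open>TT\<close> evaluates its argument at \<open>t - al\<close> and
  \<open>t - 1 - al\<close> only, and a function of period one in \<open>t\<close> takes the same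
  value at both.\<close>

lemma TT_mult_periodic:
  assumes "\<And>t y. \<psi> (t + 1) y = \<psi> t y"
  shows "TT (\<lambda>t y. \<psi> t y * G t y) t y = \<psi> (t - al) (y - be) * TT G t y"
proof -
  have "\<psi> (t - 1 - al) (y - be) = \<psi> (t - al) (y - be)" using assms[of "t - 1 - al" "y - be"] by (simp add: algebra_simps)
  then show ?thesis by (simp add: TT_def WW_def algebra_simps)
qed

text \<open>Given an eigenfunction of the cube, project onto the eigenspaces of the three cube roots; the
  three projections add up to a nonzero multiple of the given function.\<close>

lemma eigenfunction_from_cube:
  assumes G: "zak_class G" "G t0 y0 \<noteq> 0" and cube: "\<And>t y. TT (TT (TT G)) t y = L * G t y" and L: "L \<noteq> 0"
  shows "\<exists>F l t y. zak_class F \<and> F t y \<noteq> 0 \<and> l \<noteq> 0 \<and> (\<forall>t y. TT F t y = l * F t y)"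
proof -
  define l0 where "l0 = exp (Ln L / 3)"
  have l0: "l0 ^ 3 = L" using L by (simp add: l0_def exp_of_nat_mult[symmetric])
  then have l0nz: "l0 \<noteq> 0" using L by auto
  define z where "z = cis (2 * pi / 3)"
  have z3: "z ^ 3 = 1" unfolding z_def Complex.DeMoivre by simp
  have zs: "1 + z + z^2 = 0"
  proof -
    have "(z - 1) * (1 + z + z^2) = z ^ 3 - 1" by (simp add: algebra_simps power2_eq_square power3_eq_cube)
    moreover have "z \<noteq> 1"
    proof
      assume "z = 1"
      then have "cos (2 * pi / 3) = 1" by (simp add: z_def complex_eq_iff)
      moreover have "cos (2 * pi / 3) = - 1/2" by (rule cos_120)
      ultimately show False by simp
    qed
    ultimately show ?thesis using z3 by simp
  qed
  define T1 where "T1 = TT G"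
  define T2 where "T2 = TT T1"
  have T3: "TT T2 = (\<lambda>t y. L * G t y)" using cube by (auto simp: T2_def T1_def)
  \<comment> \<open>\<open>T^2 + l * T + l^2\<close> is the quotient of \<open>T^3 - L\<close> by
    \<open>T - l\<close>, so \<open>T - l\<close> annihilates its value on \<open>G\<close>. The
    factors 1 give it the shape of \<open>TT_lin\<close>.\<close>
  define F where "F l = (\<lambda>t y. 1 * (1 * T2 t y + l * T1 t y) + l^2 * G t y)" for l
  have TF: "TT (F l) t y = l * F l t y" if "l ^ 3 = L" for l t y
    unfolding F_def TT_lin T3 T2_def[symmetric] T1_def[symmetric]
    using that by (simp add: algebra_simps power2_eq_square power3_eq_cube flip: that)
  have zF: "zak_class (F l)" for l
    unfolding F_def T1_def T2_def by (intro zak_class_lin zak_class_TT G)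
  have roots: "(l0 * z) ^ 3 = L" "(l0 * z^2) ^ 3 = L"
  proof -
    show "(l0 * z) ^ 3 = L" by (simp add: power_mult_distrib z3 l0)
    have "(z^2) ^ 3 = (z^3)^2" by (simp flip: power_mult)
    then show "(l0 * z^2) ^ 3 = L" by (simp add: power_mult_distrib z3 l0)
  qed
  have "F l0 t y + z * F (l0 * z) t y + z^2 * F (l0 * z^2) t y = 3 * l0^2 * G t y" for t y
    unfolding F_def using zs z3 by algebra
  then have "F l0 t0 y0 + z * F (l0 * z) t0 y0 + z^2 * F (l0 * z^2) t0 y0 \<noteq> 0" using G(2) l0nz by simp
  then have "F l0 t0 y0 \<noteq> 0 \<or> F (l0 * z) t0 y0 \<noteq> 0 \<or> F (l0 * z^2) t0 y0 \<noteq> 0" by auto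
  then obtain l where l: "l ^ 3 = L" "F l t0 y0 \<noteq> 0" using l0 roots by blast
  then have "l \<noteq> 0" using L by auto
  with TF[OF l(1)] zF l(2) show ?thesis by blast
qed

text \<open>Integration over a full period in \<open>y\<close> does not see the shift of
  \<open>y\<close> by \<open>be\<close>.\<close>

lemma zint_eigenfunction:
  assumes F: "zak_class F" and ev: "\<And>t y. TT F t y = l * F t y"
  shows "trinomial_op (weyl al (be / 2) (zint F)) t = l * zint F t"
proof -
  have c: "continuous_on S (F t)" for S t
    using F by (intro continuous_on_smooth2_slice) (simp add: zak_class_def)
  have w: "weyl al (be / 2) (zint F) t = integral {0..1} (WW F t)" for t
  proof -
    have "integral {0..1} (\<lambda>y. F (t - al) (y - be)) = integral {0..1} (F (t - al))"
      by (rule periodic_integral_shift[OF c]) (use F in \<open>simp add: zak_class_def\<close>)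
    moreover have "2 * complex_of_real pi * \<i> * complex_of_real (be / 2 * (t - al / 2)) = of_real pi * \<i> * of_real (be * (t - al / 2))"
      by simp
    ultimately show ?thesis
      unfolding weyl_def WW_def zint_def ph_def by (simp only: integral_mult_right)
  qed
  have cW: "continuous_on {0..1} (WW F t)" for t
  proof -
    have "continuous_on {0..1} (\<lambda>y. F (t - al) (y - be))"
      by (rule continuous_on_compose2[OF c[of UNIV]]) (auto intro!: continuous_intros)
    then show ?thesis unfolding WW_def by (intro continuous_on_mult continuous_on_const)
  qed
  have i: "(\<lambda>y. a * WW F t y) integrable_on {0..1}" for a t
    by (intro integrable_continuous_interval continuous_on_mult continuous_on_const cW)
  let ?e = "1 + exp (of_real pi * \<i> * of_real t) / 2"
  have "l * zint F t = integral {0..1} (TT F t)"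
    unfolding zint_def ev by simp
  also have "\<dots> = integral {0..1} (\<lambda>y. ?e * WW F t y + (1/2) * WW F (t - 1) y)"
    by (simp add: TT_def[abs_def])
  also have "\<dots> = ?e * integral {0..1} (WW F t) + (1/2) * integral {0..1} (WW F (t - 1))"
    by (subst integral_add[OF i i]) (simp only: integral_mult_right)
  also have "\<dots> = trinomial_op (weyl al (be / 2) (zint F)) t"
    unfolding w[symmetric] trinomial_op_def weyl_def[of 1 0] weyl_def[of 0 "1/2"] by (simp add: algebra_simps)
  finally show ?thesis by simp
qed

end

section \<open>A quasi-periodic bump function\<close>

text \<open>The parameter \<open>k\<close> makes the span of these functions closed under differentiation.\<close>

definition bumpf :: "nat \<Rightarrow> real \<Rightarrow> real" where
  "bumpf k x = (if x > 0 then (1 / x) ^ k * exp (- (1 / x)) else 0)"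

lemma power_le_fact_exp: "(u::real) \<ge> 0 \<Longrightarrow> u ^ n \<le> fact n * exp u"
proof -
  assume u: "u \<ge> 0"
  have "(\<Sum>i\<in>{n}. u ^ i /\<^sub>R fact i) \<le> (\<Sum>i. u ^ i /\<^sub>R fact i)"
    by (rule sum_le_suminf[OF summable_exp_generic]) (use u in auto)
  then have "u ^ n / fact n \<le> exp u" by (simp add: exp_def field_simps)
  then show ?thesis by (simp add: field_simps)
qed

text \<open>The square on the right makes the difference quotient at the origin tend to zero in
  \<open>bumpf_deriv\<close>.\<close>

lemma bumpf_le: "bumpf k x \<le> fact (k + 2) * x ^ 2" "bumpf k x \<ge> 0"
proof -
  show "bumpf k x \<ge> 0" by (simp add: bumpf_def)
  show "bumpf k x \<le> fact (k + 2) * x ^ 2"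
  proof (cases "x > 0")
    case True
    define u where "u = 1 / x"
    have u: "u > 0" "x = 1 / u" using True by (auto simp: u_def)
    have "u ^ k * exp (- u) = u ^ (k + 2) * exp (- u) * x ^ 2"
  proof -
      have "u * x = 1" using u by simp
      have "u ^ (k + 2) * exp (- u) * x ^ 2 = u ^ k * exp (- u) * (u * x) ^ 2"
        by (simp add: power_add power_mult_distrib power2_eq_square)
      then show ?thesis unfolding \<open>u * x = 1\<close> by simp
    qed
    also have "\<dots> \<le> fact (k + 2) * exp u * exp (- u) * x ^ 2"
      by (intro mult_right_mono power_le_fact_exp) (use u in auto)
    also have "fact (k + 2) * exp u * exp (- u) = fact (k + 2)" by (simp add: exp_minus)
    finally show ?thesis using True by (simp add: bumpf_def u_def)
  qed (simp add: bumpf_def)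
qed

lemma bumpf_deriv: "(bumpf k has_real_derivative bumpf (k + 2) x - of_nat k * bumpf (k + 1) x) (at x)"
proof (cases x "0::real" rule: linorder_cases)
  case less
  have "((\<lambda>x. 0) has_real_derivative 0) (at x)" by simp
  then have "(bumpf k has_real_derivative 0) (at x)"
    by (rule has_field_derivative_transform_within_open[of _ _ _ "{..<0}"]) (use less in \<open>auto simp: bumpf_def\<close>)
  then show ?thesis using less by (simp add: bumpf_def)
next
  case greater
  have "((\<lambda>x. (1 / x) ^ k * exp (- (1 / x))) has_real_derivative
      (1 / x) ^ (k + 2) * exp (- (1 / x)) - of_nat k * ((1 / x) ^ (k + 1) * exp (- (1 / x)))) (at x)"
  proof -
    have u: "((\<lambda>x. 1 / x) has_real_derivative - ((1 / x)^2)) (at x)"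
      using greater by (auto intro!: derivative_eq_intros simp: power2_eq_square)
    have e: "((\<lambda>x. exp (- (1 / x))) has_real_derivative exp (- (1 / x)) * (1 / x)^2) (at x)"
      using DERIV_fun_exp[OF DERIV_minus[OF u]] by simp
    have "((\<lambda>x. (1 / x) ^ k) has_real_derivative - (of_nat k * (1 / x) ^ (k + 1))) (at x)"
    proof (cases k)
      case (Suc m)
      show ?thesis using DERIV_power[OF u, of k] unfolding Suc by (rule DERIV_cong) (simp add: power2_eq_square power_add)
    qed simp
    from DERIV_mult[OF this e] show ?thesis
      by (rule DERIV_cong) (simp only: power_add, algebra)
    qed
  then have "(bumpf k has_real_derivative
      (1 / x) ^ (k + 2) * exp (- (1 / x)) - of_nat k * ((1 / x) ^ (k + 1) * exp (- (1 / x)))) (at x)"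
    by (rule has_field_derivative_transform_within_open[of _ _ _ "{0<..}"]) (use greater in \<open>auto simp: bumpf_def\<close>)
  then show ?thesis using greater by (simp add: bumpf_def)
next
  case equal
  have "((\<lambda>h. (bumpf k (0 + h) - bumpf k 0) / h) \<longlongrightarrow> 0) (at 0)"
  proof (rule Lim_null_comparison)
    show "\<forall>\<^sub>F h in at 0. norm ((bumpf k (0 + h) - bumpf k 0) / h) \<le> fact (k + 2) * \<bar>h\<bar>"
    proof (rule always_eventually, rule allI)
      fix h :: real
      have "norm ((bumpf k (0 + h) - bumpf k 0) / h) = bumpf k h / \<bar>h\<bar>"
        using bumpf_le(2)[of k h] by (simp add: bumpf_def)
      also have "\<dots> \<le> fact (k + 2) * h ^ 2 / \<bar>h\<bar>" by (intro divide_right_mono bumpf_le) auto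
      also have "\<dots> = fact (k + 2) * \<bar>h\<bar>" by (cases "h = 0") (auto simp: power2_eq_square abs_if)
      finally show "norm ((bumpf k (0 + h) - bumpf k 0) / h) \<le> fact (k + 2) * \<bar>h\<bar>" .
    qed
    have "((\<lambda>h. fact (k + 2) * \<bar>h\<bar>) \<longlongrightarrow> fact (k + 2) * \<bar>0::real\<bar>) (at 0)" by (intro tendsto_intros)
    then show "((\<lambda>h::real. fact (k + 2) * \<bar>h\<bar>) \<longlongrightarrow> (0::real)) (at 0)" by simp
  qed
  then show ?thesis unfolding equal DERIV_def by (simp add: bumpf_def)
qed

lemma Ck2_bump: "Ck2 n (\<lambda>t y. of_real (bumpf k (1 - (t - c)^2)))"
proof (induction n arbitrary: k)
  case 0
  have "continuous_on UNIV (bumpf k)"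
    by (rule continuous_at_imp_continuous_on) (auto intro: DERIV_isCont bumpf_deriv)
  then have "continuous_on UNIV (\<lambda>p::real \<times> real. bumpf k (1 - (fst p - c)^2))"
    by (rule continuous_on_compose2) (auto intro!: continuous_intros)
  then show ?case by (simp add: continuous_on_of_real)
next
  case (Suc n)
  let ?f1 = "\<lambda>t y. (of_real (bumpf (k + 2) (1 - (t - c)^2)) + (- of_nat k) * of_real (bumpf (k + 1) (1 - (t - c)^2)))
     * ((- 2) * of_real t + 0 * of_real y + 2 * of_real c) :: complex"
  show ?case
  proof (rule Ck2_SucI[where ft="?f1" and fy="\<lambda>t y. 0"])
    fix t y
    have "((\<lambda>t. bumpf k (1 - (t - c)^2)) has_real_derivative
       (bumpf (k + 2) (1 - (t - c)^2) - of_nat k * bumpf (k + 1) (1 - (t - c)^2)) * (- 2 * (t - c))) (at t)"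
      by (rule DERIV_chain2[OF bumpf_deriv]) (auto intro!: derivative_eq_intros)
    from has_vector_derivative_of_real[OF this, where 'a=complex]
    show "((\<lambda>t. of_real (bumpf k (1 - (t - c)^2))) has_vector_derivative ?f1 t y) (at t)"
      by (simp add: algebra_simps)
  next
    show "Ck2 n ?f1" by (intro Ck2_mult Ck2_add Ck2_const Ck2_linear Suc.IH)
    have "continuous_on UNIV (bumpf k)"
      by (rule continuous_at_imp_continuous_on) (auto intro: DERIV_isCont bumpf_deriv)
    then have "continuous_on UNIV (\<lambda>p::real \<times> real. bumpf k (1 - (fst p - c)^2))"
      by (rule continuous_on_compose2) (auto intro!: continuous_intros)
    then show "continuous_on UNIV (\<lambda>p::real \<times> real. of_real (bumpf k (1 - (fst p - c)^2)) :: complex)" by (simp add: continuous_on_of_real)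
  qed (auto intro: Ck2_const)
qed

text \<open>Serves \<open>Gh\<close>, whose range of summation depends on \<open>t\<close>: it is
  one fixed finite sum only locally.\<close>

lemma smooth2_local:
  assumes "\<And>t0. \<exists>g. smooth2 g \<and> (\<forall>t y. \<bar>t - t0\<bar> < 1 \<longrightarrow> f t y = g t y)"
  shows "smooth2 f"
proof (rule smooth2_coinduct[where P="\<lambda>f. \<forall>t0. \<exists>g. smooth2 g \<and> (\<forall>t y. \<bar>t - t0\<bar> < 1 \<longrightarrow> f t y = g t y)"])
  fix f :: "real \<Rightarrow> real \<Rightarrow> complex"
  assume l: "\<forall>t0. \<exists>g. smooth2 g \<and> (\<forall>t y. \<bar>t - t0\<bar> < 1 \<longrightarrow> f t y = g t y)"
  have op: "open {t::real. \<bar>t - t0\<bar> < 1}" for t0 by (intro open_Collect_less continuous_intros)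
  have op2: "open {p::real \<times> real. \<bar>fst p - t0\<bar> < 1}" for t0 by (intro open_Collect_less continuous_intros)
  have loc: "((\<lambda>t. f t y) has_vector_derivative dt g t y) (at t)" "(f t has_vector_derivative dy g t y) (at y)"
    if g: "smooth2 g" "\<forall>t y. \<bar>t - t0\<bar> < 1 \<longrightarrow> f t y = g t y" and t: "\<bar>t - t0\<bar> < 1" for g t0 t y
  proof -
    show "((\<lambda>t. f t y) has_vector_derivative dt g t y) (at t)"
      by (rule has_vector_derivative_transform_within_open[OF smooth2_dt_deriv[OF g(1)] op[of t0]]) (use g t in auto)
    have "f t = g t" using g t by auto
    then show "(f t has_vector_derivative dy g t y) (at y)" using smooth2_dy_deriv[OF g(1)] by simp
  qed
  have eq: "dt f t y = dt g t y" "dy f t y = dy g t y"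
    if g: "smooth2 g" "\<forall>t y. \<bar>t - t0\<bar> < 1 \<longrightarrow> f t y = g t y" and t: "\<bar>t - t0\<bar> < 1" for g t0 t y
    using loc[OF that] by (simp_all add: dt_def[of f] dy_def[of f] vector_derivative_at)
  have d: "((\<lambda>t. f t y) has_vector_derivative dt f t y) (at t)" "(f t has_vector_derivative dy f t y) (at y)" for t y
  proof -
    obtain g where g: "smooth2 g" "\<forall>s y. \<bar>s - t\<bar> < 1 \<longrightarrow> f s y = g s y" using l by blast
    have "\<bar>t - t\<bar> < 1" by simp
    from loc[OF g this] eq[OF g this] show "((\<lambda>t. f t y) has_vector_derivative dt f t y) (at t)" "(f t has_vector_derivative dy f t y) (at y)"
      by auto
  qed
  have c: "continuous_on UNIV (\<lambda>p. f (fst p) (snd p))"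
    unfolding continuous_on_eq_continuous_at[OF open_UNIV]
  proof
    fix p :: "real \<times> real"
    obtain g where g: "smooth2 g" "\<forall>s y. \<bar>s - fst p\<bar> < 1 \<longrightarrow> f s y = g s y" using l by blast
    have "continuous_on {q. \<bar>fst q - fst p\<bar> < 1} (\<lambda>p. g (fst p) (snd p))"
      using smooth2_continuous[OF g(1)] continuous_on_subset by blast
    then have "continuous_on {q. \<bar>fst q - fst p\<bar> < 1} (\<lambda>p. f (fst p) (snd p))"
      by (rule continuous_on_eq) (use g(2) in auto)
    then show "isCont (\<lambda>p. f (fst p) (snd p)) p"

      by (rule continuous_on_interior) (simp add: interior_open[OF op2])
  qed
  have P1: "\<forall>t0. \<exists>g. smooth2 g \<and> (\<forall>t y. \<bar>t - t0\<bar> < 1 \<longrightarrow> dt f t y = g t y)"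
    using l eq(1) smooth2_dt by metis
  have P2: "\<forall>t0. \<exists>g. smooth2 g \<and> (\<forall>t y. \<bar>t - t0\<bar> < 1 \<longrightarrow> dy f t y = g t y)"
    using l eq(2) smooth2_dy by metis
  show "continuous_on UNIV (\<lambda>p. f (fst p) (snd p)) \<and>
    (\<exists>f1 f2. (\<forall>t y. ((\<lambda>t. f t y) has_vector_derivative f1 t y) (at t)) \<and>
      (\<forall>t y. (f t has_vector_derivative f2 t y) (at y)) \<and>
      (\<forall>t0. \<exists>g. smooth2 g \<and> (\<forall>t y. \<bar>t - t0\<bar> < 1 \<longrightarrow> f1 t y = g t y)) \<and>
      (\<forall>t0. \<exists>g. smooth2 g \<and> (\<forall>t y. \<bar>t - t0\<bar> < 1 \<longrightarrow> f2 t y = g t y)))"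
    by (intro conjI c exI[of _ "dt f"] exI[of _ "dy f"] P1 P2 allI d)
qed (use assms in blast)

text \<open>A bump of radius 1. With centre 5/6, \<open>hb t\<close> and \<open>hb (t - 1)\<close>
  agree at \<open>t = 4/3\<close>, where \<open>- Ef t = 1\<close>. On the window from 5/6 to 11/6
  around that point, \<open>- Ef t\<close> runs through the right half of the unit circle.\<close>

definition hb :: "real \<Rightarrow> real" where "hb t = bumpf 0 (1 - (t - 5/6)^2)"

lemma hb_zero: "\<bar>t - 5/6\<bar> \<ge> 1 \<Longrightarrow> hb t = 0"
proof -
  assume "\<bar>t - 5/6\<bar> \<ge> 1"
  then have "1 \<le> (t - 5/6)^2" using abs_le_square_iff[of 1 "t - 5/6"] by simp
  then show ?thesis by (simp add: hb_def bumpf_def)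
qed

lemma hb_nonneg: "hb t \<ge> 0" by (simp add: hb_def bumpf_le)

lemma bumpf0_mono: "x \<le> y \<Longrightarrow> bumpf 0 x \<le> bumpf 0 y"
proof -
  assume xy: "x \<le> y"
  have "1 / y \<le> 1 / x" if "x > 0" using that xy by (intro divide_left_mono) auto
  then show ?thesis using xy by (auto simp: bumpf_def)
qed

lemma hb_mono: "\<bar>t - 5/6\<bar> \<le> \<bar>s - 5/6\<bar> \<Longrightarrow> hb s \<le> hb t"
  unfolding hb_def by (rule bumpf0_mono) (simp add: abs_le_square_iff)

lemma hb_ge: "\<bar>t - 5/6\<bar> \<le> 1/2 \<Longrightarrow> hb t \<ge> 1/9"
proof -
  assume "\<bar>t - 5/6\<bar> \<le> 1/2"
  then have "hb (5/6 + 1/2) \<le> hb t" by (intro hb_mono) simp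
  moreover have "hb (5/6 + 1/2) = exp (- (4/3))" by (simp add: hb_def bumpf_def power2_eq_square)
  moreover have "exp (- (4/3)) \<ge> exp (- 2 :: real)" by simp
  moreover have "exp (- 2 :: real) \<ge> 1/9"
  proof -
    have "exp (2::real) = exp 1 * exp 1" by (simp flip: exp_add)
    also have "\<dots> \<le> 3 * 3" using exp_le by (intro mult_mono) auto
    finally show ?thesis by (simp add: exp_minus field_simps)
  qed
  ultimately show ?thesis by linarith
qed

lemma hb_lipschitz: "\<bar>t - 5/6\<bar> \<le> 3 \<Longrightarrow> \<bar>s - 5/6\<bar> \<le> 3 \<Longrightarrow> \<bar>hb t - hb s\<bar> \<le> 12 * \<bar>t - s\<bar>"
proof -
  assume ts: "\<bar>t - 5/6\<bar> \<le> 3" "\<bar>s - 5/6\<bar> \<le> 3"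
  have "norm (bumpf 0 x - bumpf 0 y) \<le> 2 * norm (x - y)" for x y
  proof (rule field_differentiable_bound[of UNIV])
    fix x :: real
    show "(bumpf 0 has_field_derivative bumpf 2 x) (at x within UNIV)" using bumpf_deriv[of 0 x] by (simp add: numeral_2_eq_2)
    show "norm (bumpf 2 x) \<le> 2"
    proof (cases "x > 0")
      case True
      have "(1 / x) ^ 2 * exp (- (1 / x)) \<le> fact 2 * exp (1 / x) * exp (- (1 / x))"
        using True by (intro mult_right_mono power_le_fact_exp) auto
      also have "fact 2 * exp (1 / x) * exp (- (1 / x)) = 2" using True by (simp add: exp_minus fact_numeral)
      finally have "(1 / x) ^ 2 * exp (- (1 / x)) \<le> 2" .
      then show ?thesis using True by (simp add: bumpf_def)
    qed (simp add: bumpf_def)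
  qed auto
  then have "\<bar>hb t - hb s\<bar> \<le> 2 * \<bar>(1 - (t - 5/6)^2) - (1 - (s - 5/6)^2)\<bar>" by (simp only: hb_def real_norm_def)
  also have "(1 - (t - 5/6)^2) - (1 - (s - 5/6)^2) = (s - t) * ((t - 5/6) + (s - 5/6))"
    by (simp add: power2_eq_square field_simps)
  also have "2 * \<bar>(s - t) * ((t - 5/6) + (s - 5/6))\<bar> \<le> 2 * (\<bar>s - t\<bar> * 6)"
    unfolding abs_mult using ts abs_triangle_ineq[of "t - 5/6" "s - 5/6"] by (intro mult_left_mono) auto
  finally show ?thesis by (simp add: abs_minus_commute)
qed

section \<open>Quasi-periodisation of the bump\<close>

definition jset :: "real \<Rightarrow> int set" where "jset t = {j. \<bar>t + 2 * of_int j - 5/6\<bar> < 1}"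

text \<open>The sum over all translates by even integers, cut down to those that can be nonzero;
  \<open>chr (- j)\<close> produces the quasi-period.\<close>

definition Gh :: "real \<Rightarrow> real \<Rightarrow> complex" where
  "Gh t y = (\<Sum>j\<in>jset t. of_real (hb (t + 2 * of_int j)) * chr (- j) y)"

lemma jset_subset: "\<bar>t\<bar> \<le> of_int N \<Longrightarrow> N \<ge> 2 \<Longrightarrow> jset t \<subseteq> {- N..N}"
proof
  fix j assume "\<bar>t\<bar> \<le> of_int N" "N \<ge> 2" "j \<in> jset t"
  then have "2 * \<bar>of_int j :: real\<bar> < of_int N + 2" "(2::real) \<le> of_int N" by (auto simp: jset_def)
  then have "real_of_int \<bar>j\<bar> \<le> of_int N" by simp
  then have "\<bar>j\<bar> \<le> N" by (simp only: of_int_le_iff)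
  then show "j \<in> {- N..N}" by auto
qed

lemma Gh_sum: "finite K \<Longrightarrow> jset t \<subseteq> K \<Longrightarrow> Gh t y = (\<Sum>j\<in>K. of_real (hb (t + 2 * of_int j)) * chr (- j) y)"
  unfolding Gh_def by (rule sum.mono_neutral_left) (auto simp: jset_def hb_zero)

lemma finite_jset: "finite (jset t)"
proof (rule finite_subset[OF jset_subset])
  show "\<bar>t\<bar> \<le> of_int (max 2 \<lceil>\<bar>t\<bar>\<rceil>)" by (simp add: of_int_max le_max_iff_disj)
qed auto

lemma smooth2_Gh: "smooth2 Gh"
proof (rule smooth2_local)
  fix t0 :: real
  define N where "N = max 2 \<lceil>\<bar>t0\<bar> + 1\<rceil>"
  have N: "\<bar>t0\<bar> + 1 \<le> of_int N" "N \<ge> 2" unfolding N_def by (auto simp: of_int_max le_max_iff_disj)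
  define g where "g t y = (\<Sum>j\<in>{- N..N}. of_real (hb (t + of_int (2 * j))) * chr (- j) y)" for t y
  have h: "smooth2 (\<lambda>t y. of_real (hb t))" unfolding hb_def smooth2_def using Ck2_bump by blast
  have "smooth2 (\<lambda>t y. of_real (hb (t + of_int (2 * j))))" for j
    using smooth2_translate[OF h, of "of_int (2 * j)"] by simp
  then have "smooth2 g" unfolding g_def[abs_def] by (intro smooth2_intros)
  moreover have "Gh t y = g t y" if "\<bar>t - t0\<bar> < 1" for t y
    unfolding g_def using Gh_sum[of "{- N..N}" t y] jset_subset[of t N] N that by simp
  ultimately show "\<exists>g. smooth2 g \<and> (\<forall>t y. \<bar>t - t0\<bar> < 1 \<longrightarrow> Gh t y = g t y)" by blast
qed

lemma Gh_quasi_periodic: "Gh (t + 2) y = chr 1 y * Gh t y" "Gh t (y + 1) = Gh t y"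
proof -
  have "Gh t y = (\<Sum>j\<in>(\<lambda>j. j + 1) ` jset (t + 2). of_real (hb (t + 2 * of_int j)) * chr (- j) y)"
  proof (rule Gh_sum[OF finite_imageI[OF finite_jset]], rule subsetI)
    fix j assume "j \<in> jset t"
    then have "j - 1 \<in> jset (t + 2)" by (simp add: jset_def algebra_simps)
    then show "j \<in> (\<lambda>j. j + 1) ` jset (t + 2)" by (rule rev_image_eqI) simp
  qed
  also have "\<dots> = (\<Sum>j\<in>jset (t + 2). of_real (hb (t + 2 + 2 * of_int j)) * chr (- (j + 1)) y)"
    by (subst sum.reindex) (auto simp: algebra_simps)
  finally have "Gh t y = (\<Sum>j\<in>jset (t + 2). of_real (hb (t + 2 + 2 * of_int j)) * chr (- (j + 1)) y)" .
  then have "chr 1 y * Gh t y = (\<Sum>j\<in>jset (t + 2). of_real (hb (t + 2 + 2 * of_int j)) * (chr 1 y * chr (- (j + 1)) y))"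
    by (simp add: sum_distrib_left mult_ac)
  also have "\<dots> = Gh (t + 2) y"
    unfolding Gh_def chr_add(1)[symmetric] by simp
  finally show "Gh (t + 2) y = chr 1 y * Gh t y" by simp
  show "Gh t (y + 1) = Gh t y" by (simp add: Gh_def chr_periodic)
qed

text \<open>On the window every translate other than the central one vanishes. A shift by
  \<open>d\<close> brings in a neighbour, but only to order \<open>d\<close>, by the Lipschitz
  bound.\<close>

lemma Gh_window:
  assumes t: "5/6 \<le> t" "t \<le> 11/6" and d: "\<bar>d\<bar> \<le> 1/1000"
  shows "norm (Gh (t - d) y - of_real (hb t)) \<le> 24 * \<bar>d\<bar>" "norm (Gh (t - d - 1) y - of_real (hb (t - 1))) \<le> 24 * \<bar>d\<bar>"
proof -
  have small: "\<bar>hb (t - d + m)\<bar> \<le> 12 * \<bar>d\<bar>" if "hb (t + m) = 0" "m = 1 \<or> m = - 2" for m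
  proof -
    have "\<bar>t - d + m - 5/6\<bar> \<le> 3" "\<bar>t + m - 5/6\<bar> \<le> 3" using t d that(2) by linarith+
    from hb_lipschitz[OF this] show ?thesis using that(1) by simp
  qed
  have "jset (t - d) \<subseteq> {0, - 1}"
  proof
    fix j assume "j \<in> jset (t - d)"
    then have "of_int j > (-2 :: real)" "of_int j < (1 :: real)" using t d by (auto simp: jset_def)
    then have "j > -2" "j < 1" by linarith+
    then show "j \<in> {0, - 1}" by auto
  qed
  then have "Gh (t - d) y = of_real (hb (t - d)) + of_real (hb (t - d - 2)) * chr 1 y"
    by (subst Gh_sum[of "{0, - 1}"]) auto
  moreover have "norm (of_real (hb (t - d)) - of_real (hb t) :: complex) \<le> 12 * \<bar>d\<bar>"
    using hb_lipschitz[of "t - d" t] t d by (simp flip: of_real_diff)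
  moreover have "norm (of_real (hb (t - d - 2)) * chr 1 y) \<le> 12 * \<bar>d\<bar>"
    using small[of "- 2"] hb_zero[of "t - 2"] t by (simp add: norm_mult)
  ultimately show "norm (Gh (t - d) y - of_real (hb t)) \<le> 24 * \<bar>d\<bar>"
    using norm_triangle_ineq[of "of_real (hb (t - d)) - of_real (hb t)" "of_real (hb (t - d - 2)) * chr 1 y"]
    by (simp add: algebra_simps)
  have "jset (t - d - 1) \<subseteq> {0, 1}"
  proof
    fix j assume "j \<in> jset (t - d - 1)"
    then have "of_int j > (-1 :: real)" "of_int j < (2 :: real)" using t d by (auto simp: jset_def)
    then have "j > -1" "j < 2" by linarith+
    then show "j \<in> {0, 1}" by auto
  qed
  then have "Gh (t - d - 1) y = of_real (hb (t - d - 1)) + of_real (hb (t - d + 1)) * chr (- 1) y"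
    by (subst Gh_sum[of "{0, 1}"]) (auto simp: add.commute)
  moreover have "norm (of_real (hb (t - d - 1)) - of_real (hb (t - 1)) :: complex) \<le> 12 * \<bar>d\<bar>"
    using hb_lipschitz[of "t - d - 1" "t - 1"] t d by (simp flip: of_real_diff)
  moreover have "norm (of_real (hb (t - d + 1)) * chr (- 1) y) \<le> 12 * \<bar>d\<bar>"
    using small[of 1] hb_zero[of "t + 1"] t unfolding norm_mult by simp
  ultimately show "norm (Gh (t - d - 1) y - of_real (hb (t - 1))) \<le> 24 * \<bar>d\<bar>"
    using norm_triangle_ineq[of "of_real (hb (t - d - 1)) - of_real (hb (t - 1))" "of_real (hb (t - d + 1)) * chr (- 1) y"]
    by (simp add: algebra_simps)
qed

section \<open>The eigenfunction\<close>

text \<open>Matrices with vanishing second column stand for vectors, and a matrix of rank one sends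
  all of them to one line.\<close>

lemma column_collinear:
  assumes "dt2 P = 0" "P * A \<noteq> 0" "m12 A = 0" "m22 A = 0" "m12 B = 0" "m22 B = 0"
  obtains k where "P * B = sc k * (P * A)"
proof -
  obtain p q r s where P: "P = Mat2 (p * r) (p * s) (q * r) (q * s)" using dt2_zeroE assms(1) .
  define a where "a = r * m11 A + s * m21 A"
  define b where "b = r * m11 B + s * m21 B"
  have A: "P * A = sc a * Mat2 p 0 q 0" and B: "P * B = sc b * Mat2 p 0 q 0"
    by (auto intro!: mat2_eqI simp: P a_def b_def assms algebra_simps)
  have "a \<noteq> 0" using assms(2) A by (auto simp: sc_simps)
  then have "P * B = sc (b / a) * (P * A)"
    unfolding A B by (auto intro!: mat2_eqI)
  then show ?thesis using that by blast
qed

lemma dt2_simps [simp]: "dt2 (sc c * A) = c^2 * dt2 A" "dt2 (adj A) = dt2 A" "dt2 (sc c) = c^2"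
  by (simp_all add: dt2_def power2_eq_square algebra_simps)

lemma dt2_diff_le:
  assumes "norm A \<le> N" "norm B \<le> N" "norm (A - B) \<le> d"
  shows "norm (dt2 A - dt2 B) \<le> 4 * N * d"
proof -
  have e: "norm (m11 A) \<le> N" "norm (m22 B) \<le> N" "norm (m12 A) \<le> N" "norm (m21 B) \<le> N"
    using norm_entries_le assms(1,2) order_trans by blast+
  have f: "norm (m11 A - m11 B) \<le> d" "norm (m22 A - m22 B) \<le> d" "norm (m12 A - m12 B) \<le> d" "norm (m21 A - m21 B) \<le> d"
    using norm_entries_le[of "A - B"] assms(3) by (auto intro: order_trans)
  have "norm (dt2 A - dt2 B) \<le> norm (m11 A * m22 A - m11 B * m22 B) + norm (m12 A * m21 A - m12 B * m21 B)"
    using norm_triangle_ineq4[of "m11 A * m22 A - m11 B * m22 B" "m12 A * m21 A - m12 B * m21 B"]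
    by (simp add: dt2_def algebra_simps)
  also have "\<dots> \<le> (N * d + N * d) + (N * d + N * d)"
    by (intro add_mono norm_mult_diff_le e f)
  finally show ?thesis by simp
qed

text \<open>Vectors of \<open>\<complex>\<^sup>2\<close> are stored in the first column of a matrix.\<close>

definition vec :: "(real \<Rightarrow> real \<Rightarrow> complex) \<Rightarrow> real \<Rightarrow> real \<Rightarrow> mat2" where
  "vec G t y = Mat2 (G t y) 0 (om * G (t - 1) y) 0"

lemma Xf_real: "Xf (of_real y) = om^2 * chr (- 1) y"
  by (simp add: Xf_def chr_def)

lemma zak_class_minus: "zak_class G \<Longrightarrow> G (t - 2) y = chr (- 1) y * G t y"
  using zak_class_shift[of G t "- 1" y] by simp

lemma vec_back:
  assumes "zak_class G" shows "vec G (t - 1) y = sc (1 / om) * (umat (Xf (of_real y)) * vec G t y)"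
proof -
  have "G (t - 1 - 1) y = chr (- 1) y * G t y" using zak_class_minus[OF assms, of t y] by simp
  then show ?thesis
    using om_facts(3) by (auto intro!: mat2_eqI simp: vec_def umat_def Xf_real power2_eq_square)
qed

locale cube = params al be e1 e2 + shift_op al be for al be e1 e2 :: real
begin

text \<open>The quotient of \<open>ph (t - 1)\<close> and \<open>ph t\<close>: the two entries of a
  vector pick up different phases under one shift.\<close>

definition "tw = Mat2 1 0 0 (exp (- (\<i> * of_real (pi * be))))"

lemma vec_TT:
  assumes "zak_class G"
  shows "vec (TT G) t y = sc (ph t) * (amat (1 / om) om (Xf (of_real y)) (Ef (of_real t)) * (tw * vec G (t - al) (y - be)))"
proof -
  let ?d = "exp (- (\<i> * of_real (pi * be)))"
  have oE: "om * Ef (of_real t) = exp (of_real pi * \<i> * of_real t)" using om_facts(3) by (simp add: Ef_def)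
  have p1: "ph (t - 1) = ph t * ?d" "ph (t - 2) = ph t * (?d * ?d)"
    using ph_add[of t "- 1"] ph_add[of t "- 2"] by (simp_all add: exp_add[symmetric] algebra_simps)
  have e1: "exp (of_real pi * \<i> * of_real (t - 1)) = - exp (of_real pi * \<i> * of_real t)"
  proof -
    have "om * Ef (of_real t - 1) = exp (of_real pi * \<i> * of_real (t - 1))" using om_facts(3) by (simp add: Ef_def)
    then show ?thesis unfolding XE_shift(4) using oE by simp
  qed
  have g: "G (t - 2 - al) (y - be) = chr (- 1) (y - be) * G (t - al) (y - be)"
    using zak_class_minus[OF assms, of "t - al" "y - be"] by (simp add: algebra_simps)
  have g1: "G (t - 1 - al) (y - be) = G (t - al - 1) (y - be)" by (simp add: algebra_simps)
  have c: "?d * ?d * chr (- 1) (y - be) = chr (- 1) y"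
    by (simp add: chr_def exp_add[symmetric] algebra_simps)
  have first: "TT G t y = ph t * ((1 + om * Ef (of_real t) / 2) * G (t - al) (y - be) + ?d * G (t - al - 1) (y - be) / 2)"
    unfolding TT_def WW_def p1 g1 oE by (simp add: algebra_simps)
  have "TT G (t - 1) y = (1 - om * Ef (of_real t) / 2) * (ph t * ?d * G (t - al - 1) (y - be)) + ph (t - 2) * G (t - 2 - al) (y - be) / 2"
    unfolding TT_def WW_def e1 oE p1(1) g1 by simp
  also have "ph (t - 2) * G (t - 2 - al) (y - be) = ph t * (?d * ?d * chr (- 1) (y - be)) * G (t - al) (y - be)"
    unfolding g p1 by simp
  finally have second: "TT G (t - 1) y = ph t * ((1 - om * Ef (of_real t) / 2) * ?d * G (t - al - 1) (y - be) + chr (- 1) y * G (t - al) (y - be) / 2)"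
    unfolding c by (simp add: algebra_simps)
  have o: "1 / om * om^2 = om" by (simp add: power2_eq_square om_facts(3))
  show ?thesis
    by (rule mat2_eqI; use om_facts(3) in \<open>simp add: vec_def amat_def tw_def first second Xf_real power2_eq_square field_simps\<close>)
qed

lemma tw_amat:
  "tw * amat (1 / om) om (Xf (of_real (y - be))) (Ef (of_real (t - al))) = amat p1 q1 (Xf (of_real y)) (Ef (of_real t)) * tw"
  "tw * (tw * amat (1 / om) om (Xf (of_real (y - be - be))) (Ef (of_real (t - al - al)))) = amat p2 q2 (Xf (of_real y)) (Ef (of_real t)) * (tw * tw)"
proof -
  have X: "Xf (of_real (y - b)) = Xf (of_real y) * exp (\<i> * of_real (2 * pi * b))" for b y
    using XE_shift(1)[of "of_real y" "- b"] by simp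
  have E: "Ef (of_real (t - a)) = Ef (of_real t) * exp (- (\<i> * of_real (pi * a)))" for a t
    using XE_shift(2)[of "of_real t" "- a"] by simp
  let ?u = "exp (\<i> * of_real (pi * be))" and ?v = "exp (- (\<i> * of_real (pi * al)))"
  have d: "exp (- (\<i> * of_real (pi * be))) = 1 / ?u" by (simp add: exp_minus field_simps)
  have u2: "exp (\<i> * of_real (2 * pi * be)) = ?u * ?u" by (simp add: exp_add[symmetric] algebra_simps)
  have v2: "exp (- (\<i> * of_real (2 * pi * al))) = ?v * ?v" by (simp add: exp_add[symmetric] algebra_simps)
  have XX: "Xf (of_real (y - be)) = Xf (of_real y) * (?u * ?u)" "Xf (of_real (y - be - be)) = Xf (of_real y) * (?u * ?u) * (?u * ?u)"
    unfolding X u2 by simp_all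
  have EE: "Ef (of_real (t - al)) = Ef (of_real t) * ?v" "Ef (of_real (t - al - al)) = Ef (of_real t) * ?v * ?v"
    unfolding E by simp_all
  have nz: "?u \<noteq> 0" "om \<noteq> 0" using om_facts(3) by auto
  note defs = p1_def q1_def p2_def q2_def u2 v2
  obtain u where u: "?u = u" by blast
  obtain v where v: "?v = v" by blast
  have nz: "u \<noteq> 0" "om \<noteq> 0" using om_facts(3) u by auto
  show "tw * amat (1 / om) om (Xf (of_real (y - be))) (Ef (of_real (t - al))) = amat p1 q1 (Xf (of_real y)) (Ef (of_real t)) * tw"
    unfolding XX EE defs amat_def tw_def d unfolding u v
    by (rule mat2_eqI; use nz in \<open>simp add: field_simps\<close>)
  show "tw * (tw * amat (1 / om) om (Xf (of_real (y - be - be))) (Ef (of_real (t - al - al)))) = amat p2 q2 (Xf (of_real y)) (Ef (of_real t)) * (tw * tw)"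
    unfolding XX EE defs amat_def tw_def d unfolding u v
    by (rule mat2_eqI; use nz in \<open>simp add: field_simps\<close>)
qed

text \<open>What remains of the three factors \<open>ph\<close> once \<open>- om * Ef\<close> has
  gone into \<open>rmat\<close>. It is not periodic in \<open>t\<close>; its change over one period
  is offset by the factor \<open>q3\<close> in \<open>kmat_equivariant\<close>.\<close>

definition "kap t = \<i> * exp (\<i> * of_real (pi * (e2 * t - e1 / 2 - e2 * (1 + e1) / 2)))"

lemma kap_eq: "- (om * Ef (of_real t)) * kap t = ph t * ph (t - al) * ph (t - al - al)"
proof -
  have al: "al = (1 + e1) / 3" and be: "be = (1 + e2) / 3" using e1 e2 by simp_all
  have i: "\<i> = - exp (- (\<i> * of_real (pi / 2)))" using cis_conv_exp[of "pi/2"] by (simp add: exp_minus)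
  have "- (om * Ef (of_real t)) * kap t = exp (of_real pi * \<i> * of_real t) * exp (- (\<i> * of_real (pi / 2))) *
     exp (\<i> * of_real (pi * (e2 * t - e1 / 2 - e2 * (1 + e1) / 2)))"
    unfolding kap_def Ef_def by (subst (2) i) (use om_facts(3) in simp)
  also have "\<dots> = exp (\<i> * of_real (pi * t - pi / 2 + pi * (e2 * t - e1 / 2 - e2 * (1 + e1) / 2)))"
    unfolding exp_add[symmetric] by (rule arg_cong[where f=exp]) (simp add: algebra_simps)
  also have "pi * t - pi / 2 + pi * (e2 * t - e1 / 2 - e2 * (1 + e1) / 2) =
     pi * (be * (t - al / 2)) + pi * (be * (t - al - al / 2)) + pi * (be * (t - al - al - al / 2))"
    unfolding al be by (simp add: field_simps)
  also have "exp (\<i> * of_real (pi * (be * (t - al / 2)) + pi * (be * (t - al - al / 2)) + pi * (be * (t - al - al - al / 2))))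
    = ph t * ph (t - al) * ph (t - al - al)"
    unfolding ph_def exp_add[symmetric] by (rule arg_cong[where f=exp]) (simp add: algebra_simps)
  finally show ?thesis .
qed

lemma kap_near: "\<bar>t\<bar> \<le> 2 \<Longrightarrow> norm (kap t - \<i>) \<le> 1 / 10^9" "norm (kap t) = 1"
proof -
  show "norm (kap t) = 1" by (simp add: kap_def norm_mult)
  assume t: "\<bar>t\<bar> \<le> 2"
  have "\<bar>e2 * t\<bar> \<le> 1 / 10^11 * 2" unfolding abs_mult using small t by (intro mult_mono) auto
  moreover have "\<bar>e2 * (1 + e1)\<bar> \<le> 1 / 10^11 * 2" unfolding abs_mult using small by (intro mult_mono) auto
  ultimately have d: "\<bar>e2 * t - e1 / 2 - e2 * (1 + e1) / 2\<bar> \<le> 4 / 10^11" using small by linarith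
  have "kap t - \<i> = \<i> * (exp (\<i> * of_real (pi * (e2 * t - e1 / 2 - e2 * (1 + e1) / 2))) - 1)"
    by (simp add: kap_def algebra_simps)
  then have "norm (kap t - \<i>) \<le> \<bar>pi * (e2 * t - e1 / 2 - e2 * (1 + e1) / 2)\<bar>"
    using norm_exp_i_minus_1 by (simp only: norm_mult norm_ii mult_1)
  also have "\<dots> \<le> 4 * (4 / 10^11)" unfolding abs_mult using d pi_less_4 by (intro mult_mono) auto
  finally show "norm (kap t - \<i>) \<le> 1 / 10^9" by simp
qed

lemma vec_cube:
  assumes G: "zak_class G"
  shows "vec (TT (TT (TT G))) t y = sc (kap t) * (kmat (Xf (of_real y)) (Ef (of_real t)) * vec G (t - e1) (y - e2))"
proof -
  define X where "X = Xf (of_real y)"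
  define E where "E = Ef (of_real t)"
  let ?A = "amat (1 / om) om" and ?V = "vec G (t - al - al - al) (y - be - be - be)"
  have "vec (TT (TT (TT G))) t y = sc (ph t) * (?A X E * (tw * (sc (ph (t - al)) *
     (?A (Xf (of_real (y - be))) (Ef (of_real (t - al))) * (tw * (sc (ph (t - al - al)) *
     (?A (Xf (of_real (y - be - be))) (Ef (of_real (t - al - al))) * (tw * ?V))))))))"
    by (simp only: vec_TT zak_class_TT G X_def E_def)
  also have "\<dots> = sc (ph t * ph (t - al) * ph (t - al - al)) * (?A X E * ((tw * ?A (Xf (of_real (y - be))) (Ef (of_real (t - al)))) * (tw *
     (?A (Xf (of_real (y - be - be))) (Ef (of_real (t - al - al))) * (tw * ?V)))))"
    by (simp only: sc_left[of tw] sc_left[of "amat p q X E" for p q X E] sc_simps(6) mult.assoc)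
  also have "\<dots> = sc (ph t * ph (t - al) * ph (t - al - al)) * (?A X E * (amat p1 q1 X E * ((tw * (tw *
     ?A (Xf (of_real (y - be - be))) (Ef (of_real (t - al - al))))) * (tw * ?V))))"
    unfolding tw_amat(1)[of y t] X_def E_def by (simp only: mult.assoc)
  also have "\<dots> = sc (ph t * ph (t - al) * ph (t - al - al)) * (?A X E * (amat p1 q1 X E * (amat p2 q2 X E * (tw * tw * tw * ?V))))"
    unfolding tw_amat(2)[of y t] X_def E_def by (simp only: mult.assoc)
  also have "sc (ph t * ph (t - al) * ph (t - al - al)) = sc (kap t) * sc (- (om * E))"
    unfolding kap_eq[symmetric] E_def sc_simps(6)[symmetric] by (simp only: mult.commute)
  also have "sc (kap t) * sc (- (om * E)) * (?A X E * (amat p1 q1 X E * (amat p2 q2 X E * (tw * tw * tw * ?V))))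
    = sc (kap t) * (?A X E * (amat p1 q1 X E * (amat p2 q2 X E * (sc (- (om * E)) * (tw * tw * tw * ?V)))))"
    by (simp only: sc_left[of "amat p q X E" for p q X E] mult.assoc)
  \<comment> \<open>\<open>?V\<close> sits at \<open>(t - e1 - 1, y - e2 - 1)\<close>. Undoing the
    period in \<open>t\<close> exchanges the two entries, which makes \<open>rmat\<close>
    antidiagonal, and \<open>tw\<close> to the third power contributes the phase
    \<open>- q3\<close>.\<close>
  also have "sc (- (om * E)) * (tw * tw * tw * ?V) = rmat q3 X E * vec G (t - e1) (y - e2)"
  proof -
    let ?d = "exp (- (\<i> * of_real (pi * be)))"
    have t: "t - al - al - al = t - e1 - 1" using e1 by simp
    have y: "y - be - be - be = y - e2 - 1" using e2 by simp
    have p: "G s (y - e2 - 1) = G s (y - e2)" for s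
    proof -
      have "G s ((y - e2 - 1) + 1) = G s (y - e2 - 1)" using G unfolding zak_class_def by blast
      then show ?thesis by simp
    qed
    have z: "G (t - e1 - 1 - 1) (y - e2) = chr (- 1) (y - e2) * G (t - e1) (y - e2)"
      using zak_class_minus[OF G, of "t - e1"] by simp
    have V: "?V = Mat2 (G (t - e1 - 1) (y - e2)) 0 (om * (chr (- 1) (y - e2) * G (t - e1) (y - e2))) 0"
      unfolding vec_def t y p z ..
    have "?d * ?d * ?d * chr (- 1) (y - e2) = - (q3 * chr (- 1) y)"
    proof -
      have be: "be = (1 + e2) / 3" using e2 by simp
      have "?d * ?d * ?d * chr (- 1) (y - e2) = exp (\<i> * of_real (pi * e2)) * chr (- 1) y * exp (- (\<i> * of_real pi))"
        unfolding chr_def exp_add[symmetric] by (rule arg_cong[where f=exp]) (simp add: be field_simps)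
      also have "exp (- (\<i> * of_real pi)) = - 1" by (simp add: exp_minus)
      finally show ?thesis by (simp add: q3_def)
    qed
    then have q: "E * (om * (om * (?d * ?d * ?d * chr (- 1) (y - e2) * G (t - e1) (y - e2)))) =
        - (E * (om * (om * (q3 * chr (- 1) y * G (t - e1) (y - e2)))))"
      by simp
    have X: "X = om * om * chr (- 1) y" by (simp add: X_def Xf_real power2_eq_square)
    show ?thesis
    proof (rule mat2_eqI)
      show "m21 (sc (- (om * E)) * (tw * tw * tw * ?V)) = m21 (rmat q3 X E * vec G (t - e1) (y - e2))"
        unfolding V unfolding tw_def rmat_def vec_def X using q by (simp add: mult_ac)
    qed (unfold V, simp_all add: tw_def rmat_def vec_def)
  qed
  finally show ?thesis by (simp only: kmat_def X_def E_def mult.assoc)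
qed

text \<open>The exponential gives the two entries opposite signs: on the window the vector is
  proportional to \<open>(hb t, - om * hb (t - 1))\<close>, the form required by
  \<open>pmat_first_entry\<close> and \<open>pmat_second_entry\<close>.\<close>

definition "hh t y = exp (of_real pi * \<i> * of_real t) * Gh t y"
definition "Pr t y = proj (of_real t) (of_real y)"
definition "G0 t y = m11 (Pr t y * vec hh t y)"
abbreviation "Xr y \<equiv> Xf (of_real y)"
abbreviation "Er t \<equiv> Ef (of_real t)"
abbreviation "P t y \<equiv> Pf (of_real t) (of_real y)"

lemma exp_back: "exp (of_real pi * \<i> * of_real (t - 1)) = - exp (of_real pi * \<i> * of_real t)"
proof -
  have "exp (of_real pi * \<i> * of_real (t - 1)) = exp (of_real pi * \<i> * of_real t) * exp (- (of_real pi * \<i>))"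
    by (simp add: exp_add[symmetric] algebra_simps)
  also have "exp (- (of_real pi * \<i>)) = (- 1 :: complex)" by (simp add: exp_minus)
  finally show ?thesis by simp
qed

lemma zak_class_hh: "zak_class hh"
proof -
  have "smooth2 (\<lambda>t y. exp (of_real pi * \<i> * of_real t))" using smooth2_expt[of 1 0] by simp
  then have "smooth2 hh" unfolding hh_def[abs_def] by (intro smooth2_mult smooth2_Gh)
  moreover have "exp (of_real pi * \<i> * of_real (t + 2)) = exp (of_real pi * \<i> * of_real t)" for t
  proof -
    have "t + 2 - 1 = t + 1" "t + 1 - 1 = t" by simp_all
    then show ?thesis using exp_back[of "t + 1"] exp_back[of "t + 2"] by (metis minus_minus)
  qed
  ultimately show ?thesis by (simp add: zak_class_def hh_def Gh_quasi_periodic)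
qed

lemma Pr_back: "Pr (t - 1) y * umat (Xr y) = umat (Xr y) * Pr t y"
  using proj_z_equivariant[of "of_real t" "of_real y"] by (simp add: Pr_def Uf_def)

lemma proj_vec_back: "Pr (t - 1) y * vec hh (t - 1) y = sc (1 / om) * (umat (Xr y) * (Pr t y * vec hh t y))"
proof -
  have "Pr (t - 1) y * vec hh (t - 1) y = sc (1 / om) * ((Pr (t - 1) y * umat (Xr y)) * vec hh t y)"
    unfolding vec_back[OF zak_class_hh] by (simp only: sc_left mult.assoc)
  then show ?thesis by (simp only: Pr_back mult.assoc)
qed

text \<open>A projected vector comes from a scalar function only if its second entry is
  \<open>om\<close> times its first entry at \<open>t - 1\<close>; this is the equivariance of the
  projection.\<close>

lemma vec_G0: "vec G0 t y = Pr t y * vec hh t y"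
proof (rule mat2_eqI)
  have "om * G0 (t - 1) y = m21 (Pr t y * vec hh t y)"
    unfolding G0_def proj_vec_back using om_facts(3) by (simp add: umat_def)
  then show "m21 (vec G0 t y) = m21 (Pr t y * vec hh t y)" by (simp add: vec_def)
qed (simp_all add: vec_def G0_def)

lemma zak_class_G0: "zak_class G0"
  unfolding zak_class_def
proof (intro conjI allI)
  have h: "smooth2 (\<lambda>t y. hh (t - a) y)" for a
    using smooth2_shift[of hh a 0] zak_class_hh by (simp add: zak_class_def)
  have "smooth2 (\<lambda>t y. m11 (Pr t y) * hh (t - 0) y + m12 (Pr t y) * (om * hh (t - 1) y))"
    unfolding Pr_def by (intro smooth2_add smooth2_mult smooth2_const smooth2_proj h)
  then show "smooth2 G0" by (simp add: G0_def[abs_def] vec_def)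
  fix t y
  have b: "vec G0 (t - 1) y = sc (1 / om) * (umat (Xr y) * vec G0 t y)" for t
    unfolding vec_G0 by (rule proj_vec_back)
  have "vec G0 t y = sc (1 / om) * (umat (Xr y) * (sc (1 / om) * (umat (Xr y) * vec G0 (t + 2) y)))"
    using b[of "t + 1"] b[of "t + 2"] by (simp add: add.commute)
  then have "G0 t y = 1 / om * (1 / om * (Xr y * G0 (t + 2) y))"
    by (auto dest!: arg_cong[where f=m11] simp: umat_def vec_def)
  then have "G0 t y = chr (- 1) y * G0 (t + 2) y"
    using om_facts(3) by (simp add: Xf_real power2_eq_square)
  moreover have "chr 1 y * chr (- 1) y = 1" using chr_add(1)[of 1 "- 1" y] by simp
  ultimately show "G0 (t + 2) y = chr 1 y * G0 t y" by (simp add: mult.assoc[symmetric])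
  have "Pr t (y + 1) = Pr t y" using proj_w_periodic[of "of_real t" "of_real y"] by (simp add: Pr_def)
  then show "G0 t (y + 1) = G0 t y"
    using zak_class_hh by (simp add: G0_def vec_def zak_class_def)
qed

section \<open>The multiplier of the cube on the line field\<close>

definition "den t y = tr (adj (kmat (Xr y) (Er t)) * Pr t y * P (t - e1) (y - e2))"
text \<open>Multiplying the fixed point equation by \<open>kmat\<close> turns the product with its
  adjugate into the determinant. Determinant over normalising trace is close to
  \<open>mpf * mmf / mpf\<close>, the small eigenvalue.\<close>

definition "c0 t y = dt2 (kmat (Xr y) (Er t)) / den t y"

lemma P_props: "dt2 (P t y) = 0" "tr (P t y) = 1" "norm (P t y) \<le> 5" "P t y * P t y = P t y"
  "P t y * Pr t y = P t y" "Pr t y * P t y = Pr t y"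
  using P_rank_one[of "of_real t" "of_real y"] near_proj_lim[of "of_real t" "of_real y"]
  by (auto simp: Pr_def near_proj_def intro: rank_one_idem)

lemma Mf_back: "Mf (of_real (t - e1)) (of_real (y - e2)) = adj (kmat (Xr y) (Er t))"
  unfolding Mf_def by (simp flip: of_real_add)

lemma vec_cube_G0:
  "vec (TT (TT (TT G0))) t y = sc (kap t * c0 t y) * (Pr t y * (P t y * (P (t - e1) (y - e2) * vec hh (t - e1) (y - e2))))"
proof -
  let ?t = "complex_of_real (t - e1)" and ?y = "complex_of_real (y - e2)" and ?K = "kmat (Xr y) (Er t)"
  have s: "?t + of_real e1 = of_real t" "?y + of_real e2 = of_real y" by (simp_all flip: of_real_add)
  have st: "?t \<in> strip (1/2000)" "?y \<in> strip (1/2000)" by (rule strip_of_real, simp)+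
  have "Pr (t - e1) (y - e2) = sc (1 / den t y) * (adj ?K * Pr t y * P (t - e1) (y - e2))"
    using proj_fix[OF st] unfolding s Mf_back graph_step_def Pr_def den_def by simp
  then have "?K * Pr (t - e1) (y - e2) = sc (1 / den t y) * ((?K * adj ?K) * (Pr t y * P (t - e1) (y - e2)))"
    by (simp only: sc_left mult.assoc)
  also have "\<dots> = sc (c0 t y) * (Pr t y * P (t - e1) (y - e2))"
    unfolding adj_mult by (simp add: c0_def mult.assoc[symmetric] sc_simps(6)[symmetric])
  \<comment> \<open>\<open>P t y\<close> is inserted by \<open>Pr t y * P t y = Pr t y\<close>. In
    \<open>ratio_window\<close> it brings the two vectors to be compared into one line.\<close>
  finally have "?K * Pr (t - e1) (y - e2) = sc (c0 t y) * (Pr t y * (P t y * P (t - e1) (y - e2)))"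
    using P_props(6) by (simp add: mult.assoc[symmetric])
  then show ?thesis
    unfolding vec_cube[OF zak_class_G0] vec_G0 by (simp add: sc_simps(6) mult.assoc[symmetric])
qed

lemma c0_near:
  fixes t y
  defines "m \<equiv> mmf (complex_of_real (t - e1)) (complex_of_real (y - e2))"
  shows "norm (c0 t y - m) \<le> 1 / 500" "norm m \<le> 7 / 10"
proof -
  let ?t = "complex_of_real (t - e1)" and ?y = "complex_of_real (y - e2)" and ?K = "kmat (Xr y) (Er t)"
  let ?P = "Pf ?t ?y"
  define p where "p = mpf ?t ?y"
  have s: "?t + of_real e1 = of_real t" "?y + of_real e2 = of_real y" by (simp_all flip: of_real_add)
  have st: "?t \<in> strip (1/2000)" "?y \<in> strip (1/2000)" by (rule strip_of_real, simp)+
  have "almost_split (adj ?K) ?P (Pf (of_real t) (of_real y)) p m"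
    using split[OF st] unfolding s Mf_back m_def p_def by simp
  then have A: "norm (adj ?K - (sc p * ?P + sc m * (1 - ?P))) \<le> 1 / 10^5" "9 / 5 \<le> norm p" "norm p \<le> 4" "norm m \<le> 7 / 10"
    "dt2 ?P = 0" "tr ?P = 1" "norm ?P \<le> 5"
    by (auto simp: almost_split_def)
  show "norm m \<le> 7 / 10" by (rule A)
  let ?B = "sc p * ?P + sc m * (1 - ?P)"
  have "norm ?B \<le> norm p * norm ?P + norm m * (1 + norm ?P)"
    using norm_triangle_ineq[of "sc p * ?P" "sc m * (1 - ?P)"] norm_triangle_ineq4[of 1 ?P]
      mult_left_mono[of "norm (1 - ?P)" "1 + norm ?P" "norm m"] by simp
  also have "\<dots> \<le> 4 * 5 + 7/10 * (1 + 5)" using A by (intro add_mono mult_mono) auto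
  finally have B0: "norm ?B \<le> 242 / 10" by simp
  then have B: "norm ?B \<le> 25" by simp
  have K: "norm (adj ?K) \<le> 25"
    using A(1) B0 norm_triangle_sub[of "adj ?K" ?B] by simp
  have dB: "dt2 ?B = p * m"
  proof -
    have "m11 ?P + m22 ?P = 1" "m11 ?P * m22 ?P = m12 ?P * m21 ?P" using A(5,6) by (auto simp: tr_def dt2_def)
    then show ?thesis unfolding dt2_def by simp algebra
  qed
  have d: "norm (dt2 ?K - p * m) \<le> 1 / 1000"
    using dt2_diff_le[OF K B A(1)] unfolding dB by simp
  have e: "norm (den t y - p) \<le> 1 / 500"
    using proj_denom[OF st] unfolding s Mf_back p_def den_def Pr_def by simp
  then have n: "norm (den t y) \<ge> 17/10" using A(2) norm_triangle_sub[of p "den t y"] by (simp add: norm_minus_commute)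
  then have "den t y \<noteq> 0" by auto
  then have "norm (c0 t y - m) = norm ((dt2 ?K - p * m) - m * (den t y - p)) / norm (den t y)"
    by (simp add: c0_def norm_divide[symmetric] field_simps)
  also have "\<dots> \<le> (1 / 1000 + 7 / 10 * (1 / 500)) / (17/10)"
  proof (rule frac_le)
    have "norm (m * (den t y - p)) \<le> 7 / 10 * (1 / 500)" unfolding norm_mult using e A(4) by (intro mult_mono) auto
    then show "norm ((dt2 ?K - p * m) - m * (den t y - p)) \<le> 1 / 1000 + 7 / 10 * (1 / 500)"
      using d norm_triangle_ineq4[of "dt2 ?K - p * m" "m * (den t y - p)"] by linarith
  qed (use n in auto)
  finally show "norm (c0 t y - m) \<le> 1 / 500" by simp
qed

lemma minus_Er: "- Er t = cis (pi * (t - 4/3))"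
proof -
  have "cis (pi * (t - 1/3)) = Er t"
    unfolding Ef_def exp_om[symmetric] exp_diff[symmetric] cis_conv_exp
    by (rule arg_cong[where f=exp]) (simp add: algebra_simps)
  moreover have "cis (pi * (t - 4/3)) = - cis (pi * (t - 1/3))"
  proof -
    have "pi * (t - 4/3) = pi * (t - 1/3) - pi" by (simp add: algebra_simps)
    then show ?thesis by (simp add: complex_eq_iff cos_diff sin_diff)
  qed
  ultimately show ?thesis by simp
qed

lemma vec_hh_window:
  assumes t: "5/6 \<le> t" "t \<le> 11/6"
  shows "vec hh t y = sc (exp (of_real pi * \<i> * of_real t)) * Mat2 (of_real (hb t)) 0 (- (om * of_real (hb (t - 1)))) 0"
    "norm (vec hh t y) \<le> 2" "norm (vec hh (t - e1) (y - e2) - vec hh t y) \<le> 1 / 10^9"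
proof -
  let ?e = "\<lambda>t. exp (of_real pi * \<i> * of_real t)"
  have "Gh t y = of_real (hb t)" "Gh (t - 1) y = of_real (hb (t - 1))" using Gh_window[OF t, of 0 y] by simp_all
  then have h: "hh t y = ?e t * of_real (hb t)" "hh (t - 1) y = ?e (t - 1) * of_real (hb (t - 1))"
    by (simp_all add: hh_def)
  show "vec hh t y = sc (?e t) * Mat2 (of_real (hb t)) 0 (- (om * of_real (hb (t - 1)))) 0"
    by (rule mat2_eqI) (simp_all only: vec_def mat2.sel mat2_sel sc_sel h exp_back, simp_all)
  have hb1: "hb s \<le> 1" for s
    by (simp add: hb_def bumpf_def)
  have n: "norm (?e s) = 1" for s by simp
  have nh: "norm (hh t y) \<le> 1" "norm (hh (t - 1) y) \<le> 1"
    unfolding h norm_mult n using hb1 hb_nonneg by auto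
  show "norm (vec hh t y) \<le> 2"
    using norm_mat2_le_sum[of "vec hh t y"] nh by (simp add: vec_def norm_mult om_facts(2))
  have e: "norm (?e (s - e1) - ?e s) \<le> 4 / 10^11" for s
  proof -
    have "?e (s - e1) = ?e s * exp (\<i> * of_real (- (pi * e1)))"
      unfolding exp_add[symmetric] by (rule arg_cong[where f=exp]) (simp add: algebra_simps)
    then have "?e (s - e1) - ?e s = ?e s * (exp (\<i> * of_real (- (pi * e1))) - 1)"
      by (simp only: right_diff_distrib mult_1_right)
    then have "norm (?e (s - e1) - ?e s) \<le> \<bar>- (pi * e1)\<bar>"
      using norm_exp_i_minus_1[of "- (pi * e1)"] by (simp only: norm_mult n mult_1)
    also have "\<dots> = pi * \<bar>e1\<bar>" by (simp add: abs_mult)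
    also have "\<dots> \<le> 4 * (1 / 10^11)" using pi_less_4 small by (intro mult_mono) auto
    finally show ?thesis by simp
  qed
  have d: "\<bar>e1\<bar> \<le> 1/1000" using small by simp
  have g: "norm (Gh (t - e1) (y - e2) - of_real (hb t)) \<le> 24 / 10^11"
    "norm (Gh (t - 1 - e1) (y - e2) - of_real (hb (t - 1))) \<le> 24 / 10^11"
    using Gh_window[OF t d, of "y - e2"] small by (auto simp: algebra_simps)
  have "norm (?e (t - e1) * Gh (t - e1) (y - e2) - ?e t * of_real (hb t)) \<le> 1 * (24 / 10^11) + 1 * (4 / 10^11)"
    using hb1[of t] hb_nonneg[of t] by (intro norm_mult_diff_le g e) auto
  then have 1: "norm (hh (t - e1) (y - e2) - hh t y) \<le> 28 / 10^11" unfolding h unfolding hh_def by simp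
  have "norm (?e (t - 1 - e1) * Gh (t - 1 - e1) (y - e2) - ?e (t - 1) * of_real (hb (t - 1))) \<le> 1 * (24 / 10^11) + 1 * (4 / 10^11)"
    using hb1[of "t - 1"] hb_nonneg[of "t - 1"] by (intro norm_mult_diff_le g e) auto
  then have 2: "norm (hh (t - 1 - e1) (y - e2) - hh (t - 1) y) \<le> 28 / 10^11" unfolding h unfolding hh_def by simp
  have "om * hh (t - e1 - 1) (y - e2) - om * hh (t - 1) y = om * (hh (t - 1 - e1) (y - e2) - hh (t - 1) y)"
    by (simp add: algebra_simps)
  then have "norm (om * hh (t - e1 - 1) (y - e2) - om * hh (t - 1) y) \<le> 28 / 10^11"
    using 2 by (simp only: norm_mult om_facts(2) mult_1)
  then show "norm (vec hh (t - e1) (y - e2) - vec hh t y) \<le> 1 / 10^9"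
    using norm_mat2_le_sum[of "vec hh (t - e1) (y - e2) - vec hh t y"] 1 by (simp add: vec_def)
qed

text \<open>The window is split at 4/3, where the two entries are equal; the larger one decides
  which row of \<open>pmat\<close> is estimated. It is at least 1/9, and the entry estimates lose a
  factor 100.\<close>

lemma P_vec_hh_lower:
  assumes t: "5/6 \<le> t" "t \<le> 11/6"
  shows "norm (P t y * vec hh t y) \<ge> 1 / 900"
proof -
  let ?N = "norm (P t y * vec hh t y)"
  have e: "norm (exp (of_real pi * \<i> * of_real t)) = 1" by simp
  have P: "P t y = pmat (Xr y) (- (- Er t))" by (simp add: Pf_def)
  let ?Q = "pmat (Xr y) (- (- Er t))"
  have n: "norm (- Er t) = 1" by simp
  have "m11 (P t y * vec hh t y) = exp (of_real pi * \<i> * of_real t) * (m11 ?Q * of_real (hb t) - m12 ?Q * (om * of_real (hb (t - 1))))"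
    "m21 (P t y * vec hh t y) = exp (of_real pi * \<i> * of_real t) * (m21 ?Q * of_real (hb t) - m22 ?Q * (om * of_real (hb (t - 1))))"
    unfolding vec_hh_window(1)[OF t] P by (simp_all add: algebra_simps)
  then have le: "norm (m11 ?Q * of_real (hb t) - m12 ?Q * (om * of_real (hb (t - 1)))) \<le> ?N"
    "norm (m21 ?Q * of_real (hb t) - m22 ?Q * (om * of_real (hb (t - 1)))) \<le> ?N"
    using norm_entries_le[of "P t y * vec hh t y"] by (simp_all only: norm_mult e mult_1)
  have Re: "Re (- Er t) \<ge> 0" unfolding minus_Er cis.sel
    by (rule cos_ge_zero) (use t pi_gt_zero in \<open>auto simp: field_simps\<close>)
  show ?thesis
  proof (cases "t \<le> 4/3")
    case True
    have "sin (- (pi * (t - 4/3))) \<ge> 0"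
    proof (rule sin_ge_zero)
      show "0 \<le> - (pi * (t - 4/3))" using True by (simp add: mult_le_0_iff)
      have "pi * (4/3 - t) \<le> pi * 1" using t by (intro mult_left_mono) auto
      then show "- (pi * (t - 4/3)) \<le> pi" by (simp add: algebra_simps)
    qed
    then have Im: "Im (- Er t) \<le> 0" unfolding minus_Er cis.sel by simp
    have "hb (t - 1) \<le> hb t" using t True by (intro hb_mono) auto
    moreover have "hb t \<ge> 1/9" by (rule hb_ge) (use t True in \<open>simp add: abs_le_iff\<close>)
    ultimately    show ?thesis using pmat_first_entry[OF norm_XE_real(1) n Re Im hb_nonneg, of "t - 1" "hb t" y] le(1) by simp
  next
    case False
    have "sin (pi * (t - 4/3)) \<ge> 0"
    proof (rule sin_ge_zero)
      have "pi * (t - 4/3) \<le> pi * 1" using t by (intro mult_left_mono) auto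
      then show "pi * (t - 4/3) \<le> pi" by simp
    qed (use False in simp)
    then have Im: "Im (- Er t) \<ge> 0" unfolding minus_Er cis.sel .
    have "hb t \<le> hb (t - 1)" using t False by (intro hb_mono) auto
    moreover have "hb (t - 1) \<ge> 1/9" by (rule hb_ge) (use t False in \<open>simp add: abs_le_iff\<close>)
    ultimately    show ?thesis using pmat_second_entry[OF norm_XE_real(1) n Re Im hb_nonneg, of t "hb (t - 1)" y] le(2) by simp
  qed
qed

section \<open>The multiplier as a smooth periodic function\<close>

definition "cubeT = TT (TT (TT G0))"

lemma zak_class_cubeT: "zak_class cubeT" unfolding cubeT_def by (intro zak_class_TT zak_class_G0)

text \<open>\<open>G0\<close> itself may have zeros; the values at \<open>t\<close> and
  \<open>t - 1\<close> together do not vanish, so the pair determines the multiplier.\<close>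

definition "ratio_at m t y \<longleftrightarrow> cubeT t y = m * G0 t y \<and> cubeT (t - 1) y = m * G0 (t - 1) y \<and>
  (G0 t y \<noteq> 0 \<or> G0 (t - 1) y \<noteq> 0) \<and> Re m > 0"

text \<open>The multiplier is \<open>kap t * c0 t y * k\<close>, where \<open>k\<close> compares the
  projected bump vectors at \<open>(t, y)\<close> and at the translated point. The factors are close
  to \<i>, to the small eigenvalue and to 1, so \<open>small_eigenvalue_Re\<close> settles the sign
  of the real part.\<close>

lemma ratio_window:
  assumes t: "5/6 \<le> t" "t \<le> 11/6" shows "\<exists>m. ratio_at m t y"
proof -
  let ?h = "vec hh t y" and ?P' = "P (t - e1) (y - e2)" and ?h' = "vec hh (t - e1) (y - e2)"
  let ?m = "mmf (complex_of_real (t - e1)) (complex_of_real (y - e2))"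
  note lower = P_vec_hh_lower[OF t, of y]
  then have Ph: "P t y * ?h \<noteq> 0" by auto
  obtain k where k: "P t y * (?P' * ?h') = sc k * (P t y * ?h)"
    by (rule column_collinear[OF P_props(1) Ph, of "?P' * ?h'"]) (auto simp: vec_def)
  have "norm (?P' - P t y) \<le> 1 / 10^5"
  proof -
    have st: "complex_of_real (t - e1) \<in> strip (1/2000)" "complex_of_real (y - e2) \<in> strip (1/2000)" by (rule strip_of_real, simp)+
    have s: "complex_of_real (t - e1) + of_real e1 = of_real t" "complex_of_real (y - e2) + of_real e2 = of_real y"
      by (simp_all flip: of_real_add)
    show ?thesis using Pf_shift_diff[OF st] unfolding s .
  qed
  then have diff: "norm (?P' * ?h' - P t y * ?h) \<le> 5 * (1 / 10^9) + 2 * (1 / 10^5)"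
    by (intro norm_mult_diff_le P_props(3) vec_hh_window(2,3) t)
  have eq: "sc (k - 1) * (P t y * ?h) = P t y * (?P' * ?h' - P t y * ?h)"
  proof -
    have "P t y * (P t y * ?h) = P t y * ?h" using P_props(4) by (simp add: mult.assoc[symmetric])
    then show ?thesis by (simp add: sc_simps(2,4) right_diff_distrib left_diff_distrib k del: of_real_diff)
  qed
  have "norm (k - 1) * norm (P t y * ?h) = norm (sc (k - 1) * (P t y * ?h))" by (simp only: norm_sc_mult)
  also have "\<dots> \<le> norm (P t y) * norm (?P' * ?h' - P t y * ?h)" unfolding eq by (rule norm_mult_ineq)
  also have "\<dots> \<le> 5 * (5 * (1 / 10^9) + 2 * (1 / 10^5))" by (intro mult_mono P_props diff) auto
  finally have "norm (k - 1) * norm (P t y * ?h) \<le> 5 * (5 * (1 / 10^9) + 2 * (1 / 10^5))" .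
  moreover have "norm (k - 1) * (1 / 900) \<le> norm (k - 1) * norm (P t y * ?h)"
    using lower by (intro mult_left_mono) auto
  \<comment> \<open>Up to a tiny term the bound is 900 * 5 * 2 / 10^5 = 0.09, the drift of
    \<open>P\<close> divided by the lower bound 1/900.\<close>
  ultimately have k1: "norm (k - 1) \<le> 91 / 1000" by simp
  define c where "c = c0 t y"
  have c: "norm (c - ?m) \<le> 1 / 500" "norm ?m \<le> 7 / 10" unfolding c_def by (rule c0_near)+
  then have cn: "norm c \<le> 702 / 1000" using norm_triangle_sub[of c ?m] by simp
  have kap: "norm (kap t) = 1" "norm (kap t - \<i>) \<le> 1 / 10^9" using kap_near t by auto
  define m where "m = kap t * c * k"
  have "m - \<i> * ?m = kap t * c * (k - 1) + ((kap t - \<i>) * c + \<i> * (c - ?m))" by (simp add: m_def algebra_simps)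
  then have "norm (m - \<i> * ?m) \<le> norm (kap t * c * (k - 1)) + (norm ((kap t - \<i>) * c) + norm (\<i> * (c - ?m)))"
    using norm_triangle_ineq norm_triangle_mono by (metis order_refl)
  also have "\<dots> \<le> 702 / 1000 * (91 / 1000) + (1 / 10^9 * (702 / 1000) + 1 / 500)"
    unfolding norm_mult kap(1) norm_ii mult_1 by (intro add_mono mult_mono cn k1 kap c) auto
  finally have "\<bar>Re (m - \<i> * ?m)\<bar> < 1/10" using abs_Re_le_cmod[of "m - \<i> * ?m"] by simp
  moreover have "Re (\<i> * ?m) \<ge> 1/10" by (rule small_eigenvalue_Re) (rule norm_XE_real)+
  ultimately have "Re m > 0" unfolding minus_complex.sel by linarith
  moreover have "vec cubeT t y = sc m * vec G0 t y"
  proof -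
    have "vec cubeT t y = sc (kap t * c) * (Pr t y * (sc k * (P t y * ?h)))"
      unfolding cubeT_def vec_cube_G0 k c_def ..
    also have "\<dots> = sc m * ((Pr t y * P t y) * ?h)"
      unfolding m_def by (simp only: sc_left[of "Pr t y"] sc_simps(6) mult.assoc)
    finally show ?thesis unfolding P_props(6) vec_G0 .
  qed
  then have "m11 (vec cubeT t y) = m11 (sc m * vec G0 t y)" "m21 (vec cubeT t y) = m21 (sc m * vec G0 t y)"
    by simp_all
  then have "cubeT t y = m * G0 t y" "cubeT (t - 1) y = m * G0 (t - 1) y"
    using om_facts(3) by (simp_all add: vec_def)
  moreover have "G0 t y \<noteq> 0 \<or> G0 (t - 1) y \<noteq> 0"
  proof (rule ccontr)
    assume "\<not> ?thesis"
    then have "vec G0 t y = 0" by (auto intro!: mat2_eqI simp: vec_def)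
    then have "P t y * Pr t y * ?h = 0" unfolding vec_G0 by (simp add: mult.assoc)
    then show False using Ph unfolding P_props(5) by simp
  qed
  ultimately show ?thesis unfolding ratio_at_def by blast
qed

lemma ratio_back: "ratio_at m (t - 1) y \<longleftrightarrow> ratio_at m t y"
  using zak_class_minus[OF zak_class_cubeT, of t y] zak_class_minus[OF zak_class_G0, of t y]
  by (auto simp: ratio_at_def)

lemma ratio_shift: "ratio_at m (t + of_int n) y \<longleftrightarrow> ratio_at m t y"
proof (induction n rule: int_induct[of _ 0])
  case (step1 i)
  then show ?case using ratio_back[of m "t + of_int (i + 1)" y] by simp
next
  case (step2 i)
  then show ?case using ratio_back[of m "t + of_int i" y] by (simp add: add_diff_eq)
qed simp

lemma ratio_y: "ratio_at m t (y + 1) \<longleftrightarrow> ratio_at m t y"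
  using zak_class_cubeT zak_class_G0 by (simp add: ratio_at_def zak_class_def)

lemma ratio_exists: "\<exists>m. ratio_at m t y"
proof -
  have "\<exists>m. ratio_at m (t + of_int (- \<lfloor>t - 5/6\<rfloor>)) y"
    by (rule ratio_window) (simp, linarith+)
  then show ?thesis unfolding ratio_shift .
qed

text \<open>The quotient of two parallel vectors by means of the inner product: no choice of a
  nonvanishing entry is made, the denominator is a positive squared length, and smoothness can be
  read off.\<close>

definition "ratio t y = (cnj (G0 t y) * cubeT t y + cnj (G0 (t - 1) y) * cubeT (t - 1) y) *
  inverse (cnj (G0 t y) * G0 t y + cnj (G0 (t - 1) y) * G0 (t - 1) y)"

lemma ratio_denom:
  "cnj (G0 t y) * G0 t y + cnj (G0 (t - 1) y) * G0 (t - 1) y \<noteq> 0"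
proof -
  have "cnj a * a + cnj b * b \<noteq> 0" if "a \<noteq> 0 \<or> b \<noteq> 0" for a b :: complex
  proof -
    have "cnj a * a + cnj b * b = of_real ((norm a)^2 + (norm b)^2)"
      by (simp only: of_real_add complex_norm_square mult.commute)
    moreover have "(norm a)^2 + (norm b)^2 > 0" using that by (simp add: sum_power2_gt_zero_iff)
    ultimately show ?thesis by (metis less_irrefl of_real_eq_0_iff)
  qed
  then show ?thesis using ratio_exists[of t y] unfolding ratio_at_def by blast
qed

lemma ratio_eq: "ratio_at m t y \<Longrightarrow> ratio t y = m"
  using ratio_denom[of t y] unfolding ratio_def ratio_at_def by (simp add: field_simps)

lemma ratio_props: "cubeT t y = ratio t y * G0 t y" "Re (ratio t y) > 0" "per2 ratio" "smooth2 ratio"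
proof -
  show "cubeT t y = ratio t y * G0 t y" "Re (ratio t y) > 0"
    using ratio_exists[of t y] ratio_eq unfolding ratio_at_def by metis+
  have "ratio (t + 1) y = ratio t y \<and> ratio t (y + 1) = ratio t y" for t y
    using ratio_exists[of t y] ratio_eq ratio_shift[of _ t 1 y] ratio_y[of _ t y] by (metis of_int_1)
  then show "per2 ratio" by (simp add: per2_def)
  have s: "smooth2 (\<lambda>t y. G0 (t - a) y)" "smooth2 (\<lambda>t y. cubeT (t - a) y)" for a
    using smooth2_shift[of G0 a 0] smooth2_shift[of cubeT a 0] zak_class_G0 zak_class_cubeT by (simp_all add: zak_class_def)
  have "smooth2 (\<lambda>t y. (cnj (G0 (t - 0) y) * cubeT (t - 0) y + cnj (G0 (t - 1) y) * cubeT (t - 1) y) *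
    inverse (cnj (G0 (t - 0) y) * G0 (t - 0) y + cnj (G0 (t - 1) y) * G0 (t - 1) y))"
    by (intro smooth2_mult smooth2_add smooth2_inverse smooth2_cnj s) (use ratio_denom in simp)
  then show "smooth2 ratio" unfolding ratio_def[abs_def] by simp
qed

text \<open>Three shifts move \<open>\<phi>\<close> by \<open>(e1, e2)\<close> modulo its periods,
  so the factor \<open>exp (\<phi> t y)\<close> replaces the multiplier \<open>ratio\<close> by
  \<open>ratio * exp (\<phi> (t - e1) (y - e2) - \<phi> t y)\<close>, and this is the constant
  \<open>exp c\<close>.\<close>

lemma eigenfunction_exists:
  assumes "diophantine e1 e2"
  shows "\<exists>f c. schwartz f \<and> (\<exists>t. f t \<noteq> 0) \<and> c \<noteq> 0 \<and> (\<forall>t. trinomial_op (weyl al (be / 2) f) t = c * f t)"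
proof -
  have l: "smooth2 (\<lambda>t y. Ln (ratio t y))" "per2 (\<lambda>t y. Ln (ratio t y))"
    using ratio_props by (auto intro: smooth2_Ln simp: per2_def)
  obtain \<phi> c where \<phi>: "smooth2 \<phi>" "per2 \<phi>" "\<And>t y. \<phi> t y - \<phi> (t - e1) (y - e2) = Ln (ratio t y) - c"
    using cohomological_equation[OF l assms] by blast
  define G where "G t y = exp (\<phi> t y) * G0 t y" for t y
  have per: "\<phi> (t + 1) y = \<phi> t y" "\<phi> t (y + 1) = \<phi> t y" for t y using \<phi>(2) by (auto simp: per2_def)
  have "\<phi> (t + 2) y = \<phi> t y" for t y using per(1)[of "t + 1" y] per(1)[of t y] by (simp add: add.assoc)
  moreover have "smooth2 G"
    unfolding G_def[abs_def] using zak_class_G0 by (intro smooth2_mult smooth2_exp \<phi>(1)) (simp add: zak_class_def)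
  ultimately have G: "zak_class G" using zak_class_G0 per by (simp add: zak_class_def G_def)
  have T: "TT (\<lambda>t y. exp (\<phi> (t - a) (y - b)) * F t y) = (\<lambda>t y. exp (\<phi> (t - al - a) (y - be - b)) * TT F t y)" for a b F
  proof (intro ext TT_mult_periodic)
    fix t y show "exp (\<phi> (t + 1 - a) (y - b)) = exp (\<phi> (t - a) (y - b))"
      using per(1)[of "t - a" "y - b"] by (simp add: algebra_simps)
  qed
  have "TT (TT (TT G)) t y = exp c * G t y" for t y
  proof -
    have "G = (\<lambda>t y. exp (\<phi> (t - 0) (y - 0)) * G0 t y)" by (simp add: G_def[abs_def])
    then have "TT G = (\<lambda>t y. exp (\<phi> (t - al) (y - be)) * TT G0 t y)" using T[of 0 0 G0] by simp
    then have "TT (TT G) = (\<lambda>t y. exp (\<phi> (t - al - al) (y - be - be)) * TT (TT G0) t y)" using T[of al be "TT G0"] by simp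
    then have "TT (TT (TT G)) t y = exp (\<phi> (t - al - (al + al)) (y - be - (be + be))) * cubeT t y"
      using T[of "al + al" "be + be" "TT (TT G0)"] by (simp add: cubeT_def diff_diff_eq)
    also have "\<phi> (t - al - (al + al)) (y - be - (be + be)) = \<phi> (t - e1) (y - e2)"
    proof -
      have s: "t - al - (al + al) = t - e1 - 1" "y - be - (be + be) = y - e2 - 1" using e1 e2 by simp_all
      show ?thesis
        unfolding s using per(1)[of "t - e1 - 1" "y - e2 - 1"] per(2)[of "t - e1" "y - e2 - 1"] by simp
    qed
    also have "\<phi> (t - e1) (y - e2) = \<phi> t y + c - Ln (ratio t y)" using \<phi>(3)[of t y] by (simp add: algebra_simps)
    also have "exp (\<phi> t y + c - Ln (ratio t y)) * cubeT t y = exp c * G t y"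
    proof -
      have "ratio t y \<noteq> 0" using ratio_props(2)[of t y] by auto
      then show ?thesis unfolding ratio_props(1) G_def by (simp add: exp_diff exp_add)
    qed
    finally show ?thesis .
  qed
  moreover obtain t0 y0 where "G t0 y0 \<noteq> 0"
  proof -
    have "G0 0 0 \<noteq> 0 \<or> G0 (0 - 1) 0 \<noteq> 0" using ratio_exists[of 0 0] unfolding ratio_at_def by blast
    then show ?thesis using that by (auto simp: G_def)
  qed
  ultimately obtain F l t y where F: "zak_class F" "F t y \<noteq> 0" "l \<noteq> 0" "\<And>t y. TT F t y = l * F t y"
    using eigenfunction_from_cube[OF G, of t0 y0 "exp c"] by auto
  show ?thesis
    using zint_schwartz[OF F(1)] zint_nonzero[OF F(1,2)] F(3) zint_eigenfunction[OF F(1,4)] by blast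
qed

end

theorem theorem1p1:
  fixes \<alpha> \<beta> :: real
  assumes "\<alpha> = 1 / 3 + 1 / 10 ^ 12 * sqrt 2"
    and "\<beta> = 1 / 3 + 1 / 10 ^ 12 * sqrt 3"
  shows "\<exists>(f :: real \<Rightarrow> complex) (c :: complex).
    schwartz f \<and> (\<exists>t. f t \<noteq> 0) \<and> c \<noteq> 0 \<and>
    (\<forall>t. trinomial_op (weyl \<alpha> (\<beta> / 2) f) t = c * f t)"
proof -
  have "sqrt 2 \<le> 2" "sqrt 3 \<le> 2" by (rule real_le_lsqrt; simp)+
  then interpret cube \<alpha> \<beta> "3 / 10^12 * sqrt 2" "3 / 10^12 * sqrt 3"
    by unfold_locales (simp_all add: assms field_simps)
  show ?thesis by (rule eigenfunction_exists[OF diophantine_sqrt2_sqrt3])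
qed

end
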